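(* There exists a universal constant $M\ge1$ such that the following holds. Let $d\ge 1$ be an integer, let $E>0$ and $\lambda\ge 0$ be real numbers, and for each $i=1,\dots,d$ let $\phi_i:[0,\infty)\to[0,\infty)$ be finite, convex and strictly increasing with $\phi_i(0)=0$ and $\lim_{r\to\infty}\phi_i(r)=\infty$. Let $X$ be a random vector in $\mathbb R^d$ whose density is proportional to $$e^{-\lambda\sum_{i=1}^d|x_i|}\,\mathbf 1_{\{\sum_{i=1}^d\phi_i(|x_i|)\le E\}}.$$ Then there exists a parameter $\tau>0$ (depending on the distribution of $X$) such that the random vector $V=(V_1,\dots,V_d)$ with independent coordinates, where $V_i$ has density $$f_{i,\tau}(v)=c_{i,\tau}\exp\{-\lambda|v|-\tau\phi_i(|v|)\},\qquad v\in\mathbb R,$$ ($c_{i,\tau}$ being the normalizing constant), satisfies $$X\preceq_{\mathrm{cx}}2MV\qquad\text{and}\qquad \mathbb E\,q(V)\le 2\,\mathbb E\,q(X)\ \text{ for every seminorm } q \text{ on }\mathbb R^d.$$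
   Context: For integrable random vectors $Y,Z$ in $\mathbb R^d$, convex order $Y\preceq_{\mathrm{cx}}Z$ means $\mathbb E f(Y)\le\mathbb E f(Z)$ for every convex function $f:\mathbb R^d\to\mathbb R$ (expectations of convex functions of integrable vectors are well defined in $(-\infty,+\infty]$). *)

theory Defs
  imports "HOL-Probability.Probability"
begin

text \<open>
  The constant in the theorem is uniform in the dimension, so \<open>d\<close> has to be a term and not a type.
  The space \<open>\<real>\<^sup>d\<close> is the set of extensional functions on \<open>{..<d}\<close> (value \<open>undefined\<close> outside
  \<open>{..<d}\<close>), i.e. the space of the finite product measure; coordinates are numbered from \<open>0\<close>.
\<close>

definition lborel_vec :: "nat \<Rightarrow> (nat \<Rightarrow> real) measure" where
  "lborel_vec d = Pi\<^sub>M {..<d} (\<lambda>_. lborel)"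

definition Rvec :: "nat \<Rightarrow> (nat \<Rightarrow> real) set" where
  "Rvec d = {..<d} \<rightarrow>\<^sub>E UNIV"

definition vadd :: "nat \<Rightarrow> (nat \<Rightarrow> real) \<Rightarrow> (nat \<Rightarrow> real) \<Rightarrow> (nat \<Rightarrow> real)" where
  "vadd d x y = (\<lambda>i\<in>{..<d}. x i + y i)"

definition vscale :: "nat \<Rightarrow> real \<Rightarrow> (nat \<Rightarrow> real) \<Rightarrow> (nat \<Rightarrow> real)" where
  "vscale d a x = (\<lambda>i\<in>{..<d}. a * x i)"

definition convex_fun :: "nat \<Rightarrow> ((nat \<Rightarrow> real) \<Rightarrow> real) \<Rightarrow> bool" where
  "convex_fun d f \<longleftrightarrow>
     (\<forall>x\<in>Rvec d. \<forall>y\<in>Rvec d. \<forall>t\<in>{0..1}.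
        f (vadd d (vscale d (1 - t) x) (vscale d t y)) \<le> (1 - t) * f x + t * f y)"

definition seminorm :: "nat \<Rightarrow> ((nat \<Rightarrow> real) \<Rightarrow> real) \<Rightarrow> bool" where
  "seminorm d q \<longleftrightarrow>
     (\<forall>x\<in>Rvec d. 0 \<le> q x) \<and>
     (\<forall>x\<in>Rvec d. \<forall>a. q (vscale d a x) = \<bar>a\<bar> * q x) \<and>
     (\<forall>x\<in>Rvec d. \<forall>y\<in>Rvec d. q (vadd d x y) \<le> q x + q y)"

text \<open>
  Expectation with values in the extended reals: integral of the positive part minus integral of the
  negative part (\<open>ennreal\<close> truncates negative numbers to \<open>0\<close>). The Bochner integral would give \<open>0\<close>
  for a function whose expectation is infinite.
\<close>

definition ext_expectation :: "'a measure \<Rightarrow> ('a \<Rightarrow> real) \<Rightarrow> ereal" where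
  "ext_expectation P g =
     enn2ereal (\<integral>\<^sup>+\<omega>. ennreal (g \<omega>) \<partial>P) - enn2ereal (\<integral>\<^sup>+\<omega>. ennreal (- g \<omega>) \<partial>P)"

definition integrable_random_vector :: "nat \<Rightarrow> 'a measure \<Rightarrow> ('a \<Rightarrow> nat \<Rightarrow> real) \<Rightarrow> bool" where
  "integrable_random_vector d P Y \<longleftrightarrow>
     prob_space P \<and> Y \<in> P \<rightarrow>\<^sub>M lborel_vec d \<and> (\<forall>i<d. integrable P (\<lambda>\<omega>. Y \<omega> i))"

text \<open>
  Convex order between a random vector \<open>Y\<close> on \<open>P\<close> and a random vector \<open>Z\<close> on \<open>Q\<close>. No measurability
  of \<open>f\<close> is demanded, since finite convex functions on \<open>\<real>\<^sup>d\<close> are continuous.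
\<close>

definition convex_order ::
  "nat \<Rightarrow> 'a measure \<Rightarrow> ('a \<Rightarrow> nat \<Rightarrow> real) \<Rightarrow> 'b measure \<Rightarrow> ('b \<Rightarrow> nat \<Rightarrow> real) \<Rightarrow> bool" where
  "convex_order d P Y Q Z \<longleftrightarrow>
     integrable_random_vector d P Y \<and> integrable_random_vector d Q Z \<and>
     (\<forall>f. convex_fun d f \<longrightarrow>
        ext_expectation P (\<lambda>\<omega>. f (Y \<omega>)) \<le> ext_expectation Q (\<lambda>\<omega>. f (Z \<omega>)))"

definition admissible_phi :: "(real \<Rightarrow> real) \<Rightarrow> bool" where
  "admissible_phi \<phi> \<longleftrightarrow>
     \<phi> \<in> {0..} \<rightarrow> {0..} \<and> convex_on {0..} \<phi> \<and> strict_mono_on {0..} \<phi> \<and>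
     \<phi> 0 = 0 \<and> filterlim \<phi> at_top at_top"

definition X_weight :: "nat \<Rightarrow> real \<Rightarrow> real \<Rightarrow> (nat \<Rightarrow> real \<Rightarrow> real) \<Rightarrow> (nat \<Rightarrow> real) \<Rightarrow> real" where
  "X_weight d E lam \<phi> x =
     exp (- lam * (\<Sum>i<d. \<bar>x i\<bar>)) * indicator {x. (\<Sum>i<d. \<phi> i \<bar>x i\<bar>) \<le> E} x"

text \<open>
  Laws on \<open>\<real>\<^sup>d\<close> stand for random vectors: \<open>X\<close> is the identity on the probability space \<open>\<mu>\<close>, and
  \<open>V\<close> below the identity on \<open>\<nu>\<close>, with coordinate variables \<open>\<lambda>v. v i\<close>.
\<close>

definition is_law_X ::
  "nat \<Rightarrow> real \<Rightarrow> real \<Rightarrow> (nat \<Rightarrow> real \<Rightarrow> real) \<Rightarrow> (nat \<Rightarrow> real) measure \<Rightarrow> bool" where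
  "is_law_X d E lam \<phi> \<mu> \<longleftrightarrow>
     prob_space \<mu> \<and>
     (\<exists>c>0. \<mu> = density (lborel_vec d) (\<lambda>x. ennreal (c * X_weight d E lam \<phi> x)))"

definition V_density :: "real \<Rightarrow> real \<Rightarrow> (real \<Rightarrow> real) \<Rightarrow> real \<Rightarrow> real" where
  "V_density lam \<tau> \<phi> v =
     exp (- lam * \<bar>v\<bar> - \<tau> * \<phi> \<bar>v\<bar>) / (LINT u|lborel. exp (- lam * \<bar>u\<bar> - \<tau> * \<phi> \<bar>u\<bar>))"

definition is_law_V ::
  "nat \<Rightarrow> real \<Rightarrow> real \<Rightarrow> (nat \<Rightarrow> real \<Rightarrow> real) \<Rightarrow> (nat \<Rightarrow> real) measure \<Rightarrow> bool" where
  "is_law_V d lam \<tau> \<phi> \<nu> \<longleftrightarrow>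
     prob_space \<nu> \<and> sets \<nu> = sets (lborel_vec d) \<and>
     prob_space.indep_vars \<nu> (\<lambda>_. borel) (\<lambda>i v. v i) {..<d} \<and>
     (\<forall>i<d. distributed \<nu> lborel (\<lambda>v. v i) (\<lambda>v. ennreal (V_density lam \<tau> (\<phi> i) v)))"

end

theory Submission
  imports Defs
begin

text \<open>
  Write \<open>\<Phi>(x) = \<Sum>i. \<phi> i \<bar>x i\<bar>\<close> and let \<open>X_s\<close> be the vector with density proportional to
  \<open>exp (- lam * \<Sum>i. \<bar>x i\<bar>)\<close> on \<open>{\<Phi> \<le> s}\<close>, so that \<open>X = X_E\<close>. Since \<open>exp (- \<tau> \<Phi>)\<close> is the integral of
  \<open>\<tau> exp (- \<tau> s)\<close> over \<open>s \<ge> \<Phi>\<close>, the vector \<open>V\<close> is the mixture of the \<open>X_s\<close> in which the level \<open>T\<close> has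
  density proportional to \<open>exp (- \<tau> s) G(s)\<close>, where \<open>G(s)\<close> is the weighted volume of \<open>{\<Phi> \<le> s}\<close>.
  By induction on the dimension, \<open>G\<close> is log-concave and \<open>(\<bar>X_s i\<bar>)\<close> is stochastically increasing in \<open>s\<close>.

  After averaging over sign changes, a convex function is nondecreasing in every \<open>\<bar>x i\<bar>\<close>. Hence
  \<open>E f(X) \<le> E [f(V) | T \<ge> E]\<close>, and if \<open>P(T \<ge> E) \<ge> p\<close> then convexity along rays from the origin gives
  \<open>X \<preceq> V / p\<close> in convex order. For the seminorm bound, \<open>E [q(V); T \<le> E] \<le> E q(X)\<close>, and the contribution
  of \<open>T > E\<close> is controlled by an exponential tilt from \<open>\<tau>\<close> to a smaller \<open>\<tau>'\<close>: the tilted vector is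
  dominated by \<open>(\<tau> / \<tau>') V\<close>. Log-concavity of \<open>G\<close> makes it possible to choose \<open>\<tau>'\<close> and \<open>\<tau>\<close> so that
  this contribution is at most half of \<open>E q(V)\<close> while \<open>P(T \<ge> E)\<close> stays above a universal constant.
\<close>

section \<open>Convex profiles and the one-dimensional weight\<close>

text \<open>Two parameters are forced by the exact constant 2 in the seminorm bound. Put
  \<open>H(\<tau>) = \<integral> exp (- \<tau> (s - E)) G(s) ds\<close> and
  \<open>k = \<tau> / \<tau>'\<close>. The tilt costs a factor \<open>k\<close> in the weight of the
  levels above \<open>E\<close>, and homogeneity of the seminorm costs another \<open>k\<close>;
  after normalisation the contribution of \<open>T > E\<close> is at most
  \<open>(H(\<tau>') / \<tau>') / (H(\<tau>) / \<tau>)\<close> times \<open>E q(V)\<close>. Hence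
  \<open>\<tau>\<close> is found by doubling \<open>H(\<tau>) / \<tau>\<close>. The starting value
  \<open>\<tau>'\<close> gives \<open>T > E\<close> probability 1/4, which is small enough for
  log-concavity to control the moment of \<open>T\<close> above \<open>E\<close> by the one below.
  The size of the constant comes from a crude bound on \<open>k\<close> by 5000: the mean tilt below
  \<open>E\<close> then has exponential at most 15000, and the upper mass decays by at most the
  ninth power of this. Ratios such as \<open>E f(X_s)\<close>, an integral divided by
  \<open>G(s)\<close>, are mostly compared cross-multiplied in \<open>ennreal\<close>, which admits
  infinite integrals and levels of volume zero.\<close>

lemma admissible_convex_abs:
  assumes "admissible_phi \<phi>"
  shows "convex_on UNIV (\<lambda>x. \<phi> \<bar>x\<bar>)"
proof (rule convex_onI)
  fix t x y :: real
  assume t: "0 < t" "t < 1"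
  have c: "convex_on {0..} \<phi>" and m: "mono_on {0..} \<phi>"
    using assms strict_mono_on_imp_mono_on by (auto simp: admissible_phi_def)
  have "\<bar>(1 - t) *\<^sub>R x + t *\<^sub>R y\<bar> \<le> \<bar>(1 - t) * x\<bar> + \<bar>t * y\<bar>"
    using abs_triangle_ineq by simp
  also have "\<dots> = (1 - t) * \<bar>x\<bar> + t * \<bar>y\<bar>"
    using t by (simp add: abs_mult)
  finally have "\<phi> \<bar>(1 - t) *\<^sub>R x + t *\<^sub>R y\<bar> \<le> \<phi> ((1 - t) * \<bar>x\<bar> + t * \<bar>y\<bar>)"
    using m t by (intro mono_onD[OF m]) auto
  also have "\<dots> \<le> (1 - t) * \<phi> \<bar>x\<bar> + t * \<phi> \<bar>y\<bar>"
    using convex_onD[OF c, of t "\<bar>x\<bar>" "\<bar>y\<bar>"] t by simp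
  finally show "\<phi> \<bar>(1 - t) *\<^sub>R x + t *\<^sub>R y\<bar> \<le> (1 - t) * \<phi> \<bar>x\<bar> + t * \<phi> \<bar>y\<bar>" .
qed simp

text \<open>The even extension puts the endpoint 0 inside an open domain, where convexity alone
  gives continuity.\<close>

lemma admissible_continuous_abs:
  assumes "admissible_phi \<phi>"
  shows "continuous_on UNIV (\<lambda>x. \<phi> \<bar>x\<bar>)"
  using convex_on_continuous[OF open_UNIV admissible_convex_abs[OF assms]] .

lemma admissible_measurable_abs:
  assumes "admissible_phi \<phi>"
  shows "(\<lambda>x. \<phi> \<bar>x\<bar>) \<in> borel_measurable borel"
  using admissible_continuous_abs[OF assms] by (rule borel_measurable_continuous_onI)

lemma admissible_strict_mono:
  assumes "admissible_phi \<phi>" "0 \<le> x" "x < y"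
  shows "\<phi> x < \<phi> y"
  using assms by (auto simp: admissible_phi_def intro: strict_mono_onD)

lemma admissible_mono:
  assumes "admissible_phi \<phi>" "0 \<le> x" "x \<le> y"
  shows "\<phi> x \<le> \<phi> y"
  using admissible_strict_mono[OF assms(1,2), of y] assms(3) by (cases "x = y") auto

lemma admissible_le_iff:
  assumes "admissible_phi \<phi>" "0 \<le> x" "0 \<le> y"
  shows "\<phi> x \<le> \<phi> y \<longleftrightarrow> x \<le> y"
  using admissible_strict_mono[OF assms(1), of y x] admissible_mono[OF assms(1), of x y] assms(2,3)
  by (meson leD leI)

lemma admissible_zero: "admissible_phi \<phi> \<Longrightarrow> \<phi> 0 = 0"
  by (simp add: admissible_phi_def)

lemma admissible_nonneg: "admissible_phi \<phi> \<Longrightarrow> 0 \<le> x \<Longrightarrow> 0 \<le> \<phi> x"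
  using admissible_mono[of \<phi> 0 x] admissible_zero[of \<phi>] by simp

lemma admissible_pos: "admissible_phi \<phi> \<Longrightarrow> 0 < x \<Longrightarrow> 0 < \<phi> x"
  using admissible_strict_mono[of \<phi> 0 x] admissible_zero[of \<phi>] by simp

text \<open>The points \<open>x + D\<close> and \<open>y\<close> divide the segment from
  \<open>x\<close> to \<open>y + D\<close> with complementary weights, so the sum of the two
  convexity inequalities contains exactly the two endpoint values.\<close>

lemma admissible_increment:
  assumes "admissible_phi \<phi>" "0 \<le> x" "x \<le> y" "0 \<le> D"
  shows "\<phi> (x + D) + \<phi> y \<le> \<phi> x + \<phi> (y + D)"
proof (cases "y + D = x")
  case True
  with assms show ?thesis by auto
next
  case False
  define t where "t = D / (y + D - x)"
  have pos: "0 < y + D - x" using False assms by simp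
  have t: "0 \<le> t" "t \<le> 1" using assms pos by (auto simp: t_def)
  have c: "convex_on {0..} \<phi>" using assms by (auto simp: admissible_phi_def)
  have eD: "t * (y + D - x) = D" using pos by (simp add: t_def)
  have e1: "(1 - t) * x + t * (y + D) = x + D" using eD by (simp add: algebra_simps)
  have e2: "t * x + (1 - t) * (y + D) = y" using eD by (simp add: algebra_simps)
  have "\<phi> (x + D) \<le> (1 - t) * \<phi> x + t * \<phi> (y + D)"
    using convex_onD[OF c, of t x "y + D"] t assms e1 by simp
  moreover have "\<phi> y \<le> t * \<phi> x + (1 - t) * \<phi> (y + D)"
    using convex_onD[OF c, of "1 - t" x "y + D"] t assms e2 by simp
  ultimately show ?thesis by (simp add: algebra_simps)
qed

lemma admissible_onto:
  assumes "admissible_phi \<phi>" "0 \<le> c"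
  obtains x where "0 \<le> x" "\<phi> x = c"
proof -
  have "filterlim \<phi> at_top at_top" using assms by (simp add: admissible_phi_def)
  then have "eventually (\<lambda>x. c \<le> \<phi> x) at_top" by (simp add: filterlim_at_top)
  then obtain N where N: "\<And>x. N \<le> x \<Longrightarrow> c \<le> \<phi> x" by (auto simp: eventually_at_top_linorder)
  have "\<exists>x\<ge>0. x \<le> max 0 N \<and> \<phi> \<bar>x\<bar> = c"
    using assms N[of "max 0 N"] admissible_zero[OF assms(1)]
      continuous_on_subset[OF admissible_continuous_abs[OF assms(1)]]
    by (intro IVT') auto
  with that show ?thesis by auto
qed

text \<open>Convexity on the chord from 0 to \<open>x\<close>, read off at 1; the shift to
  \<open>x - 1\<close> makes the bound trivial for \<open>x \<le> 1\<close>. This linear minorant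
  makes \<open>exp (- \<tau> \<phi>)\<close> integrable even when \<open>lam = 0\<close>.\<close>

lemma admissible_linear_growth:
  assumes "admissible_phi \<phi>" "0 \<le> x"
  shows "\<phi> 1 * (x - 1) \<le> \<phi> x"
proof (cases "x \<le> 1")
  case True
  have "0 \<le> \<phi> 1" "0 \<le> \<phi> x" using assms by (auto intro: admissible_nonneg)
  with True show ?thesis by (smt (verit, best) mult_nonneg_nonpos)
next
  case False
  have c: "convex_on {0..} \<phi>" using assms by (auto simp: admissible_phi_def)
  have "\<phi> 1 \<le> (1 - 1 / x) * \<phi> 0 + (1 / x) * \<phi> x"
    using convex_onD[OF c, of "1 / x" 0 x] False by simp
  then have "x * \<phi> 1 \<le> \<phi> x" using False admissible_zero[OF assms(1)] by (simp add: field_simps)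
  then show ?thesis using admissible_nonneg[OF assms(1), of 1] by (simp add: algebra_simps)
qed

text \<open>Moves the weight into the reference measure, relative to which \<open>X\<close> is
  uniform on a sublevel set of the energy. It stays unnormalised because \<open>lam = 0\<close>
  gives Lebesgue measure.\<close>

definition exp_measure :: "real \<Rightarrow> real measure" where
  "exp_measure lam = density lborel (\<lambda>x. ennreal (exp (- lam * \<bar>x\<bar>)))"

lemma sets_exp_measure [simp, measurable_cong]: "sets (exp_measure lam) = sets borel"
  by (simp add: exp_measure_def)

lemma space_exp_measure [simp]: "space (exp_measure lam) = UNIV"
  by (simp add: exp_measure_def)

lemma sigma_finite_exp_measure: "sigma_finite_measure (exp_measure lam)"
  unfolding exp_measure_def
  by (subst sigma_finite_measure.sigma_finite_iff_density_finite[OF sigma_finite_lborel]) auto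

lemma nn_integral_exp_measure:
  "f \<in> borel_measurable borel \<Longrightarrow>
    (\<integral>\<^sup>+x. f x \<partial>exp_measure lam) = (\<integral>\<^sup>+x. ennreal (exp (- lam * \<bar>x\<bar>)) * f x \<partial>lborel)"
  unfolding exp_measure_def by (subst nn_integral_density) auto

lemma AE_exp_measure_nonzero: "AE x in exp_measure lam. x \<noteq> 0"
  unfolding exp_measure_def using AE_lborel_singleton[of "0::real"] by (subst AE_density) auto

lemma nn_integral_abs:
  fixes f :: "real \<Rightarrow> ennreal"
  assumes [measurable]: "f \<in> borel_measurable borel"
  shows "(\<integral>\<^sup>+x. f \<bar>x\<bar> \<partial>lborel) = 2 * (\<integral>\<^sup>+x. f x * indicator {0<..} x \<partial>lborel)"
proof -
  have "(\<integral>\<^sup>+x. f \<bar>x\<bar> \<partial>lborel) =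
      (\<integral>\<^sup>+x. f x * indicator {0<..} x + f (- x) * indicator {0<..} (- x) \<partial>lborel)"
    using AE_lborel_singleton[of "0::real"]
    by (intro nn_integral_cong_AE) (auto simp: indicator_def abs_if)
  also have "\<dots> = (\<integral>\<^sup>+x. f x * indicator {0<..} x \<partial>lborel)
      + (\<integral>\<^sup>+x. f (- x) * indicator {0<..} (- x) \<partial>lborel)"
    by (intro nn_integral_add) auto
  also have "(\<integral>\<^sup>+x. f (- x) * indicator {0<..} (- x) \<partial>lborel) =
      (\<integral>\<^sup>+x. f x * indicator {0<..} x \<partial>lborel)"
    by (subst nn_integral_real_affine[of _ "-1" 0]) auto
  finally show ?thesis by (simp add: mult_2)
qed

text \<open>An even integral is twice the integral over the half-line, and translation by
  \<open>D\<close> preserves Lebesgue measure there; the piece up to \<open>D\<close> that the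
  translate misses carries no \<open>f\<close>.\<close>

lemma nn_integral_abs_shift:
  fixes f g :: "real \<Rightarrow> ennreal"
  assumes [measurable]: "f \<in> borel_measurable borel" "g \<in> borel_measurable borel"
    and "0 \<le> D" "\<And>x. 0 < x \<Longrightarrow> x \<le> D \<Longrightarrow> f x = 0" "\<And>x. 0 < x \<Longrightarrow> f (x + D) \<le> g x"
  shows "(\<integral>\<^sup>+x. f \<bar>x\<bar> \<partial>lborel) \<le> (\<integral>\<^sup>+x. g \<bar>x\<bar> \<partial>lborel)"
proof -
  have "(\<integral>\<^sup>+x. f x * indicator {0<..} x \<partial>lborel) =
      (\<integral>\<^sup>+x. f (D + x) * indicator {0<..} (D + x) \<partial>lborel)"
    by (subst nn_integral_real_affine[of _ 1 D]) auto
  also have "\<dots> \<le> (\<integral>\<^sup>+x. g x * indicator {0<..} x \<partial>lborel)"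
    using AE_lborel_singleton[of "0::real"]
  proof (intro nn_integral_mono_AE, eventually_elim)
    fix x :: real assume "x \<noteq> 0"
    then show "f (D + x) * indicator {0<..} (D + x) \<le> g x * indicator {0<..} x"
      using assms(4)[of "D + x"] assms(5)[of x] by (auto simp: indicator_def add.commute)
  qed
  finally show ?thesis by (simp add: nn_integral_abs mult_left_mono)
qed

text \<open>Both laws are realised on the unit interval by their quantile functions.
  \<open>le1\<close> orders the two quantiles, \<open>le2\<close> bounds the larger by
  \<open>\<theta>\<close> of the smaller, and then \<open>k\<close> applies pointwise.\<close>

lemma quantile_coupling:
  fixes k1 k2 :: "real \<Rightarrow> ennreal"
  assumes P: "real_distribution P" and Q: "real_distribution Q"
    and [measurable]: "k1 \<in> borel_measurable borel" "k2 \<in> borel_measurable borel"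
    and supp: "\<And>t. t < 0 \<Longrightarrow> cdf P t = 0"
    and le1: "\<And>t. cdf Q t \<le> cdf P t"
    and le2: "\<And>t. 0 \<le> t \<Longrightarrow> cdf P t \<le> cdf Q (\<theta> t)"
    and k: "\<And>x y. 0 \<le> x \<Longrightarrow> x \<le> y \<Longrightarrow> y \<le> \<theta> x \<Longrightarrow> k1 x \<le> k2 y"
  shows "(\<integral>\<^sup>+x. k1 x \<partial>P) \<le> (\<integral>\<^sup>+x. k2 x \<partial>Q)"
proof -
  interpret P: cdf_distribution P using P by (simp add: cdf_distribution_def)
  interpret Q: cdf_distribution Q using Q by (simp add: cdf_distribution_def)
  let ?R = "restrict_space lborel {0<..<1::real}"
  have "(\<integral>\<^sup>+x. k1 x \<partial>P) = (\<integral>\<^sup>+x. k1 x \<partial>distr ?R borel P.I)"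
    by (simp only: P.distr_I_eq_M)
  also have "\<dots> = (\<integral>\<^sup>+\<omega>. k1 (P.I \<omega>) \<partial>?R)"
    by (subst nn_integral_distr) auto
  also have "\<dots> \<le> (\<integral>\<^sup>+\<omega>. k2 (Q.I \<omega>) \<partial>?R)"
  proof (rule nn_integral_mono)
    fix \<omega> assume "\<omega> \<in> space ?R"
    then have w: "0 < \<omega>" "\<omega> < 1" by (auto simp: space_restrict_space)
    define x y where "x = P.I \<omega>" and "y = Q.I \<omega>"
    have x: "\<omega> \<le> P.C t \<longleftrightarrow> x \<le> t" and y: "\<omega> \<le> Q.C t \<longleftrightarrow> y \<le> t" for t
      unfolding x_def y_def by (fact P.pseudoinverse[OF w], fact Q.pseudoinverse[OF w])
    have 0: "0 \<le> x" using x[of x] supp[of x] w by (cases "x < 0") auto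
    moreover have "x \<le> y" using y[of y] x[of y] le1[of y] by simp
    moreover have "y \<le> \<theta> x" using x[of x] y[of "\<theta> x"] le2[OF 0] by simp
    ultimately show "k1 (P.I \<omega>) \<le> k2 (Q.I \<omega>)"
      unfolding x_def[symmetric] y_def[symmetric] by (intro k)
  qed
  also have "\<dots> = (\<integral>\<^sup>+x. k2 x \<partial>distr ?R borel Q.I)"
    by (subst nn_integral_distr) auto
  also have "\<dots> = (\<integral>\<^sup>+x. k2 x \<partial>Q)"
    by (simp only: Q.distr_I_eq_M)
  finally show ?thesis .
qed

section \<open>Coupling of one coordinate at two levels\<close>

lemma ennreal_divide_le_cross:
  fixes a b c d :: ennreal
  assumes "a * d \<le> c * b" "0 < b" "b < \<top>" "0 < d" "d < \<top>"
  shows "a / b \<le> c / d"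
proof -
  have "a = a * d / d" using assms by (simp add: ennreal_mult_divide_eq)
  also have "\<dots> \<le> c * b / d" using assms by (intro divide_right_mono_ennreal)
  finally have "a \<le> c / d * b" by (simp add: ennreal_times_divide mult.commute)
  then have "a / b \<le> c / d * b / b" by (rule divide_right_mono_ennreal)
  also have "\<dots> = c / d" using assms by (simp add: ennreal_mult_divide_eq)
  finally show ?thesis .
qed

lemma ennreal_cross_le_divide:
  fixes a b c d :: ennreal
  assumes "a / b \<le> c / d" "0 < b" "b < \<top>" "0 < d" "d < \<top>"
  shows "a * d \<le> c * b"
proof -
  have "a * d = a / b * b * d" using assms by (simp add: ennreal_divide_times ennreal_mult_divide_eq)
  also have "\<dots> \<le> c / d * b * d" using assms by (intro mult_right_mono) auto
  also have "\<dots> = c / d * d * b" by (simp add: ac_simps)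
  also have "\<dots> = c * b" using assms by (simp add: ennreal_divide_times ennreal_mult_divide_eq)
  finally show ?thesis .
qed

text \<open>The four-point inequality says that \<open>F (u + h) / F u\<close> does not increase in
  \<open>u\<close>, without logarithms or quotients of zero. The value at 0 is left free: the volume
  over no coordinates equals 1 there, over at least one coordinate it is 0.\<close>

definition log_concave_profile :: "(real \<Rightarrow> ennreal) \<Rightarrow> bool" where
  "log_concave_profile F \<longleftrightarrow> mono F \<and> (\<forall>u<0. F u = 0) \<and> (\<forall>u. F u < \<top>) \<and> (\<forall>u>0. 0 < F u) \<and>
     (\<forall>a b h. a \<le> b \<longrightarrow> 0 \<le> h \<longrightarrow> F (b + h) * F a \<le> F b * F (a + h))"

text \<open>\<open>F u\<close> stands for the volume available to the remaining coordinates when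
  their budget is \<open>u\<close>; \<open>D\<close> below is the volume after this coordinate has
  been added.\<close>

locale coordinate =
  fixes lam :: real and \<phi> :: "real \<Rightarrow> real" and F :: "real \<Rightarrow> ennreal"
  assumes lam: "0 \<le> lam" and adm: "admissible_phi \<phi>" and F: "log_concave_profile F"
begin

abbreviation B :: "real measure" where "B \<equiv> exp_measure lam"

definition D :: "real \<Rightarrow> ennreal" where
  "D s = (\<integral>\<^sup>+x. F (s - \<phi> \<bar>x\<bar>) \<partial>B)"

lemma F_mono: "u \<le> v \<Longrightarrow> F u \<le> F v"
  using F by (auto simp: log_concave_profile_def dest: monoD)

lemma F_neg: "u < 0 \<Longrightarrow> F u = 0"
  using F by (auto simp: log_concave_profile_def)

lemma F_finite: "F u < \<top>"
  using F by (auto simp: log_concave_profile_def)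

lemma F_pos: "0 < u \<Longrightarrow> 0 < F u"
  using F by (auto simp: log_concave_profile_def)

lemma F_log_concave: "a \<le> b \<Longrightarrow> 0 \<le> h \<Longrightarrow> F (b + h) * F a \<le> F b * F (a + h)"
  using F by (auto simp: log_concave_profile_def)

lemma measurable_F [measurable]: "F \<in> borel_measurable borel"
proof -
  have "mono (\<lambda>u. enn2real (F u))"
    using F_mono F_finite by (intro monoI enn2real_mono) auto
  from borel_measurable_mono[OF this] have "(\<lambda>u. ennreal (enn2real (F u))) \<in> borel_measurable borel"
    by measurable
  then show ?thesis using F_finite by simp
qed

lemma measurable_phi_abs [measurable]: "(\<lambda>x. \<phi> \<bar>x\<bar>) \<in> borel_measurable borel"
  using adm by (rule admissible_measurable_abs)

lemma phi_abs_nonneg: "0 \<le> \<phi> \<bar>x\<bar>"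
  by (rule admissible_nonneg[OF adm]) simp

lemma D_mono: "s \<le> s' \<Longrightarrow> D s \<le> D s'"
  unfolding D_def by (intro nn_integral_mono F_mono) auto

lemma D_nonpos:
  assumes "s \<le> 0" shows "D s = 0"
proof -
  have "D s = (\<integral>\<^sup>+x. 0 \<partial>B)"
    unfolding D_def using AE_exp_measure_nonzero[of lam]
  proof (intro nn_integral_cong_AE, eventually_elim)
    fix x :: real assume "x \<noteq> 0"
    then show "F (s - \<phi> \<bar>x\<bar>) = 0"
      using assms admissible_pos[OF adm, of "\<bar>x\<bar>"] by (intro F_neg) auto
  qed
  then show ?thesis by simp
qed

lemma D_finite: "D s < \<top>"
proof -
  obtain R where R: "0 \<le> R" "\<phi> R = \<bar>s\<bar>" using admissible_onto[OF adm, of "\<bar>s\<bar>"] by auto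
  have "D s = (\<integral>\<^sup>+x. ennreal (exp (- lam * \<bar>x\<bar>)) * F (s - \<phi> \<bar>x\<bar>) \<partial>lborel)"
    unfolding D_def by (subst nn_integral_exp_measure) auto
  also have "\<dots> \<le> (\<integral>\<^sup>+x. F s * indicator {-R..R} x \<partial>lborel)"
  proof (rule nn_integral_mono)
    fix x :: real
    have "x \<in> {-R..R}" if "\<phi> \<bar>x\<bar> \<le> s"
      using that R admissible_le_iff[OF adm, of "\<bar>x\<bar>" R] by auto
    moreover have "ennreal (exp (- lam * \<bar>x\<bar>)) \<le> 1" using lam by simp
    then have "ennreal (exp (- lam * \<bar>x\<bar>)) * F (s - \<phi> \<bar>x\<bar>) \<le> 1 * F s"
      using phi_abs_nonneg[of x] by (intro mult_mono F_mono) auto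
    ultimately show "ennreal (exp (- lam * \<bar>x\<bar>)) * F (s - \<phi> \<bar>x\<bar>) \<le> F s * indicator {-R..R} x"
      by (cases "\<phi> \<bar>x\<bar> \<le> s") (auto simp: F_neg)
  qed
  also have "\<dots> < \<top>"
    using F_finite[of s] by (simp add: nn_integral_cmult ennreal_mult_less_top emeasure_lborel_Icc_eq)
  finally show ?thesis .
qed

lemma D_pos:
  assumes "0 < s" shows "0 < D s"
proof -
  \<comment> \<open>On \<open>{-R..R}\<close> the coordinate spends at most half of the budget, so
    at least \<open>F (s / 2)\<close> remains for the others.\<close>
  obtain R where R: "0 \<le> R" "\<phi> R = s / 2" using admissible_onto[OF adm, of "s / 2"] assms by auto
  have "R \<noteq> 0" using R assms admissible_zero[OF adm] by auto
  with R have "0 < R" by simp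
  have "0 < ennreal (exp (- lam * R)) * F (s / 2) * ennreal (R - - R)"
    using F_pos[of "s / 2"] assms \<open>0 < R\<close> by (simp add: ennreal_zero_less_mult_iff)
  also have "\<dots> = (\<integral>\<^sup>+x. (ennreal (exp (- lam * R)) * F (s / 2)) * indicator {-R..R} x \<partial>lborel)"
    using R by (subst nn_integral_cmult_indicator) (auto simp: emeasure_lborel_Icc_eq)
  also have "\<dots> \<le> (\<integral>\<^sup>+x. ennreal (exp (- lam * \<bar>x\<bar>)) * F (s - \<phi> \<bar>x\<bar>) \<partial>lborel)"
  proof (rule nn_integral_mono)
    fix x :: real
    show "(ennreal (exp (- lam * R)) * F (s / 2)) * indicator {-R..R} x
        \<le> ennreal (exp (- lam * \<bar>x\<bar>)) * F (s - \<phi> \<bar>x\<bar>)"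
    proof (cases "x \<in> {-R..R}")
      case True
      then have "\<bar>x\<bar> \<le> R" by auto
      then have "\<phi> \<bar>x\<bar> \<le> s / 2" using R admissible_mono[OF adm, of "\<bar>x\<bar>" R] by simp
      then show ?thesis using True lam \<open>\<bar>x\<bar> \<le> R\<close>
        by (auto intro!: mult_mono F_mono ennreal_leI mult_left_mono)
    qed simp
  qed
  also have "\<dots> = D s" unfolding D_def by (subst nn_integral_exp_measure) auto
  finally show ?thesis .
qed

text \<open>
  The translation by \<open>\<alpha>' - \<alpha>\<close> maps the tail at level \<open>s\<close> onto the tail at level \<open>s'\<close>, and by convexity of
  \<open>\<phi>\<close> it does not increase the remaining budget \<open>s - \<phi> x\<close>.
\<close>

lemma tail_shift:
  assumes a: "0 \<le> \<alpha>" "0 \<le> \<alpha>'" and d: "\<phi> \<alpha>' = \<phi> \<alpha> + (s' - s)" "s \<le> s'"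
  shows "(\<integral>\<^sup>+x. F (s' - \<phi> \<bar>x\<bar>) * indicator {\<alpha>'<..} \<bar>x\<bar> \<partial>B)
    \<le> (\<integral>\<^sup>+x. F (s - \<phi> \<bar>x\<bar>) * indicator {\<alpha><..} \<bar>x\<bar> \<partial>B)"
proof -
  define f where "f x = ennreal (exp (- lam * \<bar>x\<bar>)) * (F (s' - \<phi> \<bar>x\<bar>) * indicator {\<alpha>'<..} \<bar>x\<bar>)" for x
  define g where "g x = ennreal (exp (- lam * \<bar>x\<bar>)) * (F (s - \<phi> \<bar>x\<bar>) * indicator {\<alpha><..} \<bar>x\<bar>)" for x
  have [measurable]: "f \<in> borel_measurable borel" "g \<in> borel_measurable borel"
    unfolding f_def g_def by measurable
  have le: "\<alpha> \<le> \<alpha>'" using a d admissible_le_iff[OF adm, of \<alpha> \<alpha>'] by simp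
  have "(\<integral>\<^sup>+x. f \<bar>x\<bar> \<partial>lborel) \<le> (\<integral>\<^sup>+x. g \<bar>x\<bar> \<partial>lborel)"
  proof (rule nn_integral_abs_shift[where D = "\<alpha>' - \<alpha>"])
    fix x :: real assume "0 < x" "x \<le> \<alpha>' - \<alpha>"
    then show "f x = 0" using a by (auto simp: f_def)
  next
    fix x :: real assume x: "0 < x"
    show "f (x + (\<alpha>' - \<alpha>)) \<le> g x"
    proof (cases "\<alpha> < x")
      case True
      have "\<phi> (\<alpha> + (\<alpha>' - \<alpha>)) + \<phi> x \<le> \<phi> \<alpha> + \<phi> (x + (\<alpha>' - \<alpha>))"
        using True a le by (intro admissible_increment[OF adm]) auto
      then have "s' - \<phi> (x + (\<alpha>' - \<alpha>)) \<le> s - \<phi> x" using d by simp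
      then show ?thesis
        unfolding f_def g_def using x le lam True
        by (intro mult_mono ennreal_leI F_mono) (auto intro!: mult_left_mono split: split_indicator)
    next
      case False
      then have "\<bar>x + (\<alpha>' - \<alpha>)\<bar> \<le> \<alpha>'" using x le by simp
      then show ?thesis by (simp add: f_def)
    qed
  qed (use le in auto)
  then show ?thesis
    by (simp add: nn_integral_exp_measure f_def g_def)
qed

text \<open>By log-concavity the likelihood ratio
  \<open>F (s' - \<phi> \<bar>x\<bar>) / F (s - \<phi> \<bar>x\<bar>)\<close> increases with
  \<open>\<bar>x\<bar>\<close>. Splitting \<open>D\<close> at \<open>t\<close> cancels the product
  of the two lower parts, and the remaining products are compared pointwise in a double
  integral.\<close>

lemma head_order:
  assumes "s \<le> s'"
  shows "(\<integral>\<^sup>+x. F (s' - \<phi> \<bar>x\<bar>) * indicator {..t} \<bar>x\<bar> \<partial>B) * D s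
    \<le> (\<integral>\<^sup>+x. F (s - \<phi> \<bar>x\<bar>) * indicator {..t} \<bar>x\<bar> \<partial>B) * D s'"
proof -
  define l where "l r = (\<integral>\<^sup>+x. F (r - \<phi> \<bar>x\<bar>) * indicator {..t} \<bar>x\<bar> \<partial>B)" for r
  define u where "u r = (\<integral>\<^sup>+x. F (r - \<phi> \<bar>x\<bar>) * indicator {t<..} \<bar>x\<bar> \<partial>B)" for r
  have D: "D r = l r + u r" for r
    unfolding D_def l_def u_def
    by (subst nn_integral_add[symmetric]) (auto intro!: nn_integral_cong simp: indicator_def)
  have prod: "l r * u r' = (\<integral>\<^sup>+x. \<integral>\<^sup>+y. (F (r - \<phi> \<bar>x\<bar>) * indicator {..t} \<bar>x\<bar>) *
      (F (r' - \<phi> \<bar>y\<bar>) * indicator {t<..} \<bar>y\<bar>) \<partial>B \<partial>B)" for r r'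
    unfolding l_def u_def by (simp add: nn_integral_cmult nn_integral_multc)
  have "l s' * u s \<le> l s * u s'"
    unfolding prod
  proof (intro nn_integral_mono)
    fix x y :: real
    show "(F (s' - \<phi> \<bar>x\<bar>) * indicator {..t} \<bar>x\<bar>) * (F (s - \<phi> \<bar>y\<bar>) * indicator {t<..} \<bar>y\<bar>)
      \<le> (F (s - \<phi> \<bar>x\<bar>) * indicator {..t} \<bar>x\<bar>) * (F (s' - \<phi> \<bar>y\<bar>) * indicator {t<..} \<bar>y\<bar>)"
    proof (cases "\<bar>x\<bar> \<le> t \<and> t < \<bar>y\<bar>")
      case True
      then have "\<phi> \<bar>x\<bar> \<le> \<phi> \<bar>y\<bar>" by (intro admissible_mono[OF adm]) auto
      then show ?thesis
        using F_log_concave[of "s - \<phi> \<bar>y\<bar>" "s - \<phi> \<bar>x\<bar>" "s' - s"] assms True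
        by (simp add: algebra_simps)
    qed (auto simp: indicator_def)
  qed
  then have "l s' * (l s + u s) \<le> l s * (l s' + u s')"
    by (simp add: distrib_left mult.commute[of "l s"] add_left_mono)
  then show ?thesis unfolding D by (simp only: l_def)
qed

text \<open>The law of the absolute value of this coordinate in the vector at level
  \<open>s\<close>; for \<open>s \<le> 0\<close> it is the zero measure.\<close>

definition level_law :: "real \<Rightarrow> real measure" where
  "level_law s = distr (density B (\<lambda>x. F (s - \<phi> \<bar>x\<bar>) / D s)) borel abs"

lemma emeasure_level_law:
  assumes [measurable]: "A \<in> sets borel"
  shows "emeasure (level_law s) A = (\<integral>\<^sup>+x. F (s - \<phi> \<bar>x\<bar>) * indicator A \<bar>x\<bar> \<partial>B) / D s"
proof -
  have [measurable]: "abs -` A \<in> sets borel"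
    using measurable_sets_borel[of abs borel A] by simp
  have "emeasure (level_law s) A = (\<integral>\<^sup>+x. F (s - \<phi> \<bar>x\<bar>) / D s * indicator (abs -` A) x \<partial>B)"
    unfolding level_law_def by (subst emeasure_distr; simp) (subst emeasure_density; simp)
  also have "\<dots> = (\<integral>\<^sup>+x. F (s - \<phi> \<bar>x\<bar>) * indicator A \<bar>x\<bar> / D s \<partial>B)"
    by (intro nn_integral_cong) (auto simp: indicator_def)
  also have "\<dots> = (\<integral>\<^sup>+x. F (s - \<phi> \<bar>x\<bar>) * indicator A \<bar>x\<bar> \<partial>B) / D s"
    by (rule nn_integral_divide) measurable
  finally show ?thesis .
qed

lemma real_distribution_level_law:
  assumes "0 < s" shows "real_distribution (level_law s)"
proof -
  have "emeasure (level_law s) UNIV = D s / D s"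
    by (subst emeasure_level_law) (auto simp: D_def)
  also have "\<dots> = 1" using D_pos[OF assms] D_finite[of s] by (intro ennreal_divide_self) auto
  finally have "prob_space (level_law s)"
    by (intro prob_spaceI) (simp add: level_law_def)
  then show ?thesis
    by (simp add: real_distribution_def real_distribution_axioms_def level_law_def)
qed

lemma nn_integral_level_law:
  assumes [measurable]: "k \<in> borel_measurable borel"
  shows "(\<integral>\<^sup>+x. k x \<partial>level_law s) = (\<integral>\<^sup>+x. k \<bar>x\<bar> * F (s - \<phi> \<bar>x\<bar>) \<partial>B) / D s"
proof -
  have "(\<integral>\<^sup>+x. k x \<partial>level_law s) = (\<integral>\<^sup>+x. F (s - \<phi> \<bar>x\<bar>) / D s * k \<bar>x\<bar> \<partial>B)"
    unfolding level_law_def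
    by (subst nn_integral_distr; (simp add: nn_integral_density)?)
  also have "\<dots> = (\<integral>\<^sup>+x. k \<bar>x\<bar> * F (s - \<phi> \<bar>x\<bar>) / D s \<partial>B)"
    by (intro nn_integral_cong) (simp add: ennreal_times_divide mult.commute)
  also have "\<dots> = (\<integral>\<^sup>+x. k \<bar>x\<bar> * F (s - \<phi> \<bar>x\<bar>) \<partial>B) / D s"
    by (rule nn_integral_divide) measurable
  finally show ?thesis .
qed

text \<open>
  In the quantile coupling of the two levels both the coordinate (by \<open>head_order\<close>) and the remaining
  budget (by \<open>tail_shift\<close>) increase.
\<close>

proposition level_coupling:
  fixes k1 k2 :: "real \<Rightarrow> ennreal"
  assumes [measurable]: "k1 \<in> borel_measurable borel" "k2 \<in> borel_measurable borel"
    and s: "s \<le> s'"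
    and k: "\<And>x y. 0 \<le> x \<Longrightarrow> x \<le> y \<Longrightarrow> \<phi> y \<le> \<phi> x + (s' - s) \<Longrightarrow> k1 x \<le> k2 y"
  shows "(\<integral>\<^sup>+x. k1 \<bar>x\<bar> * F (s - \<phi> \<bar>x\<bar>) \<partial>B) * D s'
    \<le> (\<integral>\<^sup>+x. k2 \<bar>x\<bar> * F (s' - \<phi> \<bar>x\<bar>) \<partial>B) * D s"
proof (cases "0 < s")
  case False
  then have "D s = 0" by (simp add: D_nonpos)
  then have "AE x in B. F (s - \<phi> \<bar>x\<bar>) = 0"
    unfolding D_def by (subst (asm) nn_integral_0_iff_AE) auto
  then have "(\<integral>\<^sup>+x. k1 \<bar>x\<bar> * F (s - \<phi> \<bar>x\<bar>) \<partial>B) = 0"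
    by (subst nn_integral_0_iff_AE) auto
  then show ?thesis by simp
next
  case True
  note Dp = D_pos[OF True] D_finite[of s] D_pos[of s'] D_finite[of s']
  \<comment> \<open>The point \<open>\<theta> x\<close> at level \<open>s'\<close> leaves the same
    remaining budget as \<open>x\<close> at level \<open>s\<close>; \<open>tail_shift\<close>
    compares the two tails beyond these points.\<close>
  define \<theta> where "\<theta> x = (SOME y. 0 \<le> y \<and> \<phi> y = \<phi> x + (s' - s))" for x
  have \<theta>: "0 \<le> \<theta> x" "\<phi> (\<theta> x) = \<phi> x + (s' - s)" if "0 \<le> x" for x
  proof -
    have "\<exists>y. 0 \<le> y \<and> \<phi> y = \<phi> x + (s' - s)"
      using admissible_onto[OF adm, of "\<phi> x + (s' - s)"] admissible_nonneg[OF adm that] s by force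
    from someI_ex[OF this] show "0 \<le> \<theta> x" "\<phi> (\<theta> x) = \<phi> x + (s' - s)"
      by (auto simp: \<theta>_def)
  qed
  interpret P: real_distribution "level_law s" by (rule real_distribution_level_law[OF True])
  interpret Q: real_distribution "level_law s'" using True s by (intro real_distribution_level_law) auto
  have "(\<integral>\<^sup>+x. k1 x \<partial>level_law s) \<le> (\<integral>\<^sup>+x. k2 x \<partial>level_law s')"
  proof (rule quantile_coupling[where \<theta> = \<theta>])
    fix t :: real assume "t < 0"
    then have "\<not> \<bar>x\<bar> \<le> t" for x by linarith
    then have "(\<lambda>x. F (s - \<phi> \<bar>x\<bar>) * indicator {..t} \<bar>x\<bar>) = (\<lambda>x. 0)"
      by simp
    then have "emeasure (level_law s) {..t} = 0"
      by (simp add: emeasure_level_law)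
    then show "cdf (level_law s) t = 0" by (simp add: cdf_def measure_def)
  next
    fix t
    have "emeasure (level_law s') {..t} \<le> emeasure (level_law s) {..t}"
      using head_order[OF s, of t] Dp True s
      by (simp add: emeasure_level_law ennreal_divide_le_cross)
    then show "cdf (level_law s') t \<le> cdf (level_law s) t"
      by (simp add: cdf_def P.emeasure_eq_measure Q.emeasure_eq_measure)
  next
    fix t :: real assume t: "0 \<le> t"
    have "emeasure (level_law s') {\<theta> t<..} \<le> emeasure (level_law s) {t<..}"
      using mult_mono[OF tail_shift[OF t \<theta>[OF t] s] D_mono[OF s]] Dp True s
      by (simp add: emeasure_level_law ennreal_divide_le_cross)
    then have "measure (level_law s') {\<theta> t<..} \<le> measure (level_law s) {t<..}"
      by (simp add: P.emeasure_eq_measure Q.emeasure_eq_measure)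
    moreover have "UNIV - {..r} = {r<..}" for r :: real by auto
    ultimately show "cdf (level_law s) t \<le> cdf (level_law s') (\<theta> t)"
      using P.prob_compl[of "{..t}"] Q.prob_compl[of "{..\<theta> t}"] by (simp add: cdf_def)
  next
    fix x y :: real assume "0 \<le> x" "x \<le> y" "y \<le> \<theta> x"
    then show "k1 x \<le> k2 y"
      using admissible_mono[OF adm, of y "\<theta> x"] \<theta>[of x] by (intro k) auto
  qed (auto intro: P.real_distribution_axioms Q.real_distribution_axioms)
  then show ?thesis
    using Dp True s by (simp add: nn_integral_level_law ennreal_cross_le_divide)
qed

end

section \<open>Monotonicity in the level\<close>

text \<open>Applied in both directions to points with equal absolute values, this makes
  \<open>f\<close> a function of the \<open>\<bar>x i\<bar>\<close>. The order-valued codomain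
  covers both \<open>ennreal\<close> integrands and real convex functions.\<close>

definition abs_mono :: "'i set \<Rightarrow> (('i \<Rightarrow> real) \<Rightarrow> 'b::order) \<Rightarrow> bool" where
  "abs_mono I f \<longleftrightarrow>
     (\<forall>x\<in>I \<rightarrow>\<^sub>E UNIV. \<forall>y\<in>I \<rightarrow>\<^sub>E UNIV. (\<forall>i\<in>I. \<bar>x i\<bar> \<le> \<bar>y i\<bar>) \<longrightarrow> f x \<le> f y)"

lemma abs_monoD:
  assumes "abs_mono I f" "x \<in> I \<rightarrow>\<^sub>E UNIV" "y \<in> I \<rightarrow>\<^sub>E UNIV" "\<And>i. i \<in> I \<Longrightarrow> \<bar>x i\<bar> \<le> \<bar>y i\<bar>"
  shows "f x \<le> f y"
  using assms by (auto simp: abs_mono_def)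

lemma fun_upd_PiE_UNIV: "x \<in> I \<rightarrow>\<^sub>E UNIV \<Longrightarrow> x(i := y) \<in> insert i I \<rightarrow>\<^sub>E UNIV"
  by (auto simp: PiE_def extensional_def)

lemma abs_mono_section:
  assumes "abs_mono (insert i I) f"
  shows "abs_mono I (\<lambda>x. f (x(i := y)))"
  unfolding abs_mono_def
  by (intro ballI impI abs_monoD[OF assms] fun_upd_PiE_UNIV) auto

abbreviation exp_product :: "real \<Rightarrow> 'i set \<Rightarrow> ('i \<Rightarrow> real) measure" where
  "exp_product lam I \<equiv> Pi\<^sub>M I (\<lambda>_. exp_measure lam)"

lemma space_exp_product [simp]: "space (exp_product lam I) = I \<rightarrow>\<^sub>E UNIV"
  by (simp add: space_PiM)

text \<open>Numerator of the expectation at level \<open>s\<close>, with \<open>level_volume\<close>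
  as denominator; kept unnormalised so that levels of volume zero need no exception.\<close>

definition level_integral ::
  "real \<Rightarrow> ('i \<Rightarrow> real \<Rightarrow> real) \<Rightarrow> 'i set \<Rightarrow> (('i \<Rightarrow> real) \<Rightarrow> ennreal) \<Rightarrow> real \<Rightarrow> ennreal" where
  "level_integral lam \<phi> I f s =
     (\<integral>\<^sup>+x. f x * indicator {x. (\<Sum>i\<in>I. \<phi> i \<bar>x i\<bar>) \<le> s} x \<partial>exp_product lam I)"

abbreviation level_volume :: "real \<Rightarrow> ('i \<Rightarrow> real \<Rightarrow> real) \<Rightarrow> 'i set \<Rightarrow> real \<Rightarrow> ennreal" where
  "level_volume lam \<phi> I \<equiv> level_integral lam \<phi> I (\<lambda>_. 1)"

lemma product_sigma_finite_exp_measure: "product_sigma_finite (\<lambda>_. exp_measure lam)"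
  by (simp add: product_sigma_finite_def sigma_finite_exp_measure)

lemma measurable_energy:
  assumes "\<And>i. i \<in> I \<Longrightarrow> admissible_phi (\<phi> i)"
  shows "(\<lambda>x. \<Sum>i\<in>I. \<phi> i \<bar>x i\<bar>) \<in> borel_measurable (exp_product lam I)"
proof (rule borel_measurable_sum)
  fix i assume "i \<in> I"
  note [measurable] = admissible_measurable_abs[OF assms[OF this]]
  have [measurable]: "(\<lambda>x. x i) \<in> borel_measurable (exp_product lam I)"
    using measurable_component_singleton[OF \<open>i \<in> I\<close>, of "\<lambda>_. exp_measure lam"]
    by (simp add: measurable_cong_sets[OF refl sets_exp_measure])
  show "(\<lambda>x. \<phi> i \<bar>x i\<bar>) \<in> borel_measurable (exp_product lam I)"
    by (rule measurable_compose[of "\<lambda>x. x i"]) measurable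
qed

lemma level_integral_empty:
  "level_integral lam \<phi> {} f s = f (\<lambda>_. undefined) * indicator {0..} s"
  by (simp add: level_integral_def PiM_empty nn_integral_count_space_finite indicator_def)

text \<open>Fubini with the new coordinate outermost: once it has the value \<open>y\<close>, the
  others share the budget \<open>s - \<phi> i \<bar>y\<bar>\<close>.\<close>

lemma level_integral_insert:
  assumes fin: "finite I" "i \<notin> I" and adm: "\<And>j. j \<in> insert i I \<Longrightarrow> admissible_phi (\<phi> j)"
    and [measurable]: "f \<in> borel_measurable (exp_product lam (insert i I))"
  shows "level_integral lam \<phi> (insert i I) f s =
    (\<integral>\<^sup>+y. level_integral lam \<phi> I (\<lambda>x. f (x(i := y))) (s - \<phi> i \<bar>y\<bar>) \<partial>exp_measure lam)"
proof -
  interpret product_sigma_finite "\<lambda>_. exp_measure lam" by (rule product_sigma_finite_exp_measure)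
  define e where "e x = (\<Sum>j\<in>insert i I. \<phi> j \<bar>x j\<bar>)" for x
  have [measurable]: "e \<in> borel_measurable (exp_product lam (insert i I))"
    unfolding e_def using adm by (rule measurable_energy)
  have e: "e (x(i := y)) = \<phi> i \<bar>y\<bar> + (\<Sum>j\<in>I. \<phi> j \<bar>x j\<bar>)" for x y
    unfolding e_def using fin by (subst sum.insert) (auto intro!: sum.cong)
  have "(\<integral>\<^sup>+x. f x * indicator {x. e x \<le> s} x \<partial>exp_product lam (insert i I)) =
      (\<integral>\<^sup>+y. \<integral>\<^sup>+x. f (x(i := y)) * indicator {x. e x \<le> s} (x(i := y)) \<partial>exp_product lam I \<partial>exp_measure lam)"
    by (rule product_nn_integral_insert_rev[OF fin]) measurable
  also have "\<dots> = (\<integral>\<^sup>+y. level_integral lam \<phi> I (\<lambda>x. f (x(i := y))) (s - \<phi> i \<bar>y\<bar>) \<partial>exp_measure lam)"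
    unfolding level_integral_def
    by (intro nn_integral_cong arg_cong2[where f = "(*)"] refl) (auto simp: e indicator_def)
  finally show ?thesis
    by (simp only: level_integral_def e_def)
qed

text \<open>Lets an integral be recovered from its quotient by the volume where that volume is 0; a
  nonzero numerator over 0 would be infinite.\<close>

lemma level_integral_null:
  assumes "level_volume lam \<phi> I s = 0" and "\<And>i. i \<in> I \<Longrightarrow> admissible_phi (\<phi> i)"
    and [measurable]: "f \<in> borel_measurable (exp_product lam I)"
  shows "level_integral lam \<phi> I f s = 0"
proof -
  note [measurable] = measurable_energy[of I \<phi>, OF assms(2)]
  have "AE x in exp_product lam I. (indicator {x. (\<Sum>i\<in>I. \<phi> i \<bar>x i\<bar>) \<le> s} x :: ennreal) = 0"
    using assms(1) unfolding level_integral_def by (subst (asm) nn_integral_0_iff_AE) auto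
  then show ?thesis
    unfolding level_integral_def by (subst nn_integral_0_iff_AE) (auto elim!: eventually_mono)
qed

lemma level_integral_mono:
  assumes "\<And>x. x \<in> I \<rightarrow>\<^sub>E UNIV \<Longrightarrow> f x \<le> g x"
  shows "level_integral lam \<phi> I f s \<le> level_integral lam \<phi> I g s"
  unfolding level_integral_def using assms by (intro nn_integral_mono mult_right_mono) auto

lemma ennreal_times_divide_cancel:
  fixes a b :: ennreal
  assumes "b = 0 \<Longrightarrow> a = 0" "b < \<top>"
  shows "a / b * b = a"
  using assms by (cases "b = 0") (auto simp: ennreal_divide_times ennreal_mult_divide_eq)

text \<open>
  The two properties are proved together because the coupling in the new coordinate needs
  log-concavity of the volume in the old ones.
\<close>

proposition level_volume_log_concave_and_integral_ratio_mono:
  fixes \<phi> :: "'i \<Rightarrow> real \<Rightarrow> real"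
  assumes lam: "0 \<le> lam" and "finite I" and "\<And>i. i \<in> I \<Longrightarrow> admissible_phi (\<phi> i)"
  shows "log_concave_profile (level_volume lam \<phi> I) \<and>
    (\<forall>f\<in>borel_measurable (exp_product lam I). abs_mono I f \<longrightarrow> (\<forall>s s'. s \<le> s' \<longrightarrow>
      level_integral lam \<phi> I f s * level_volume lam \<phi> I s'
      \<le> level_integral lam \<phi> I f s' * level_volume lam \<phi> I s))"
  using assms(2,3)
proof (induction I rule: finite_induct)
  case empty
  show ?case
    by (auto simp: log_concave_profile_def level_integral_empty mono_def indicator_def)
next
  case (insert i I)
  let ?G = "level_volume lam \<phi> I" and ?B = "exp_measure lam"
  have adm: "admissible_phi (\<phi> i)" and admI: "\<And>j. j \<in> I \<Longrightarrow> admissible_phi (\<phi> j)"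
    using insert.prems by auto
  have IH1: "log_concave_profile ?G" and IH2: "\<And>f s s'. f \<in> borel_measurable (exp_product lam I) \<Longrightarrow>
      abs_mono I f \<Longrightarrow> s \<le> s' \<Longrightarrow>
      level_integral lam \<phi> I f s * ?G s' \<le> level_integral lam \<phi> I f s' * ?G s"
    using insert by auto
  interpret coordinate lam "\<phi> i" ?G
    using lam adm IH1 by unfold_locales
  interpret PS: product_sigma_finite "\<lambda>_. ?B" by (rule product_sigma_finite_exp_measure)
  interpret PI: sigma_finite_measure "exp_product lam I" by (rule PS.sigma_finite[OF insert.hyps(1)])
  have vol: "level_volume lam \<phi> (insert i I) s = D s" for s
    unfolding D_def using insert.prems
    by (subst level_integral_insert[OF insert.hyps]) auto
  note [measurable] = measurable_energy[of I \<phi>, OF admI]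

  have "D (b + h) * D a \<le> D b * D (a + h)" if "a \<le> b" "0 \<le> h" for a b h
  proof -
    \<comment> \<open>Given the new coordinate, the conditional probability that a vector at level
      \<open>r + h\<close> already lies at level \<open>r\<close>. Its mean over the level law is
      \<open>D r / D (r + h)\<close>, so log-concavity of \<open>D\<close> becomes a comparison of
      the levels \<open>a + h\<close> and \<open>b + h\<close>.\<close>
    define k where "k r x = ?G (r - \<phi> i \<bar>x\<bar>) / ?G (r + h - \<phi> i \<bar>x\<bar>)" for r x
    have [measurable]: "k r \<in> borel_measurable borel" for r
      unfolding k_def by measurable
    have zero: "?G (r - t) = 0" if "?G (r + h - t) = 0" for r t
      using that F_mono[of "r - t" "r + h - t"] \<open>0 \<le> h\<close> by simp
    have int: "(\<integral>\<^sup>+x. k r \<bar>x\<bar> * ?G (r + h - \<phi> i \<bar>x\<bar>) \<partial>?B) = D r" for r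
      unfolding D_def k_def
      by (intro nn_integral_cong) (simp add: ennreal_times_divide_cancel zero F_finite)
    have "(\<integral>\<^sup>+x. k a \<bar>x\<bar> * ?G (a + h - \<phi> i \<bar>x\<bar>) \<partial>?B) * D (b + h)
        \<le> (\<integral>\<^sup>+x. k b \<bar>x\<bar> * ?G (b + h - \<phi> i \<bar>x\<bar>) \<partial>?B) * D (a + h)"
    proof (rule level_coupling)
      fix x y assume xy: "0 \<le> x" "x \<le> y" "\<phi> i y \<le> \<phi> i x + (b + h - (a + h))"
      show "k a x \<le> k b y"
      proof (cases "?G (a + h - \<phi> i x) = 0")
        case True
        then have "k a x = 0" using zero[of a "\<phi> i x"] xy by (simp add: k_def)
        then show ?thesis by simp
      next
        case False
        moreover from this have "?G (b + h - \<phi> i y) \<noteq> 0"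
          using F_mono[of "a + h - \<phi> i x" "b + h - \<phi> i y"] xy by auto
        ultimately show ?thesis
          using F_log_concave[of "a - \<phi> i x" "b - \<phi> i y" h] xy \<open>0 \<le> h\<close>
            F_finite[of "a + h - \<phi> i x"] F_finite[of "b + h - \<phi> i y"]
          by (auto simp: k_def algebra_simps zero_less_iff_neq_zero
              intro!: ennreal_divide_le_cross)
      qed
    qed (use that in auto)
    then show ?thesis by (simp add: int mult.commute)
  qed
  then have LC: "log_concave_profile D"
    using D_mono D_nonpos D_finite D_pos by (auto simp: log_concave_profile_def mono_def)

  have "level_integral lam \<phi> (insert i I) f s * D s' \<le> level_integral lam \<phi> (insert i I) f s' * D s"
    if f [measurable]: "f \<in> borel_measurable (exp_product lam (insert i I))"
      and mono: "abs_mono (insert i I) f" and s: "s \<le> s'" for f s s'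
  proof -
    \<comment> \<open>Integral over the old coordinates with the new one fixed at \<open>t\<close>;
      dividing by the volume in \<open>k\<close> gives a conditional expectation of \<open>f\<close>
      given the new coordinate.\<close>
    define N where "N t u = level_integral lam \<phi> I (\<lambda>x. f (x(i := t))) u" for t u
    define k where "k r t = N \<bar>t\<bar> (r - \<phi> i \<bar>t\<bar>) / ?G (r - \<phi> i \<bar>t\<bar>)" for r t
    have [measurable]: "(\<lambda>x. f (x(i := t))) \<in> borel_measurable (exp_product lam I)" for t
      using insert.hyps by measurable
    have [measurable]: "(\<lambda>t. N \<bar>t\<bar> (r - \<phi> i \<bar>t\<bar>)) \<in> borel_measurable borel" for r
      unfolding N_def level_integral_def
      using insert.hyps by (intro PI.borel_measurable_nn_integral) measurable
    have [measurable]: "k r \<in> borel_measurable borel" for r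
      unfolding k_def by measurable
    have null: "N t u = 0" if "?G u = 0" for t u
      unfolding N_def using that admI by (rule level_integral_null) measurable
    have abs: "N \<bar>t\<bar> u = N t u" for t u
      unfolding N_def
      by (intro antisym level_integral_mono abs_monoD[OF mono] fun_upd_PiE_UNIV) auto
    have int: "level_integral lam \<phi> (insert i I) f r = (\<integral>\<^sup>+t. k r \<bar>t\<bar> * ?G (r - \<phi> i \<bar>t\<bar>) \<partial>?B)" for r
      using insert.prems
      by (subst level_integral_insert[OF insert.hyps])
        (auto intro!: nn_integral_cong simp: k_def ennreal_times_divide_cancel null F_finite abs N_def[symmetric])
    show ?thesis
      unfolding int
    proof (rule level_coupling)
      fix x y assume xy: "0 \<le> x" "x \<le> y" "\<phi> i y \<le> \<phi> i x + (s' - s)"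
      define u v where "u = s - \<phi> i x" and "v = s' - \<phi> i y"
      have uv: "u \<le> v" using xy by (simp add: u_def v_def)
      \<comment> \<open>The coupling raises budget and coordinate together. The budget is raised
        first at fixed \<open>x\<close> by the induction hypothesis, then the coordinate at fixed
        budget by monotonicity of \<open>f\<close>.\<close>
      have "N x u / ?G u \<le> N x v / ?G v"
      proof (cases "?G u = 0")
        case False
        moreover from this have "?G v \<noteq> 0" using F_mono[OF uv] by auto
        moreover have "N x u * ?G v \<le> N x v * ?G u"
          unfolding N_def by (intro IH2 abs_mono_section[OF mono] uv) measurable
        ultimately show ?thesis
          using F_finite by (intro ennreal_divide_le_cross) (auto simp: zero_less_iff_neq_zero)
      qed (simp add: null)
      also have "N x v / ?G v \<le> N y v / ?G v"
        unfolding N_def using xy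
        by (intro divide_right_mono_ennreal level_integral_mono abs_monoD[OF mono] fun_upd_PiE_UNIV) auto
      finally show "k s x \<le> k s' y"
        using xy by (simp add: k_def u_def v_def)
    qed (use s in auto)
  qed
  with LC show ?case by (simp add: vol)
qed

section \<open>Choice of the parameter\<close>

lemma set_integral_mono_subset:
  fixes F :: "real \<Rightarrow> real"
  assumes "set_integrable lborel B F" "A \<in> sets borel" "A \<subseteq> B" "\<And>s. s \<in> B \<Longrightarrow> 0 \<le> F s"
  shows "(LINT s:A|lborel. F s) \<le> (LINT s:B|lborel. F s)"
proof -
  have "set_integrable lborel A F"
    using assms(2,3) by (intro set_integrable_subset[OF assms(1)]) auto
  then show ?thesis
    using assms unfolding set_lebesgue_integral_def set_integrable_def
    by (intro integral_mono) (auto simp: indicator_def)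
qed

lemma shift_integral:
  fixes F :: "real \<Rightarrow> real"
  shows "(LINT s:A|lborel. F s) = (LINT u:{u. u + h \<in> A}|lborel. F (u + h))"
proof -
  have "(LINT s:A|lborel. F s) = (\<integral>u. indicator A (h + u) * F (h + u) \<partial>lborel)"
    unfolding set_lebesgue_integral_def by (subst lborel_integral_real_affine[of 1 _ h]) auto
  also have "\<dots> = (LINT u:{u. u + h \<in> A}|lborel. F (u + h))"
    unfolding set_lebesgue_integral_def
    by (intro Bochner_Integration.integral_cong) (auto simp: indicator_def add.commute)
  finally show ?thesis .
qed

section \<open>Exponential tilts of a log-concave level profile\<close>

locale laplace_profile =
  fixes g :: "real \<Rightarrow> real" and E :: real
  assumes E: "0 < E"
    and g_mono: "\<And>s t. s \<le> t \<Longrightarrow> g s \<le> g t"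
    and g_neg: "\<And>s. s < 0 \<Longrightarrow> g s = 0"
    and g_pos: "\<And>s. 0 < s \<Longrightarrow> 0 < g s"
    and g_log_concave: "\<And>a b h. a \<le> b \<Longrightarrow> 0 \<le> h \<Longrightarrow> g (b + h) * g a \<le> g b * g (a + h)"
    and g_integrable: "\<And>\<tau>. 0 < \<tau> \<Longrightarrow> integrable lborel (\<lambda>s. exp (- \<tau> * s) * g s)"
begin

lemma g_nonneg: "0 \<le> g s"
  using g_pos[of s] g_neg[of s] g_mono[of "-1" s] by (cases "s < 0"; cases "0 < s") (auto simp: g_neg)

lemma measurable_g [measurable]: "g \<in> borel_measurable borel"
  using g_mono by (intro borel_measurable_mono monoI)

text \<open>Unnormalised density of the mixing level, recentred at \<open>E\<close>: raising
  \<open>\<tau>\<close> then lowers it above \<open>E\<close> and raises it below, with the value at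
  \<open>E\<close> fixed.\<close>

definition f :: "real \<Rightarrow> real \<Rightarrow> real" where "f \<tau> s = exp (- \<tau> * (s - E)) * g s"

lemma measurable_f [measurable]: "f \<tau> \<in> borel_measurable borel"
  unfolding f_def by measurable

lemma f_nonneg: "0 \<le> f \<tau> s"
  by (simp add: f_def g_nonneg)

lemma f_integrable: "0 < \<tau> \<Longrightarrow> integrable lborel (f \<tau>)"
proof -
  assume "0 < \<tau>"
  have "f \<tau> = (\<lambda>s. exp (\<tau> * E) * (exp (- \<tau> * s) * g s))"
    by (auto simp: f_def fun_eq_iff right_diff_distrib exp_diff exp_minus divide_simps)
  then show ?thesis using g_integrable[OF \<open>0 < \<tau>\<close>] by simp
qed

text \<open>Half of the exponential rate pays for the linear factor: with
  \<open>y = \<tau> / 2 * (s - E)\<close>, the product \<open>\<bar>y\<bar> * exp (- y)\<close> is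
  bounded on \<open>s \<ge> 0\<close>, and \<open>f (\<tau> / 2)\<close> is integrable.\<close>

lemma f_moment_integrable:
  assumes "0 < \<tau>" shows "integrable lborel (\<lambda>s. (s - E) * f \<tau> s)"
proof (rule Bochner_Integration.integrable_bound)
  show "integrable lborel (\<lambda>s. exp (\<tau> * E) * (2 / \<tau>) * f (\<tau> / 2) s)"
    using f_integrable[of "\<tau> / 2"] assms by simp
  show "AE s in lborel. norm ((s - E) * f \<tau> s) \<le> norm (exp (\<tau> * E) * (2 / \<tau>) * f (\<tau> / 2) s)"
  proof (intro always_eventually allI)
    fix s
    show "norm ((s - E) * f \<tau> s) \<le> norm (exp (\<tau> * E) * (2 / \<tau>) * f (\<tau> / 2) s)"
    proof (cases "s < 0")
      case False
      define y where "y = \<tau> / 2 * (s - E)"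
      have y: "\<bar>y\<bar> * exp (- y) \<le> exp (\<tau> * E)"
      proof (cases "0 \<le> y")
        case True
        have "y \<le> exp y" using exp_ge_add_one_self[of y] by linarith
        then have "y * exp (- y) \<le> 1" by (simp add: exp_minus field_simps)
        also have "1 \<le> exp (\<tau> * E)" using assms E by simp
        finally show ?thesis using True by simp
      next
        case False
        have "- y \<le> exp (- y)" using exp_ge_add_one_self[of "- y"] by simp
        then have "\<bar>y\<bar> * exp (- y) \<le> exp (- y) * exp (- y)" using False by (intro mult_right_mono) auto
        also have "\<dots> = exp (\<tau> * (E - s))" by (simp add: y_def exp_add[symmetric] algebra_simps)
        also have "\<dots> \<le> exp (\<tau> * E)" using \<open>\<not> s < 0\<close> assms by simp
        finally show ?thesis .
      qed
      have "\<bar>s - E\<bar> = 2 / \<tau> * \<bar>y\<bar>" using assms by (simp add: y_def abs_mult)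
      moreover have "f \<tau> s = exp (- y) * f (\<tau> / 2) s"
        by (simp add: f_def y_def exp_add[symmetric] algebra_simps)
      ultimately have "norm ((s - E) * f \<tau> s) = (\<bar>y\<bar> * exp (- y)) * (2 / \<tau>) * f (\<tau> / 2) s"
        using f_nonneg[of "\<tau> / 2" s] assms by (simp add: abs_mult)
      also have "\<dots> \<le> exp (\<tau> * E) * (2 / \<tau>) * f (\<tau> / 2) s"
        using y assms f_nonneg by (intro mult_right_mono) auto
      finally show ?thesis using assms f_nonneg[of "\<tau> / 2" s] by simp
    qed (simp add: f_def g_neg)
  qed
qed simp

definition H :: "real set \<Rightarrow> real \<Rightarrow> real" where
  "H A \<tau> = (LINT s:A|lborel. f \<tau> s)"

lemma f_set_integrable: "0 < \<tau> \<Longrightarrow> A \<in> sets borel \<Longrightarrow> set_integrable lborel A (f \<tau>)"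
  unfolding set_integrable_def by (intro integrable_mult_indicator f_integrable) auto

lemma f_moment_set_integrable:
  "0 < \<tau> \<Longrightarrow> A \<in> sets borel \<Longrightarrow> set_integrable lborel A (\<lambda>s. (s - E) * f \<tau> s)"
  unfolding set_integrable_def by (intro integrable_mult_indicator f_moment_integrable) auto

lemma H_Un:
  "0 < \<tau> \<Longrightarrow> A \<in> sets borel \<Longrightarrow> A' \<in> sets borel \<Longrightarrow> A \<inter> A' = {} \<Longrightarrow> H (A \<union> A') \<tau> = H A \<tau> + H A' \<tau>"
  unfolding H_def by (intro set_integral_Un f_set_integrable)

lemma H_split: "0 < \<tau> \<Longrightarrow> H UNIV \<tau> = H {..E} \<tau> + H {E<..} \<tau>"
proof -
  assume "0 < \<tau>"
  moreover have "{..E} \<union> {E<..} = UNIV" "{..E} \<inter> {E<..} = {}" by auto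
  ultimately show ?thesis using H_Un[of \<tau> "{..E}" "{E<..}"] by simp
qed

lemma H_nonneg: "0 \<le> H A \<tau>"
  unfolding H_def set_lebesgue_integral_def by (intro integral_nonneg_AE always_eventually) (simp add: f_nonneg)

lemma H_mono_set:
  assumes "0 < \<tau>" "A \<in> sets borel" "A' \<in> sets borel" "A \<subseteq> A'" shows "H A \<tau> \<le> H A' \<tau>"
  using H_Un[of \<tau> A "A' - A"] assms H_nonneg[of "A' - A" \<tau>] by (simp add: Un_absorb1)

text \<open>A superposition of exponentials in \<open>\<tau>\<close> with nonnegative weights.
  Convexity is wanted for the continuity it gives on the open half-line, on which both choices by
  the intermediate value theorem rest.\<close>

lemma convex_H:
  assumes [measurable]: "A \<in> sets borel"
  shows "convex_on {0<..} (H A)"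
proof (rule convex_onI)
  fix t x y :: real assume t: "0 < t" "t < 1" and xy: "x \<in> {0<..}" "y \<in> {0<..}"
  then have pos: "0 < (1 - t) *\<^sub>R x + t *\<^sub>R y" by (auto intro: add_pos_pos)
  have "H A ((1 - t) *\<^sub>R x + t *\<^sub>R y) \<le> (LINT s:A|lborel. (1 - t) * f x s + t * f y s)"
    unfolding H_def
  proof (rule set_integral_mono)
    fix s
    have "exp (- ((1 - t) *\<^sub>R x + t *\<^sub>R y) * (s - E)) \<le> (1 - t) * exp (- x * (s - E)) + t * exp (- y * (s - E))"
      using convex_onD[OF exp_convex, of t "- x * (s - E)" "- y * (s - E)"] t by (simp add: algebra_simps)
    from mult_right_mono[OF this g_nonneg[of s]]
    show "f ((1 - t) *\<^sub>R x + t *\<^sub>R y) s \<le> (1 - t) * f x s + t * f y s"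
      by (simp add: f_def algebra_simps)
  qed (use xy pos in \<open>auto intro!: f_set_integrable set_integral_add set_integrable_mult_right\<close>)
  also have "\<dots> = (1 - t) * H A x + t * H A y"
    unfolding H_def using xy
    by (subst set_integral_add) (auto intro!: f_set_integrable set_integrable_mult_right simp: set_integral_mult_right)
  finally show "H A ((1 - t) *\<^sub>R x + t *\<^sub>R y) \<le> (1 - t) * H A x + t * H A y" .
qed (simp add: convex_real_interval)

lemma continuous_H: "A \<in> sets borel \<Longrightarrow> continuous_on {0<..} (H A)"
  by (intro convex_on_continuous convex_H) auto

lemma H_upper_antimono:
  assumes "0 < \<tau>'" "\<tau>' \<le> \<tau>" shows "H {E<..} \<tau> \<le> H {E<..} \<tau>'"
  unfolding H_def using assms
  by (intro set_integral_mono f_set_integrable) (auto simp: f_def intro!: mult_right_mono g_nonneg)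

lemma H_lower_mono:
  assumes "0 < \<tau>'" "\<tau>' \<le> \<tau>" shows "H {..E} \<tau>' \<le> H {..E} \<tau>"
  unfolding H_def using assms
  by (intro set_integral_mono f_set_integrable)
    (auto simp: f_def mult_right_mono_neg intro!: mult_right_mono[OF _ g_nonneg])

text \<open>Within \<open>1 / \<tau>\<close> above \<open>E\<close> the exponential loses at most a
  factor \<open>exp 1\<close> and \<open>g\<close> is at least \<open>g E\<close>. The bound
  diverges as \<open>\<tau>\<close> tends to 0.\<close>

lemma H_upper_ge:
  assumes "0 < \<tau>" shows "exp (- 1) * g E / \<tau> \<le> H {E<..} \<tau>"
proof -
  have "exp (- 1) * g E / \<tau> = (LINT s:{E<..E + 1 / \<tau>}|lborel. exp (- 1) * g E)"
    using assms by (simp add: set_integral_const)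
  also have "\<dots> \<le> H {E<..E + 1 / \<tau>} \<tau>"
    unfolding H_def
  proof (rule set_integral_mono)
    fix s assume "s \<in> {E<..E + 1 / \<tau>}"
    then have "\<tau> * (s - E) \<le> 1" "E \<le> s" using assms by (auto simp: field_simps)
    then show "exp (- 1) * g E \<le> f \<tau> s"
      unfolding f_def by (intro mult_mono g_mono) (auto simp: g_nonneg)
  qed (use assms in \<open>auto intro!: f_set_integrable\<close>, simp add: set_integrable_def)
  also have "\<dots> \<le> H {E<..} \<tau>" using assms by (intro H_mono_set) auto
  finally show ?thesis .
qed

text \<open>The window stays a distance \<open>E / 4\<close> below \<open>E\<close>, which makes the
  tilt exponentially large, and above \<open>E / 2\<close>, where \<open>g\<close> is bounded away
  from 0.\<close>

lemma H_middle_ge: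
  assumes "0 < \<tau>" shows "exp (\<tau> * (E / 4)) * (E / 4 * g (E / 2)) \<le> H {E/2<..3 * E / 4} \<tau>"
proof -
  have "exp (\<tau> * (E / 4)) * (E / 4 * g (E / 2)) =
      (LINT s:{E/2<..3 * E / 4}|lborel. exp (\<tau> * (E / 4)) * g (E / 2))"
    using E by (simp add: set_integral_const)
  also have "\<dots> \<le> H {E/2<..3 * E / 4} \<tau>"
    unfolding H_def
  proof (rule set_integral_mono)
    show "set_integrable lborel {E/2<..3 * E / 4} (\<lambda>s. exp (\<tau> * (E / 4)) * g (E / 2))"
      unfolding set_integrable_def by (rule integrable_scaleR_left) (auto intro!: integrable_real_indicator simp: emeasure_lborel_Ioc E less_imp_le)
    fix s assume "s \<in> {E/2<..3 * E / 4}"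
    then have "\<tau> * (E / 4) \<le> \<tau> * (E - s)" "E / 2 \<le> s" using assms by auto
    then show "exp (\<tau> * (E / 4)) * g (E / 2) \<le> f \<tau> s"
      unfolding f_def by (intro mult_mono g_mono) (auto simp: g_nonneg algebra_simps)
  qed (use assms in \<open>auto intro!: f_set_integrable\<close>)
  finally show ?thesis .
qed

lemma H_lower_ge:
  assumes "0 < \<tau>" shows "exp (\<tau> * (E / 4)) * (E / 4 * g (E / 2)) \<le> H {..E} \<tau>"
proof -
  have "{E/2<..3 * E / 4} \<subseteq> {..E}" using E by auto
  then show ?thesis
    using H_middle_ge[OF assms] H_mono_set[OF assms, of "{E/2<..3 * E / 4}" "{..E}"] by simp
qed

text \<open>Intermediate value theorem: the upper mass blows up as \<open>\<tau>\<close> tends to 0,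
  the lower mass as \<open>\<tau>\<close> tends to infinity. The ratio 3 is what produces the
  contraction factor 1/2 in \<open>upper_moment_le\<close>.\<close>

lemma quarter_parameter:
  obtains \<tau> where "0 < \<tau>" "H {..E} \<tau> = 3 * H {E<..} \<tau>"
proof -
  define D where "D \<tau> = H {..E} \<tau> - 3 * H {E<..} \<tau>" for \<tau>
  have gE: "0 < g E" "0 < g (E / 2)" using E by (auto intro: g_pos)
  \<comment> \<open>Chosen so that \<open>exp (- 1) * g E / a\<close>, a lower bound for the upper
    mass, exceeds \<open>H {..E} 1\<close>, which bounds the lower mass at \<open>a\<close>.\<close>
  define a where "a = min 1 (exp (- 1) * g E / (H {..E} 1 + 1))"
  have a: "0 < a" "a \<le> 1" using gE H_nonneg[of "{..E}" 1] by (auto simp: a_def add_nonneg_pos)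
  have "a * (H {..E} 1 + 1) \<le> exp (- 1) * g E"
    using H_nonneg[of "{..E}" 1] by (subst pos_le_divide_eq[symmetric]) (auto simp: a_def)
  then have "H {..E} 1 + 1 \<le> exp (- 1) * g E / a" using a by (simp add: field_simps)
  then have "D a \<le> 0"
    using H_upper_ge[OF a(1)] H_lower_mono[OF a] H_nonneg[of "{E<..}" a] by (simp add: D_def)
  define c where "c = E / 4 * g (E / 2)"
  have c: "0 < c" using E gE by (simp add: c_def)
  define b where "b = max 1 (3 * H {E<..} 1 / (c * (E / 4)))"
  have b: "1 \<le> b" by (simp add: b_def)
  have "3 * H {E<..} 1 \<le> c * (b * (E / 4))"
    using c E by (simp add: b_def max_def field_simps not_le)
  also have "\<dots> \<le> exp (b * (E / 4)) * c"
    using exp_ge_add_one_self[of "b * (E / 4)"] c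
    by (subst mult.commute[of _ c], intro mult_left_mono) linarith+
  also have "\<dots> \<le> H {..E} b" unfolding c_def using b by (intro H_lower_ge) auto
  finally have "0 \<le> D b" using H_upper_antimono[of 1 b] b by (simp add: D_def)
  have "continuous_on {a..b} D"
    unfolding D_def using a
    by (intro continuous_intros continuous_on_subset[OF continuous_H]) auto
  with \<open>D a \<le> 0\<close> \<open>0 \<le> D b\<close> a b obtain \<tau> where "a \<le> \<tau>" "D \<tau> = 0"
    using IVT'[of D a 0 b] by auto
  with a that[of \<tau>] show ?thesis by (simp add: D_def)
qed

lemma f_shift_integrable: "0 < \<tau> \<Longrightarrow> integrable lborel (\<lambda>u. f \<tau> (u + h))"
  using lborel_integrable_real_affine[OF f_integrable, of \<tau> 1 h] by (simp add: add.commute)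

text \<open>The tilting factor of a product depends only on the sum of the two arguments, and this
  sum is the same on both sides.\<close>

lemma f_log_concave:
  assumes "a \<le> b" "0 \<le> h" shows "f \<tau> (b + h) * f \<tau> a \<le> f \<tau> b * f \<tau> (a + h)"
proof -
  have "f \<tau> (b + h) * f \<tau> a = exp (- \<tau> * (a + b + h - 2 * E)) * (g (b + h) * g a)"
    by (simp add: f_def exp_add[symmetric] algebra_simps)
  also have "\<dots> \<le> exp (- \<tau> * (a + b + h - 2 * E)) * (g b * g (a + h))"
    by (intro mult_left_mono g_log_concave assms) auto
  also have "\<dots> = f \<tau> b * f \<tau> (a + h)"
    by (simp add: f_def exp_add[symmetric] algebra_simps)
  finally show ?thesis .
qed

lemma f_shift_set_integrable:
  "0 < \<tau> \<Longrightarrow> A \<in> sets borel \<Longrightarrow> set_integrable lborel A (\<lambda>u. f \<tau> (u + h))"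
  unfolding set_integrable_def by (intro integrable_mult_indicator f_shift_integrable) auto

text \<open>This is the derivative in \<open>\<tau>\<close> of the mass below \<open>E\<close>;
  \<open>upper_moment\<close> is minus the derivative of the mass above \<open>E\<close>.\<close>

definition lower_moment :: "real \<Rightarrow> real" where
  "lower_moment \<tau> = (LINT s:{..E}|lborel. (E - s) * f \<tau> s)"

definition upper_moment :: "real \<Rightarrow> real" where
  "upper_moment \<tau> = (LINT s:{E<..}|lborel. (s - E) * f \<tau> s)"

lemma lower_moment_integrable:
  assumes "0 < \<tau>" "A \<in> sets borel" shows "set_integrable lborel A (\<lambda>s. (E - s) * f \<tau> s)"
proof -
  have "(\<lambda>s. (E - s) * f \<tau> s) = (\<lambda>s. - ((s - E) * f \<tau> s))"
    by (auto simp: fun_eq_iff algebra_simps)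
  then show ?thesis
    using f_moment_set_integrable[OF assms] by (simp add: set_integrable_def)
qed

text \<open>Markov's inequality for the depth \<open>E - s\<close> below \<open>E\<close>.\<close>

lemma lower_moment_ge:
  assumes "0 < \<tau>" "0 \<le> h" shows "h * H {..E - h} \<tau> \<le> lower_moment \<tau>"
proof -
  have "h * H {..E - h} \<tau> = (LINT s:{..E - h}|lborel. h * f \<tau> s)"
    by (simp add: H_def)
  also have "\<dots> \<le> (LINT s:{..E - h}|lborel. (E - s) * f \<tau> s)"
    using assms by (intro set_integral_mono lower_moment_integrable set_integrable_mult_right f_set_integrable)
      (auto intro!: mult_right_mono f_nonneg)
  also have "\<dots> \<le> lower_moment \<tau>"
    unfolding lower_moment_def using assms f_nonneg
    by (intro set_integral_mono_subset lower_moment_integrable) auto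
  finally show ?thesis .
qed

text \<open>Since \<open>g\<close> is nondecreasing, translation by \<open>1 / \<tau>\<close> keeps
  at least the fraction \<open>exp (- 1)\<close> of the density. At least that fraction of the upper
  mass lies beyond \<open>E + 1 / \<tau>\<close>, where
  \<open>s - E \<ge> 1 / \<tau>\<close>.\<close>

lemma upper_moment_ge:
  assumes "0 < \<tau>" shows "exp (- 1) / \<tau> * H {E<..} \<tau> \<le> upper_moment \<tau>"
proof -
  have "exp (- 1) * H {E<..} \<tau> = (LINT u:{E<..}|lborel. exp (- 1) * f \<tau> u)"
    by (simp add: H_def)
  also have "\<dots> \<le> (LINT u:{E<..}|lborel. f \<tau> (u + 1 / \<tau>))"
  proof (rule set_integral_mono)
    fix u
    have "exp (- 1) * f \<tau> u = exp (- \<tau> * (u + 1 / \<tau> - E)) * g u"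
      using assms by (simp add: f_def exp_add[symmetric] algebra_simps)
    also have "\<dots> \<le> f \<tau> (u + 1 / \<tau>)"
      unfolding f_def using assms by (intro mult_left_mono g_mono) auto
    finally show "exp (- 1) * f \<tau> u \<le> f \<tau> (u + 1 / \<tau>)" .
  qed (use assms in \<open>auto intro!: f_set_integrable set_integrable_mult_right f_shift_set_integrable\<close>)
  also have "\<dots> = H {E + 1 / \<tau><..} \<tau>"
    unfolding H_def by (subst shift_integral[where h = "1 / \<tau>" and A = "{E + 1 / \<tau><..}"]) (simp add: greaterThan_def)
  finally have "exp (- 1) / \<tau> * H {E<..} \<tau> \<le> 1 / \<tau> * H {E + 1 / \<tau><..} \<tau>"
    using assms by (simp add: divide_right_mono)
  also have "\<dots> = (LINT s:{E + 1 / \<tau><..}|lborel. 1 / \<tau> * f \<tau> s)"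
    by (simp only: H_def set_integral_mult_right)
  also have "\<dots> \<le> (LINT s:{E + 1 / \<tau><..}|lborel. (s - E) * f \<tau> s)"
    using assms by (intro set_integral_mono f_moment_set_integrable set_integrable_mult_right
        f_set_integrable mult_right_mono f_nonneg) auto
  also have "\<dots> \<le> upper_moment \<tau>"
    unfolding upper_moment_def
    using assms f_nonneg
    by (intro set_integral_mono_subset f_moment_set_integrable) (auto intro: less_trans[rotated])
  finally show ?thesis .
qed

text \<open>
  With \<open>h\<close> as in the proof, at least half of the total mass lies in \<open>{E - h<..E}\<close> and at most a quarter in
  \<open>{E<..}\<close>, so by log-concavity translation by \<open>h\<close> multiplies the density above \<open>E\<close> by at most \<open>1 / 2\<close>.
\<close>

lemma upper_moment_le:
  assumes \<tau>: "0 < \<tau>" and quarter: "H {..E} \<tau> = 3 * H {E<..} \<tau>"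
  shows "upper_moment \<tau> \<le> 3 * lower_moment \<tau>"
proof -
  let ?P = "H {E<..} \<tau>"
  have gE: "0 < g E" "0 < g (E / 2)" using E by (auto intro: g_pos)
  have P: "0 < ?P"
    using H_upper_ge[OF \<tau>] \<tau> gE by (smt (verit) divide_pos_pos exp_gt_zero mult_pos_pos)
  have "0 < E / 4 * H {..E - E / 4} \<tau>"
  proof -
    have "0 < H {E/2<..3 * E / 4} \<tau>"
      using H_middle_ge[OF \<tau>] gE E by (smt (verit) divide_pos_pos exp_gt_zero mult_pos_pos)
    also have "\<dots> \<le> H {..E - E / 4} \<tau>" using \<tau> by (intro H_mono_set) auto
    finally show ?thesis using E by simp
  qed
  then have M: "0 < lower_moment \<tau>" using lower_moment_ge[OF \<tau>, of "E / 4"] E by simp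
  \<comment> \<open>With this displacement, Markov's inequality leaves mass at most
    \<open>?P\<close> below \<open>E - h\<close>.\<close>
  define h where "h = lower_moment \<tau> / ?P"
  have h: "0 < h" "h * ?P = lower_moment \<tau>" using M P by (auto simp: h_def)
  \<comment> \<open>The ratio \<open>f \<tau> (u + h) / f \<tau> u\<close> decreases in
    \<open>u\<close>, so its value at \<open>E\<close> bounds it from above beyond \<open>E\<close>
    and from below before \<open>E\<close>.\<close>
  define \<kappa> where "\<kappa> = f \<tau> (E + h) / f \<tau> E"
  have fE: "0 < f \<tau> E" using gE by (simp add: f_def)
  have \<kappa>0: "0 \<le> \<kappa>" by (simp add: \<kappa>_def f_nonneg)
  have above: "f \<tau> (u + h) \<le> \<kappa> * f \<tau> u" if "E \<le> u" for u
    using f_log_concave[OF that, of h \<tau>] h fE by (simp add: \<kappa>_def field_simps)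
  have below: "\<kappa> * f \<tau> u \<le> f \<tau> (u + h)" if "u \<le> E" for u
    using f_log_concave[OF that, of h \<tau>] h fE by (simp add: \<kappa>_def field_simps)
  have "H {..E} \<tau> = H {..E - h} \<tau> + H {E - h<..E} \<tau>"
    using h \<tau> by (subst H_Un[symmetric]) (auto intro!: arg_cong[where f = "\<lambda>A. H A \<tau>"])
  moreover have "H {..E - h} \<tau> \<le> ?P"
    using lower_moment_ge[OF \<tau>, of h] h by (metis less_eq_real_def mult_le_cancel_left_pos)
  ultimately have "\<kappa> * (2 * ?P) \<le> \<kappa> * H {E - h<..E} \<tau>"
    using quarter \<kappa>0 by (intro mult_left_mono) auto
  also have "\<dots> = (LINT u:{E - h<..E}|lborel. \<kappa> * f \<tau> u)"
    by (simp add: H_def)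
  also have "\<dots> \<le> (LINT u:{E - h<..E}|lborel. f \<tau> (u + h))"
    using \<tau> below
    by (intro set_integral_mono set_integrable_mult_right f_set_integrable f_shift_set_integrable) auto
  also have "\<dots> = (LINT u:{u. u + h \<in> {E<..E + h}}|lborel. f \<tau> (u + h))"
    by (intro arg_cong2[where f = "set_lebesgue_integral lborel"] refl) auto
  also have "\<dots> = H {E<..E + h} \<tau>"
    unfolding H_def by (rule shift_integral[symmetric])
  also have "\<dots> \<le> ?P" using \<tau> by (intro H_mono_set) auto
  finally have \<kappa>: "\<kappa> \<le> 1 / 2" using P by (simp add: field_simps)

  have "upper_moment \<tau> = (LINT s:{E<..E + h}|lborel. (s - E) * f \<tau> s) + (LINT s:{E + h<..}|lborel. (s - E) * f \<tau> s)"
    unfolding upper_moment_def using \<tau> h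
    by (subst set_integral_Un[symmetric])
      (auto intro!: f_moment_set_integrable arg_cong2[where f = "set_lebesgue_integral lborel"])
  also have "(LINT s:{E<..E + h}|lborel. (s - E) * f \<tau> s) \<le> (LINT s:{E<..E + h}|lborel. h * f \<tau> s)"
    using \<tau> by (intro set_integral_mono f_moment_set_integrable set_integrable_mult_right f_set_integrable)
      (auto intro!: mult_right_mono f_nonneg)
  also have "\<dots> = h * H {E<..E + h} \<tau>" by (simp add: H_def)
  also have "\<dots> \<le> h * ?P" using \<tau> h by (intro mult_left_mono H_mono_set) auto
  also have "(LINT s:{E + h<..}|lborel. (s - E) * f \<tau> s) = (LINT u:{E<..}|lborel. (u + h - E) * f \<tau> (u + h))"
    by (subst shift_integral[where h = h]) (simp add: greaterThan_def)
  also have "\<dots> \<le> (LINT u:{E<..}|lborel. \<kappa> * ((u - E) * f \<tau> u + h * f \<tau> u))"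
  proof (rule set_integral_mono)
    show "set_integrable lborel {E<..} (\<lambda>u. (u + h - E) * f \<tau> (u + h))"
      unfolding set_integrable_def
      using lborel_integrable_real_affine[OF f_moment_integrable[OF \<tau>], of 1 h]
      by (intro integrable_mult_indicator) (auto simp: algebra_simps)
    show "set_integrable lborel {E<..} (\<lambda>u. \<kappa> * ((u - E) * f \<tau> u + h * f \<tau> u))"
      using \<tau> by (intro set_integrable_mult_right set_integral_add f_moment_set_integrable f_set_integrable) auto
    fix u assume "u \<in> {E<..}"
    then have "(u + h - E) * f \<tau> (u + h) \<le> (u + h - E) * (\<kappa> * f \<tau> u)"
      using above[of u] h by (intro mult_left_mono) auto
    then show "(u + h - E) * f \<tau> (u + h) \<le> \<kappa> * ((u - E) * f \<tau> u + h * f \<tau> u)"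
      by (simp add: algebra_simps)
  qed
  also have "\<dots> = \<kappa> * (upper_moment \<tau> + h * ?P)"
    unfolding upper_moment_def H_def using \<tau>
    by (subst set_integral_mult_right, subst set_integral_add)
      (auto intro!: f_moment_set_integrable f_set_integrable set_integrable_mult_right)
  also have "\<dots> \<le> 1 / 2 * (upper_moment \<tau> + h * ?P)"
  proof (rule mult_right_mono[OF \<kappa>])
    have "0 \<le> exp (- 1) / \<tau> * ?P" using \<tau> P by simp
    then show "0 \<le> upper_moment \<tau> + h * ?P" using upper_moment_ge[OF \<tau>] h M by linarith
  qed
  \<comment> \<open>The upper moment \<open>m\<close> now satisfies
    \<open>m \<le> h * ?P + (m + h * ?P) / 2\<close>, hence \<open>m \<le> 3 * h * ?P\<close>, and
    \<open>h * ?P\<close> is the lower moment.\<close>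
  finally show ?thesis unfolding h(2) by (simp add: field_simps)
qed

text \<open>Intermediate value theorem between \<open>\<tau>'\<close>, where the quotient is half of
  the target, and a large \<open>b\<close>. The division by \<open>\<tau>\<close> is why the
  quadratic term of the exponential is used for growth.\<close>

lemma doubling_parameter:
  assumes \<tau>': "0 < \<tau>'"
  obtains \<tau> where "\<tau>' < \<tau>" "H UNIV \<tau> / \<tau> = 2 * (H UNIV \<tau>' / \<tau>')"
proof -
  have gE: "0 < g (E / 2)" using E by (auto intro: g_pos)
  define c where "c = E / 4 * g (E / 2)"
  have c: "0 < c" using E gE by (simp add: c_def)
  define y where "y = 2 * (H UNIV \<tau>' / \<tau>')"
  have "0 < exp (\<tau>' * (E / 4)) * c" using c by simp
  also have "\<dots> \<le> H {..E} \<tau>'" unfolding c_def by (rule H_lower_ge[OF \<tau>'])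
  also have "\<dots> \<le> H UNIV \<tau>'" using \<tau>' by (intro H_mono_set) auto
  finally have "0 < H UNIV \<tau>' / \<tau>'" using \<tau>' by simp
  then have y: "H UNIV \<tau>' / \<tau>' < y" unfolding y_def by linarith
  \<comment> \<open>Solves \<open>y * b \<le> c * (b * (E / 4))^2 / 2\<close>, the quadratic Taylor
    bound for the lower mass at \<open>b\<close>.\<close>
  define b where "b = max \<tau>' (2 * y / (c * (E / 4)^2))"
  have b: "\<tau>' \<le> b" "0 < b" using \<tau>' by (auto simp: b_def)
  have "y * b \<le> c * (b * (E / 4))^2 / 2"
  proof -
    have "2 * y \<le> b * (c * (E / 4)^2)"
      using c E by (subst pos_divide_le_eq[symmetric]) (auto simp: b_def)
    then have "2 * y * b \<le> b * (c * (E / 4)^2) * b" using b by (intro mult_right_mono) auto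
    then show ?thesis by (simp add: power2_eq_square algebra_simps)
  qed
  also have "\<dots> \<le> exp (b * (E / 4)) * c"
  proof -
    have "(b * (E / 4))^2 / 2 \<le> exp (b * (E / 4))"
      using exp_lower_Taylor_quadratic[of "b * (E / 4)"] b E by (smt (verit) divide_nonneg_nonneg mult_nonneg_nonneg)
    from mult_right_mono[OF this, of c] c show ?thesis by (simp add: mult.commute)
  qed
  also have "\<dots> \<le> H {..E} b" unfolding c_def using b by (intro H_lower_ge) auto
  also have "\<dots> \<le> H UNIV b" using b by (intro H_mono_set) auto
  finally have "y \<le> H UNIV b / b" using b by (simp add: field_simps)
  moreover have "continuous_on {\<tau>'..b} (\<lambda>\<tau>. H UNIV \<tau> / \<tau>)"
    using \<tau>' by (intro continuous_intros continuous_on_subset[OF continuous_H]) auto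
  ultimately obtain \<tau> where "\<tau>' \<le> \<tau>" "H UNIV \<tau> / \<tau> = y"
    using IVT'[of "\<lambda>\<tau>. H UNIV \<tau> / \<tau>" \<tau>' y b] y b by auto
  with y that[of \<tau>] show ?thesis by (cases "\<tau> = \<tau>'") (auto simp: y_def)
qed

text \<open>
  Jensen's inequality for the tilt from \<open>\<tau>'\<close> to \<open>\<tau>\<close>, in the form of a tangent line to the exponential.
\<close>

lemma tangent_lower:
  assumes "0 < \<tau>'" "\<tau>' < \<tau>"
  shows "exp ((\<tau> - \<tau>') * lower_moment \<tau>' / H {..E} \<tau>') * H {..E} \<tau>' \<le> H {..E} \<tau>"
proof (cases "H {..E} \<tau>' = 0")
  case False
  \<comment> \<open>The mean of \<open>(\<tau> - \<tau>') * (E - s)\<close> under the density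
    \<open>f \<tau>'\<close> on \<open>{..E}\<close>. The tangent to the exponential is taken at
    this mean, so its linear part integrates to 0.\<close>
  define c where "c = (\<tau> - \<tau>') * lower_moment \<tau>' / H {..E} \<tau>'"
  have "exp c * H {..E} \<tau>' = exp c * ((1 - c) * H {..E} \<tau>' + (\<tau> - \<tau>') * lower_moment \<tau>')"
  proof -
    have "c * H {..E} \<tau>' = (\<tau> - \<tau>') * lower_moment \<tau>'" using False by (simp add: c_def)
    then show ?thesis by (simp add: left_diff_distrib)
  qed
  also have "\<dots> = (LINT s:{..E}|lborel. exp c * ((1 - c) * f \<tau>' s + (\<tau> - \<tau>') * ((E - s) * f \<tau>' s)))"
    unfolding H_def lower_moment_def using assms
    by (subst set_integral_mult_right, subst set_integral_add)
      (auto intro!: f_set_integrable lower_moment_integrable)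
  also have "\<dots> \<le> H {..E} \<tau>"
    unfolding H_def
  proof (rule set_integral_mono)
    fix s
    have "1 + ((\<tau> - \<tau>') * (E - s) - c) \<le> exp ((\<tau> - \<tau>') * (E - s) - c)" by (rule exp_ge_add_one_self)
    then have "exp c * (1 + ((\<tau> - \<tau>') * (E - s) - c)) * f \<tau>' s
        \<le> exp c * exp ((\<tau> - \<tau>') * (E - s) - c) * f \<tau>' s"
      by (intro mult_right_mono mult_left_mono f_nonneg) auto
    also have "\<dots> = f \<tau> s" by (simp add: f_def exp_add[symmetric] algebra_simps)
    finally show "exp c * ((1 - c) * f \<tau>' s + (\<tau> - \<tau>') * ((E - s) * f \<tau>' s)) \<le> f \<tau> s"
      by (simp add: algebra_simps)
  qed (use assms in \<open>auto intro!: f_set_integrable lower_moment_integrable set_integral_add\<close>)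
  finally show ?thesis by (simp add: c_def)
qed (simp add: H_nonneg)

lemma tangent_upper:
  assumes "0 < \<tau>'" "\<tau>' < \<tau>"
  shows "exp (- (\<tau> - \<tau>') * upper_moment \<tau>' / H {E<..} \<tau>') * H {E<..} \<tau>' \<le> H {E<..} \<tau>"
proof (cases "H {E<..} \<tau>' = 0")
  case False
  \<comment> \<open>The same mean over \<open>{E<..}\<close>, now negative.\<close>
  define c where "c = - (\<tau> - \<tau>') * upper_moment \<tau>' / H {E<..} \<tau>'"
  have "exp c * H {E<..} \<tau>' = exp c * ((1 - c) * H {E<..} \<tau>' + - (\<tau> - \<tau>') * upper_moment \<tau>')"
  proof -
    have "c * H {E<..} \<tau>' = - (\<tau> - \<tau>') * upper_moment \<tau>'" using False by (simp add: c_def)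
    then show ?thesis by (simp add: left_diff_distrib)
  qed
  also have "\<dots> = (LINT s:{E<..}|lborel. exp c * ((1 - c) * f \<tau>' s + - (\<tau> - \<tau>') * ((s - E) * f \<tau>' s)))"
    unfolding H_def upper_moment_def using assms
    by (subst set_integral_mult_right, subst set_integral_add, simp_all only: set_integral_mult_right)
      (auto intro!: f_set_integrable f_moment_set_integrable set_integrable_mult_right)
  also have "\<dots> \<le> H {E<..} \<tau>"
    unfolding H_def
  proof (rule set_integral_mono)
    fix s
    have "1 + ((\<tau> - \<tau>') * (E - s) - c) \<le> exp ((\<tau> - \<tau>') * (E - s) - c)" by (rule exp_ge_add_one_self)
    then have "exp c * (1 + ((\<tau> - \<tau>') * (E - s) - c)) * f \<tau>' s
        \<le> exp c * exp ((\<tau> - \<tau>') * (E - s) - c) * f \<tau>' s"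
      by (intro mult_right_mono mult_left_mono f_nonneg) auto
    also have "\<dots> = f \<tau> s" by (simp add: f_def exp_add[symmetric] algebra_simps)
    finally show "exp c * ((1 - c) * f \<tau>' s + - (\<tau> - \<tau>') * ((s - E) * f \<tau>' s)) \<le> f \<tau> s"
      by (simp add: algebra_simps)
  qed (use assms in \<open>auto intro!: f_set_integrable f_moment_set_integrable set_integral_add set_integrable_mult_right\<close>)
  finally show ?thesis by (simp add: c_def)
qed (simp add: H_nonneg)

text \<open>Exponential against linear growth: the doubling fixes the total mass at
  \<open>8 * k * P\<close>, whereas by Jensen the part below \<open>E\<close> is at least
  \<open>3 * P * exp c\<close> with \<open>c\<close> growing linearly in \<open>k\<close>. This
  bounds \<open>k\<close> and \<open>c\<close>, and a bounded tilt leaves a fixed share of the mass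
  above \<open>E\<close>.\<close>

proposition parameters:
  obtains \<tau>' \<tau> where "0 < \<tau>'" "\<tau>' < \<tau>" "H UNIV \<tau> / \<tau> = 2 * (H UNIV \<tau>' / \<tau>')"
    "H UNIV \<tau> \<le> 3 * 15000 ^ 10 * H {E<..} \<tau>"
proof -
  obtain \<tau>' where \<tau>': "0 < \<tau>'" "H {..E} \<tau>' = 3 * H {E<..} \<tau>'" by (rule quarter_parameter)
  obtain \<tau> where \<tau>: "\<tau>' < \<tau>" "H UNIV \<tau> / \<tau> = 2 * (H UNIV \<tau>' / \<tau>')" by (rule doubling_parameter[OF \<tau>'(1)])
  define P k where "P = H {E<..} \<tau>'" and "k = \<tau> / \<tau>'"
  have P: "0 < P"
    using H_upper_ge[OF \<tau>'(1)] \<tau>' g_pos[OF E] unfolding P_def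
    by (smt (verit) divide_pos_pos exp_gt_zero mult_pos_pos)
  have k: "1 < k" "\<tau> = k * \<tau>'" using \<tau>' \<tau> by (auto simp: k_def)
  \<comment> \<open>The total mass at \<open>\<tau>'\<close> is \<open>4 * P\<close>; the doubling
    contributes 2 and the ratio of the parameters \<open>k\<close>.\<close>
  have HU: "H UNIV \<tau> = 8 * k * P"
    using \<tau> \<tau>' k H_split[OF \<tau>'(1)] by (simp add: P_def field_simps)
  define c where "c = (\<tau> - \<tau>') * lower_moment \<tau>' / H {..E} \<tau>'"
  have "exp c * (3 * P) \<le> H {..E} \<tau>"
    using tangent_lower[OF \<tau>'(1) \<tau>(1)] \<tau>' by (simp add: c_def P_def)
  also have "\<dots> \<le> 8 * k * P" using HU H_split[of \<tau>] H_nonneg[of "{E<..}" \<tau>] \<tau> \<tau>' by simp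
  finally have ck: "exp c \<le> 3 * k" using P k by (simp add: field_simps)
  have um: "upper_moment \<tau>' \<le> 3 * lower_moment \<tau>'" by (rule upper_moment_le[OF \<tau>'])
  have "P / (3 * \<tau>') \<le> exp (- 1) / \<tau>' * P"
    using P \<tau>' exp_le by (simp add: exp_minus field_simps)
  also have "\<dots> \<le> 3 * lower_moment \<tau>'" using upper_moment_ge[OF \<tau>'(1)] um by (simp add: P_def)
  finally have "P / (9 * \<tau>') \<le> lower_moment \<tau>'" by simp
  \<comment> \<open>Three factors 3 make up the 27 below: the bound \<open>exp 1 \<le> 3\<close>,
    the moment comparison, and the mass \<open>3 * P\<close> below \<open>E\<close>.\<close>
  then have "(\<tau> - \<tau>') * (P / (9 * \<tau>')) / (3 * P) \<le> c"
    unfolding c_def \<tau>'(2) P_def[symmetric] using \<tau> P by (intro divide_right_mono mult_left_mono) auto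
  moreover have "(\<tau> - \<tau>') * (P / (9 * \<tau>')) / (3 * P) = (k - 1) / 27"
    using P \<tau>'(1) by (simp add: k_def field_simps)
  ultimately have cl: "(k - 1) / 27 \<le> c" by simp
  \<comment> \<open>From \<open>exp c \<le> 3 * k\<close> and \<open>c \<ge> (k - 1) / 27\<close>.
    The bound is not sharp; beyond 5000 the quadratic Taylor polynomial already exceeds
    \<open>3 * k\<close>.\<close>
  have k5: "k \<le> 5000"
  proof (rule ccontr)
    assume "\<not> k \<le> 5000"
    define x where "x = (k - 1) / 27"
    have x: "185 \<le> x" "k = 27 * x + 1" using \<open>\<not> k \<le> 5000\<close> by (auto simp: x_def field_simps)
    have "1 + x + x^2 / 2 \<le> exp x" using x by (intro exp_lower_Taylor_quadratic) auto
    also have "\<dots> \<le> 3 * k" using cl ck by (simp add: x_def order.trans[OF _ ck])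
    finally have "1 + x + x^2 / 2 \<le> 81 * x + 3" using x by simp
    moreover have "185 * x \<le> x^2" using x by (simp add: power2_eq_square)
    ultimately show False using x by simp
  qed
  \<comment> \<open>One factor 3 comes from the moments and one from the masses \<open>P\<close> and
    \<open>3 * P\<close>; the resulting \<open>9 * c\<close> becomes the ninth power below.\<close>
  have "(\<tau> - \<tau>') * upper_moment \<tau>' / P \<le> (\<tau> - \<tau>') * (3 * lower_moment \<tau>') / P"
    using um \<tau> P by (intro divide_right_mono mult_left_mono) auto
  also have "\<dots> = 9 * c" using P by (simp add: c_def \<tau>'(2) P_def[symmetric])
  finally have "exp (- (9 * c)) * P \<le> exp (- (\<tau> - \<tau>') * upper_moment \<tau>' / P) * P"
    using P by (intro mult_right_mono) (auto simp only: exp_le_cancel_iff mult_minus_left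
        minus_divide_left[symmetric] neg_le_iff_le)
  also have "\<dots> \<le> H {E<..} \<tau>" using tangent_upper[OF \<tau>'(1) \<tau>(1)] by (simp add: P_def)
  finally have "P \<le> exp c ^ 9 * H {E<..} \<tau>"
    by (simp add: exp_of_nat_mult[symmetric] exp_minus field_simps)
  also have "\<dots> \<le> 15000 ^ 9 * H {E<..} \<tau>"
    using ck k5 by (intro mult_right_mono power_mono H_nonneg) auto
  finally have "8 * k * P \<le> 8 * k * (15000 ^ 9 * H {E<..} \<tau>)" using k by simp
  also have "\<dots> \<le> 8 * 5000 * (15000 ^ 9 * H {E<..} \<tau>)"
    using k5 by (intro mult_right_mono) (auto simp: H_nonneg)
  \<comment> \<open>Here \<open>8 * 5000 = 40000\<close> is rounded up to
    \<open>3 * 15000\<close>.\<close>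
  also have "\<dots> \<le> 3 * 15000 ^ 10 * H {E<..} \<tau>" using H_nonneg[of "{E<..}" \<tau>] by simp
  finally show ?thesis using that \<tau>' \<tau> HU by simp
qed

end

section \<open>The product law\<close>

text \<open>For smooth \<open>\<phi>\<close> this is
  \<open>k \<phi>'(v) \<le> k \<phi>'(k v)\<close> integrated from \<open>x\<close> to
  \<open>y\<close>. In terms of chords, \<open>y\<close> and \<open>k * x\<close> lie between
  \<open>x\<close> and \<open>k * y\<close>, with weights linked by
  \<open>k * t = 1 - s\<close>.\<close>

lemma admissible_dilation:
  assumes adm: "admissible_phi \<phi>" and x: "0 \<le> x" "x \<le> y" and k: "1 \<le> k"
  shows "k * (\<phi> y - \<phi> x) \<le> \<phi> (k * y) - \<phi> (k * x)"
proof (cases "x = y")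
  case False
  have y: "x < y" "x \<le> k * x" "y \<le> k * y" using x k False mult_right_mono[of 1 k x] mult_right_mono[of 1 k y] by auto
  define L where "L = k * y - x"
  have L: "0 < L" using y by (simp add: L_def)
  have c: "convex_on {0..} \<phi>" using adm by (auto simp: admissible_phi_def)
  define t s where "t = (y - x) / L" and "s = (k * x - x) / L"
  have tL: "t * L = y - x" and sL: "s * L = k * x - x" using L by (auto simp: t_def s_def)
  have t: "0 \<le> t" "t \<le> 1" and s: "0 \<le> s" "s \<le> 1"
    using L y k x by (auto simp: t_def s_def) (auto simp: L_def mult_left_mono)
  have kt: "k * t = 1 - s" using L by (simp add: t_def s_def field_simps) (simp add: L_def algebra_simps)
  have "(1 - t) * x + t * (k * y) = x + t * L" "(1 - s) * x + s * (k * y) = x + s * L"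
    by (auto simp: L_def algebra_simps)
  then have "(1 - t) * x + t * (k * y) = y" "(1 - s) * x + s * (k * y) = k * x"
    unfolding tL sL by auto
  then have "\<phi> y \<le> (1 - t) * \<phi> x + t * \<phi> (k * y)" "\<phi> (k * x) \<le> (1 - s) * \<phi> x + s * \<phi> (k * y)"
    using convex_onD[OF c, of t x "k * y"] convex_onD[OF c, of s x "k * y"] t s x y by auto
  then have "\<phi> y - \<phi> x \<le> t * (\<phi> (k * y) - \<phi> x)"
    and *: "(1 - s) * (\<phi> (k * y) - \<phi> x) \<le> \<phi> (k * y) - \<phi> (k * x)"
    by (auto simp: algebra_simps)
  from mult_left_mono[OF this(1), of k] have "k * (\<phi> y - \<phi> x) \<le> k * (t * (\<phi> (k * y) - \<phi> x))"
    using k by auto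
  with * show ?thesis by (simp add: kt mult.assoc[symmetric])
qed simp

lemma nn_integral_exp_tail:
  assumes "0 < a" shows "(\<integral>\<^sup>+s. ennreal (a * exp (- a * s)) * indicator {c..} s \<partial>lborel) = ennreal (exp (- a * c))"
proof -
  have "((\<lambda>s. - exp (- a * s)) \<longlongrightarrow> - 0) at_top"
    using assms by (intro tendsto_minus filterlim_compose[OF exp_at_bot]
        filterlim_tendsto_neg_mult_at_bot[OF tendsto_const] filterlim_ident) auto
  then have "(\<integral>\<^sup>+s. ennreal (a * exp (- a * s)) * indicator {c..} s \<partial>lborel) = ennreal (0 - - exp (- a * c))"
    using assms
    by (intro nn_integral_FTC_atLeast[where F = "\<lambda>s. - exp (- a * s)"])
      (auto intro!: derivative_eq_intros)
  then show ?thesis by simp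
qed

lemma integrable_exp_abs:
  assumes "0 < a" shows "integrable lborel (\<lambda>x::real. exp (- a * \<bar>x\<bar>))"
proof (rule integrableI_nonneg)
  have "(\<integral>\<^sup>+x. ennreal (exp (- a * \<bar>x\<bar>)) \<partial>lborel) =
      2 * (\<integral>\<^sup>+x. ennreal (exp (- a * x)) * indicator {0<..} x \<partial>lborel)"
    by (rule nn_integral_abs) measurable
  also have "(\<integral>\<^sup>+x. ennreal (exp (- a * x)) * indicator {0<..} x \<partial>lborel)
      \<le> (\<integral>\<^sup>+x. ennreal (1 / a) * (ennreal (a * exp (- a * x)) * indicator {0..} x) \<partial>lborel)"
    using assms by (intro nn_integral_mono) (auto simp: indicator_def ennreal_mult[symmetric])
  also have "\<dots> = ennreal (1 / a)"
    using assms nn_integral_exp_tail[of a 0] by (subst nn_integral_cmult) auto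
  finally show "(\<integral>\<^sup>+x. ennreal (exp (- a * \<bar>x\<bar>)) \<partial>lborel) < \<infinity>"
    by (simp add: ennreal_mult_less_top mult_left_mono order.strict_trans1)
qed auto

lemma admissible_exp_bound:
  assumes adm: "admissible_phi \<phi>" and "0 \<le> lam" "0 < \<tau>"
  shows "exp (- lam * \<bar>v\<bar> - \<tau> * \<phi> \<bar>v\<bar>) \<le> exp (\<tau> * \<phi> 1) * exp (- (\<tau> * \<phi> 1) * \<bar>v\<bar>)"
proof -
  have "\<tau> * (\<phi> 1 * (\<bar>v\<bar> - 1)) \<le> \<tau> * \<phi> \<bar>v\<bar>"
    using admissible_linear_growth[OF adm, of "\<bar>v\<bar>"] assms by simp
  moreover have "0 \<le> lam * \<bar>v\<bar>" using assms by simp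
  ultimately show ?thesis by (simp add: exp_add[symmetric] algebra_simps)
qed

section \<open>The law of one coordinate of V and its dilations\<close>

definition V_normalizer :: "real \<Rightarrow> real \<Rightarrow> (real \<Rightarrow> real) \<Rightarrow> real" where
  "V_normalizer lam \<tau> \<phi> = (LINT u|lborel. exp (- lam * \<bar>u\<bar> - \<tau> * \<phi> \<bar>u\<bar>))"

definition V_law :: "real \<Rightarrow> real \<Rightarrow> (real \<Rightarrow> real) \<Rightarrow> real measure" where
  "V_law lam \<tau> \<phi> = density lborel (\<lambda>v. ennreal (V_density lam \<tau> \<phi> v))"

lemma V_density_eq:
  "V_density lam \<tau> \<phi> v = exp (- lam * \<bar>v\<bar> - \<tau> * \<phi> \<bar>v\<bar>) / V_normalizer lam \<tau> \<phi>"
  by (simp add: V_density_def V_normalizer_def)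

lemma sets_V_law [simp, measurable_cong]: "sets (V_law lam \<tau> \<phi>) = sets borel"
  by (simp add: V_law_def)

lemma space_V_law [simp]: "space (V_law lam \<tau> \<phi>) = UNIV"
  by (simp add: V_law_def)

locale admissible_coordinate =
  fixes lam \<tau> :: real and \<phi> :: "real \<Rightarrow> real"
  assumes lam: "0 \<le> lam" and tau: "0 < \<tau>" and adm: "admissible_phi \<phi>"
begin

lemma measurable_phi_abs [measurable]: "(\<lambda>x. \<phi> \<bar>x\<bar>) \<in> borel_measurable borel"
  using adm by (rule admissible_measurable_abs)

lemma V_weight_integrable: "integrable lborel (\<lambda>v. exp (- lam * \<bar>v\<bar> - \<tau> * \<phi> \<bar>v\<bar>))"
proof (rule Bochner_Integration.integrable_bound)
  show "integrable lborel (\<lambda>v. exp (\<tau> * \<phi> 1) * exp (- (\<tau> * \<phi> 1) * \<bar>v\<bar>))"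
    using admissible_pos[OF adm, of 1] tau by (intro integrable_mult_right integrable_exp_abs) auto
qed (use admissible_exp_bound[OF adm lam tau] in auto)

lemma V_normalizer_pos: "0 < V_normalizer lam \<tau> \<phi>"
proof -
  have "0 \<noteq> (LINT v|lborel. exp (- lam * \<bar>v\<bar> - \<tau> * \<phi> \<bar>v\<bar>))"
  proof
    assume "0 = (LINT v|lborel. exp (- lam * \<bar>v\<bar> - \<tau> * \<phi> \<bar>v\<bar>))"
    then have "AE v::real in lborel. \<not> True"
      using integral_nonneg_eq_0_iff_AE[OF V_weight_integrable] by simp
    from emeasure_eq_0_AE[OF this] show False by simp
  qed
  moreover have "0 \<le> (LINT v|lborel. exp (- lam * \<bar>v\<bar> - \<tau> * \<phi> \<bar>v\<bar>))"
    by simp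
  ultimately show ?thesis unfolding V_normalizer_def by linarith
qed

lemma measurable_V_density [measurable]: "V_density lam \<tau> \<phi> \<in> borel_measurable borel"
  unfolding V_density_eq[abs_def] by measurable

lemma V_density_nonneg: "0 \<le> V_density lam \<tau> \<phi> v"
  using V_normalizer_pos by (simp add: V_density_eq)

lemma prob_space_V_law: "prob_space (V_law lam \<tau> \<phi>)"
proof (rule prob_spaceI)
  have "emeasure (V_law lam \<tau> \<phi>) UNIV = (\<integral>\<^sup>+v. ennreal (V_density lam \<tau> \<phi> v) \<partial>lborel)"
    unfolding V_law_def by (simp add: emeasure_density)
  also have "\<dots> = ennreal (LINT v|lborel. V_density lam \<tau> \<phi> v)"
    using V_weight_integrable V_density_nonneg
    by (intro nn_integral_eq_integral) (auto simp: V_density_eq)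
  also have "(LINT v|lborel. V_density lam \<tau> \<phi> v) = 1"
    using V_normalizer_pos by (simp add: V_density_eq V_normalizer_def)
  finally show "emeasure (V_law lam \<tau> \<phi>) (space (V_law lam \<tau> \<phi>)) = 1" by simp
qed

text \<open>Over this base measure both \<open>X\<close> and the product law have densities that
  depend on the energy alone.\<close>

lemma V_law_exp_measure:
  "V_law lam \<tau> \<phi> =
    density (exp_measure lam) (\<lambda>v. ennreal (exp (- \<tau> * \<phi> \<bar>v\<bar>) / V_normalizer lam \<tau> \<phi>))"
  unfolding V_law_def exp_measure_def using V_normalizer_pos
  by (subst density_density_eq)
    (auto intro!: density_cong simp: V_density_eq ennreal_mult[symmetric] exp_add[symmetric])

text \<open>The factor \<open>\<bar>v\<bar>\<close> is paid for by half of the exponential rate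
  \<open>a = \<tau> * \<phi> 1\<close>.\<close>

lemma V_law_integrable_abs: "integrable (V_law lam \<tau> \<phi>) (\<lambda>v. v)"
proof -
  define a where "a = \<tau> * \<phi> 1"
  have a: "0 < a" using admissible_pos[OF adm, of 1] tau by (simp add: a_def)
  have "integrable lborel (\<lambda>v. V_density lam \<tau> \<phi> v *\<^sub>R v)"
  proof (rule Bochner_Integration.integrable_bound)
    show "integrable lborel (\<lambda>v. exp a * (2 / a) / V_normalizer lam \<tau> \<phi> * exp (- (a / 2) * \<bar>v\<bar>))"
      using a by (intro integrable_mult_right integrable_exp_abs) auto
    show "AE v in lborel. norm (V_density lam \<tau> \<phi> v *\<^sub>R v)
        \<le> norm (exp a * (2 / a) / V_normalizer lam \<tau> \<phi> * exp (- (a / 2) * \<bar>v\<bar>))"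
    proof (intro always_eventually allI)
      fix v :: real
      have "a / 2 * \<bar>v\<bar> \<le> exp (a / 2 * \<bar>v\<bar>)" using exp_ge_add_one_self[of "a / 2 * \<bar>v\<bar>"] by linarith
      then have v: "\<bar>v\<bar> \<le> 2 / a * exp (a / 2 * \<bar>v\<bar>)" using a by (simp add: field_simps)
      have "exp (- lam * \<bar>v\<bar> - \<tau> * \<phi> \<bar>v\<bar>) * \<bar>v\<bar> \<le> (exp a * exp (- a * \<bar>v\<bar>)) * (2 / a * exp (a / 2 * \<bar>v\<bar>))"
        using admissible_exp_bound[OF adm lam tau, of v] v by (intro mult_mono) (auto simp: a_def)
      also have "\<dots> = exp a * (2 / a) * exp (- (a / 2) * \<bar>v\<bar>)"
        by (simp add: exp_add[symmetric] field_simps)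
      finally have "exp (- lam * \<bar>v\<bar> - \<tau> * \<phi> \<bar>v\<bar>) * \<bar>v\<bar> / V_normalizer lam \<tau> \<phi>
          \<le> exp a * (2 / a) * exp (- (a / 2) * \<bar>v\<bar>) / V_normalizer lam \<tau> \<phi>"
        using V_normalizer_pos by (intro divide_right_mono) auto
      then show "norm (V_density lam \<tau> \<phi> v *\<^sub>R v)
        \<le> norm (exp a * (2 / a) / V_normalizer lam \<tau> \<phi> * exp (- (a / 2) * \<bar>v\<bar>))"
        using V_normalizer_pos a by (simp add: V_density_eq abs_mult)
    qed
  qed simp
  then show ?thesis
    unfolding V_law_def using V_density_nonneg by (subst integrable_density) auto
qed

end

text \<open>Chebyshev's association inequality, proved by integrating over two independent copies.\<close>

lemma (in prob_space) nn_integral_mult_le_of_opposite_monotone: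
  fixes h S :: "'a \<Rightarrow> ennreal" and r :: "'a \<Rightarrow> real"
  assumes [measurable]: "h \<in> borel_measurable M" "S \<in> borel_measurable M"
    and h: "\<And>x y. r x \<le> r y \<Longrightarrow> h x \<le> h y" and S: "\<And>x y. r x \<le> r y \<Longrightarrow> S y \<le> S x"
  shows "(\<integral>\<^sup>+x. h x * S x \<partial>M) \<le> (\<integral>\<^sup>+x. h x \<partial>M) * (\<integral>\<^sup>+x. S x \<partial>M)"
proof -
  have rearrange: "a * b + a' * b' \<le> a * b' + a' * b" if "a \<le> a'" "b' \<le> b" for a a' b b' :: ennreal
  proof -
    from \<open>a \<le> a'\<close> obtain d where d: "a' = a + d" by (auto simp: le_iff_add)
    have "a * b + a' * b' = a * b + a * b' + d * b'" by (simp add: d distrib_right add_ac)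
    also have "\<dots> \<le> a * b + a * b' + d * b" using that by (intro add_left_mono mult_left_mono) auto
    also have "\<dots> = a * b' + a' * b" by (simp add: d distrib_right add_ac)
    finally show ?thesis .
  qed
  have pw: "h x * S x + h y * S y \<le> h x * S y + h y * S x" for x y
    using rearrange[OF h S, of x y x y] rearrange[OF h S, of y x y x]
    by (cases "r x \<le> r y") (auto simp: add.commute)
  have "2 * (\<integral>\<^sup>+x. h x * S x \<partial>M) = (\<integral>\<^sup>+x. \<integral>\<^sup>+y. h x * S x + h y * S y \<partial>M \<partial>M)"
    by (simp add: nn_integral_add emeasure_space_1 mult_2)
  also have "\<dots> \<le> (\<integral>\<^sup>+x. \<integral>\<^sup>+y. h x * S y + h y * S x \<partial>M \<partial>M)"
    by (intro nn_integral_mono pw)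
  also have "\<dots> = 2 * ((\<integral>\<^sup>+x. h x \<partial>M) * (\<integral>\<^sup>+x. S x \<partial>M))"
    by (simp add: nn_integral_add nn_integral_cmult nn_integral_multc mult_2 mult.commute)
  finally show ?thesis
    by (subst (asm) ennreal_mult_le_mult_iff) auto
qed

text \<open>The variable with parameter \<open>\<tau>\<close>, divided by \<open>k\<close>, has
  density \<open>S\<close> with respect to the law with parameter \<open>k * \<tau>\<close>. By
  \<open>admissible_dilation\<close> this density decreases in \<open>\<bar>v\<bar>\<close>, while
  \<open>h\<close> increases, so the association inequality applies and \<open>S\<close> has mean
  1.\<close>

lemma V_law_scaled_domination:
  fixes h :: "real \<Rightarrow> ennreal"
  assumes lam: "0 \<le> lam" and tau: "0 < \<tau>" and k: "1 \<le> k" and adm: "admissible_phi \<phi>"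
    and [measurable]: "h \<in> borel_measurable borel" and h: "\<And>x y. \<bar>x\<bar> \<le> \<bar>y\<bar> \<Longrightarrow> h x \<le> h y"
  shows "(\<integral>\<^sup>+v. h (v / k) \<partial>V_law lam \<tau> \<phi>) \<le> (\<integral>\<^sup>+v. h v \<partial>V_law lam (k * \<tau>) \<phi>)"
proof -
  interpret A: admissible_coordinate lam \<tau> \<phi> using assms by unfold_locales auto
  interpret A': admissible_coordinate lam "k * \<tau>" \<phi> using assms by unfold_locales auto
  interpret V: prob_space "V_law lam \<tau> \<phi>" by (rule A.prob_space_V_law)
  interpret V': prob_space "V_law lam (k * \<tau>) \<phi>" by (rule A'.prob_space_V_law)
  define S where "S v = k * V_density lam \<tau> \<phi> (k * v) / V_density lam (k * \<tau>) \<phi> v" for v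
  have [measurable]: "S \<in> borel_measurable borel" unfolding S_def[abs_def] by measurable
  have pos: "0 < V_density lam (k * \<tau>) \<phi> v" for v
    using A'.V_normalizer_pos by (simp add: V_density_eq)
  have S_dens: "S v * V_density lam (k * \<tau>) \<phi> v = k * V_density lam \<tau> \<phi> (k * v)" for v
    using pos[of v] by (simp add: S_def)
  have S0: "0 \<le> S v" for v
    using k A.V_density_nonneg A'.V_density_nonneg by (simp add: S_def)
  have eq: "(\<integral>\<^sup>+v. g (v / k) \<partial>V_law lam \<tau> \<phi>) = (\<integral>\<^sup>+v. g v * S v \<partial>V_law lam (k * \<tau>) \<phi>)"
    if [measurable]: "g \<in> borel_measurable borel" for g :: "real \<Rightarrow> ennreal"
  proof -
    have "(\<integral>\<^sup>+v. g (v / k) \<partial>V_law lam \<tau> \<phi>) = (\<integral>\<^sup>+v. ennreal (V_density lam \<tau> \<phi> v) * g (v / k) \<partial>lborel)"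
      unfolding V_law_def by (subst nn_integral_density) auto
    also have "\<dots> = ennreal k * (\<integral>\<^sup>+v. ennreal (V_density lam \<tau> \<phi> (k * v)) * g v \<partial>lborel)"
      using k by (subst nn_integral_real_affine[of _ k 0]) auto
    also have "\<dots> = (\<integral>\<^sup>+v. ennreal (k * V_density lam \<tau> \<phi> (k * v)) * g v \<partial>lborel)"
      using k A.V_density_nonneg by (subst nn_integral_cmult[symmetric]) (auto simp: ennreal_mult mult_ac)
    also have "\<dots> = (\<integral>\<^sup>+v. ennreal (V_density lam (k * \<tau>) \<phi> v) * (g v * S v) \<partial>lborel)"
    proof (rule nn_integral_cong)
      fix v
      have "ennreal (k * V_density lam \<tau> \<phi> (k * v)) = ennreal (S v) * ennreal (V_density lam (k * \<tau>) \<phi> v)"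
        using S0 A'.V_density_nonneg by (simp only: S_dens[symmetric] ennreal_mult)
      then show "ennreal (k * V_density lam \<tau> \<phi> (k * v)) * g v =
          ennreal (V_density lam (k * \<tau>) \<phi> v) * (g v * S v)"
        by (simp only: mult_ac)
    qed
    also have "\<dots> = (\<integral>\<^sup>+v. g v * S v \<partial>V_law lam (k * \<tau>) \<phi>)"
      unfolding V_law_def by (subst nn_integral_density) auto
    finally show ?thesis .
  qed
  have total: "(\<integral>\<^sup>+v. S v \<partial>V_law lam (k * \<tau>) \<phi>) = 1"
    using eq[of "\<lambda>_. 1"] V.emeasure_space_1 by simp
  have anti: "S y \<le> S x" if "\<bar>x\<bar> \<le> \<bar>y\<bar>" for x y
  proof -
    define w where "w v = - lam * \<bar>k * v\<bar> - \<tau> * \<phi> \<bar>k * v\<bar> - (- lam * \<bar>v\<bar> - k * \<tau> * \<phi> \<bar>v\<bar>)" for v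
    have S_eq: "S v = k * V_normalizer lam (k * \<tau>) \<phi> / V_normalizer lam \<tau> \<phi> * exp (w v)" for v
      by (simp add: S_def V_density_eq w_def exp_diff mult_ac)
    have "k * (\<phi> \<bar>y\<bar> - \<phi> \<bar>x\<bar>) \<le> \<phi> (k * \<bar>y\<bar>) - \<phi> (k * \<bar>x\<bar>)"
      using that k by (intro admissible_dilation[OF adm]) auto
    then have "\<tau> * (k * (\<phi> \<bar>y\<bar> - \<phi> \<bar>x\<bar>)) \<le> \<tau> * (\<phi> (k * \<bar>y\<bar>) - \<phi> (k * \<bar>x\<bar>))" using tau by simp
    moreover have "lam * ((k - 1) * \<bar>x\<bar>) \<le> lam * ((k - 1) * \<bar>y\<bar>)" using lam k that by (intro mult_left_mono) auto
    ultimately have "w y \<le> w x" using k by (simp add: w_def abs_mult algebra_simps)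
    then show ?thesis
      unfolding S_eq using k A.V_normalizer_pos A'.V_normalizer_pos by (intro mult_left_mono) auto
  qed
  have "(\<integral>\<^sup>+v. h (v / k) \<partial>V_law lam \<tau> \<phi>) = (\<integral>\<^sup>+v. h v * S v \<partial>V_law lam (k * \<tau>) \<phi>)"
    by (rule eq) simp
  also have "\<dots> \<le> (\<integral>\<^sup>+v. h v \<partial>V_law lam (k * \<tau>) \<phi>) * (\<integral>\<^sup>+v. S v \<partial>V_law lam (k * \<tau>) \<phi>)"
    using h anti by (intro V'.nn_integral_mult_le_of_opposite_monotone[where r = abs]) (auto intro: ennreal_leI)
  finally show ?thesis by (simp add: total)
qed

section \<open>Densities and domination on product measures\<close>

lemma PiM_density:
  assumes M: "product_sigma_finite M" and D: "product_sigma_finite (\<lambda>i. density (M i) (g i))"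
    and fin: "finite I" and [measurable]: "\<And>i. g i \<in> borel_measurable (M i)"
  shows "Pi\<^sub>M I (\<lambda>i. density (M i) (g i)) = density (Pi\<^sub>M I M) (\<lambda>x. \<Prod>i\<in>I. g i (x i))"
proof (rule product_sigma_finite.PiM_eqI[OF D fin, symmetric])
  interpret product_sigma_finite M by (rule M)
  fix A assume A: "\<And>i. i \<in> I \<Longrightarrow> A i \<in> sets (density (M i) (g i))"
  then have [measurable]: "\<And>i. i \<in> I \<Longrightarrow> A i \<in> sets (M i)" by simp
  have "emeasure (density (Pi\<^sub>M I M) (\<lambda>x. \<Prod>i\<in>I. g i (x i))) (Pi\<^sub>E I A) =
      (\<integral>\<^sup>+x. (\<Prod>i\<in>I. g i (x i)) * indicator (Pi\<^sub>E I A) x \<partial>Pi\<^sub>M I M)"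
    using fin by (intro emeasure_density sets_PiM_I_finite) measurable
  also have "\<dots> = (\<integral>\<^sup>+x. (\<Prod>i\<in>I. g i (x i) * indicator (A i) (x i)) \<partial>Pi\<^sub>M I M)"
  proof (rule nn_integral_cong)
    fix x assume "x \<in> space (Pi\<^sub>M I M)"
    then have "indicator (Pi\<^sub>E I A) x = (\<Prod>i\<in>I. indicator (A i) (x i) :: ennreal)"
      using fin by (auto simp: indicator_def space_PiM PiE_iff prod_zero_iff intro!: prod.neutral[symmetric])
    then show "(\<Prod>i\<in>I. g i (x i)) * indicator (Pi\<^sub>E I A) x = (\<Prod>i\<in>I. g i (x i) * indicator (A i) (x i))"
      by (simp add: prod.distrib)
  qed
  also have "\<dots> = (\<Prod>i\<in>I. \<integral>\<^sup>+y. g i y * indicator (A i) y \<partial>M i)"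
    using fin by (intro product_nn_integral_prod) measurable
  also have "\<dots> = (\<Prod>i\<in>I. emeasure (density (M i) (g i)) (A i))"
    by (intro prod.cong refl emeasure_density[symmetric]) auto
  finally show "emeasure (density (Pi\<^sub>M I M) (\<lambda>x. \<Prod>i\<in>I. g i (x i))) (Pi\<^sub>E I A) =
      (\<Prod>i\<in>I. emeasure (density (M i) (g i)) (A i))" .
qed (simp add: sets_PiM_cong[of I I "\<lambda>i. density (M i) (g i)" M])

lemma borel_measurable_PiM_borel:
  "(\<And>i. sets (M i) = sets borel) \<Longrightarrow> borel_measurable (Pi\<^sub>M I M) = borel_measurable (Pi\<^sub>M I (\<lambda>_. borel))"
  by (intro measurable_cong_sets sets_PiM_cong) auto

text \<open>One coordinate is integrated last. The induction hypothesis treats the sections of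
  \<open>f\<close>, and \<open>dom\<close> applies to the partial integral because this inherits
  monotonicity in the absolute value.\<close>

lemma PiM_scaled_domination:
  fixes M M' :: "'i \<Rightarrow> real measure" and f :: "('i \<Rightarrow> real) \<Rightarrow> ennreal"
  assumes M: "product_sigma_finite M" and M': "product_sigma_finite M'" and fin: "finite I"
    and S: "\<And>i. sets (M i) = sets borel" "\<And>i. sets (M' i) = sets borel"
    and dom: "\<And>i h. h \<in> borel_measurable borel \<Longrightarrow> (\<And>x y. \<bar>x\<bar> \<le> \<bar>y\<bar> \<Longrightarrow> h x \<le> h y) \<Longrightarrow>
      (\<integral>\<^sup>+x. h (x / k) \<partial>M' i) \<le> (\<integral>\<^sup>+x. h x \<partial>M i :: ennreal)"
    and f: "f \<in> borel_measurable (Pi\<^sub>M I (\<lambda>_. borel))" "abs_mono I f"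
  shows "(\<integral>\<^sup>+x. f (\<lambda>i\<in>I. x i / k) \<partial>Pi\<^sub>M I M') \<le> (\<integral>\<^sup>+x. f x \<partial>Pi\<^sub>M I M)"
  using fin f
proof (induction I arbitrary: f rule: finite_induct)
  case empty
  then show ?case by (simp add: PiM_empty nn_integral_count_space_finite)
next
  case (insert i I)
  interpret M: product_sigma_finite M by (rule M)
  interpret M': product_sigma_finite M' by (rule M')
  interpret MI: sigma_finite_measure "Pi\<^sub>M I M" by (rule M.sigma_finite[OF insert.hyps(1)])
  note [measurable_cong] = S
  note [measurable] = insert.prems(1)
  have "space (M j) = UNIV" "space (M' j) = UNIV" for j
    using sets_eq_imp_space_eq[OF S(1)] sets_eq_imp_space_eq[OF S(2)] by auto
  then have sp: "space (Pi\<^sub>M I M) = I \<rightarrow>\<^sub>E UNIV" "space (Pi\<^sub>M I M') = I \<rightarrow>\<^sub>E UNIV" by (simp_all add: space_PiM)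
  have m: "f \<in> borel_measurable (Pi\<^sub>M (insert i I) M)"
    using insert.prems(1) borel_measurable_PiM_borel[OF S(1)] by auto
  have sec: "(\<lambda>x. f (x(i := y))) \<in> borel_measurable (Pi\<^sub>M I (\<lambda>_. borel))" for y
    using insert.hyps by measurable
  define h where "h y = (\<integral>\<^sup>+x. f (x(i := y)) \<partial>Pi\<^sub>M I M)" for y
  have [measurable]: "h \<in> borel_measurable borel"
  proof -
    have "h \<in> borel_measurable (M i)"
      unfolding h_def[abs_def] using m insert.hyps
      by (intro MI.borel_measurable_nn_integral) measurable
    then show ?thesis using measurable_cong_sets[OF S(1) refl] by auto
  qed
  have h: "h x \<le> h y" if "\<bar>x\<bar> \<le> \<bar>y\<bar>" for x y
    unfolding h_def using that
    by (intro nn_integral_mono abs_monoD[OF insert.prems(2)] fun_upd_PiE_UNIV) (auto simp: sp)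
  have upd: "(\<lambda>j\<in>insert i I. (x(i := y)) j / k) = (\<lambda>j\<in>I. x j / k)(i := y / k)" for x y
    using insert.hyps by (auto simp: fun_eq_iff)
  have "(\<integral>\<^sup>+x. f (\<lambda>j\<in>insert i I. x j / k) \<partial>Pi\<^sub>M (insert i I) M') =
      (\<integral>\<^sup>+y. \<integral>\<^sup>+x. f (\<lambda>j\<in>insert i I. (x(i := y)) j / k) \<partial>Pi\<^sub>M I M' \<partial>M' i)"
  proof (rule M'.product_nn_integral_insert_rev[OF insert.hyps])
    have "(\<lambda>x. \<lambda>j\<in>insert i I. x j / k) \<in> Pi\<^sub>M (insert i I) M' \<rightarrow>\<^sub>M Pi\<^sub>M (insert i I) (\<lambda>_. borel)"
      by (intro measurable_restrict) measurable
    from measurable_compose[OF this insert.prems(1)]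
    show "(\<lambda>x. f (\<lambda>j\<in>insert i I. x j / k)) \<in> borel_measurable (Pi\<^sub>M (insert i I) M')" .
  qed
  also have "\<dots> = (\<integral>\<^sup>+y. \<integral>\<^sup>+x. f ((\<lambda>j\<in>I. x j / k)(i := y / k)) \<partial>Pi\<^sub>M I M' \<partial>M' i)"
    by (simp only: upd)
  also have "\<dots> \<le> (\<integral>\<^sup>+y. h (y / k) \<partial>M' i)"
    unfolding h_def
    by (intro nn_integral_mono insert.IH[where f = "\<lambda>x. f (x(i := _ / k))"] sec abs_mono_section[OF insert.prems(2)])
  also have "\<dots> \<le> (\<integral>\<^sup>+y. h y \<partial>M i)" by (rule dom) (use h in auto)
  also have "\<dots> = (\<integral>\<^sup>+x. f x \<partial>Pi\<^sub>M (insert i I) M)"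
    unfolding h_def by (rule M.product_nn_integral_insert_rev[OF insert.hyps m, symmetric])
  finally show ?case .
qed

section \<open>The product law as a mixture over energy levels\<close>

locale product_gibbs =
  fixes lam :: real and \<phi> :: "'i \<Rightarrow> real \<Rightarrow> real" and I :: "'i set"
  assumes lam: "0 \<le> lam" and fin: "finite I" and adm: "\<And>i. admissible_phi (\<phi> i)"
begin

definition V_product :: "real \<Rightarrow> ('i \<Rightarrow> real) measure" where
  "V_product \<tau> = Pi\<^sub>M I (\<lambda>i. V_law lam \<tau> (\<phi> i))"

abbreviation energy :: "('i \<Rightarrow> real) \<Rightarrow> real" where
  "energy x \<equiv> \<Sum>i\<in>I. \<phi> i \<bar>x i\<bar>"

abbreviation N :: "(('i \<Rightarrow> real) \<Rightarrow> ennreal) \<Rightarrow> real \<Rightarrow> ennreal" where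
  "N \<equiv> level_integral lam \<phi> I"

abbreviation G :: "real \<Rightarrow> ennreal" where
  "G \<equiv> N (\<lambda>_. 1)"

text \<open>Up to the factor \<open>partition_function \<tau>\<close>, the expectation of
  \<open>f(V)\<close> over the event that the mixing level lies in \<open>A\<close>.\<close>

definition L :: "real \<Rightarrow> (('i \<Rightarrow> real) \<Rightarrow> ennreal) \<Rightarrow> real set \<Rightarrow> ennreal" where
  "L \<tau> f A = (\<integral>\<^sup>+s. ennreal (\<tau> * exp (- \<tau> * s)) * N f s * indicator A s \<partial>lborel)"

definition partition_function :: "real \<Rightarrow> real" where
  "partition_function \<tau> = (\<Prod>i\<in>I. V_normalizer lam \<tau> (\<phi> i))"

lemma coordinate: "0 < \<tau> \<Longrightarrow> admissible_coordinate lam \<tau> (\<phi> i)"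
  using lam adm by unfold_locales

lemma product_prob_space_V_law: "0 < \<tau> \<Longrightarrow> product_prob_space (\<lambda>i. V_law lam \<tau> (\<phi> i))"
  using admissible_coordinate.prob_space_V_law[OF coordinate]
  by (intro product_prob_spaceI) auto

lemma product_sigma_finite_V_law: "0 < \<tau> \<Longrightarrow> product_sigma_finite (\<lambda>i. V_law lam \<tau> (\<phi> i))"
  using product_prob_space_V_law unfolding product_prob_space_def by blast

lemma partition_function_pos: "0 < \<tau> \<Longrightarrow> 0 < partition_function \<tau>"
  unfolding partition_function_def
  using admissible_coordinate.V_normalizer_pos[OF coordinate] by (intro prod_pos) auto

lemma measurable_energy' [measurable]: "energy \<in> borel_measurable (exp_product lam I)"
  using adm by (intro measurable_energy)

lemma sets_V_product [simp]: "sets (V_product \<tau>) = sets (Pi\<^sub>M I (\<lambda>_. borel))"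
  unfolding V_product_def by (intro sets_PiM_cong) auto

lemma space_V_product [simp]: "space (V_product \<tau>) = I \<rightarrow>\<^sub>E UNIV"
  by (simp add: V_product_def space_PiM)

lemma prob_space_V_product:
  assumes "0 < \<tau>" shows "prob_space (V_product \<tau>)"
  unfolding V_product_def
  by (intro prob_space_PiM admissible_coordinate.prob_space_V_law[OF coordinate[OF assms]])

lemma sigma_finite_exp_product: "sigma_finite_measure (exp_product lam I)"
  by (rule product_sigma_finite.sigma_finite[OF product_sigma_finite_exp_measure fin])

lemma level_integral_Laplace:
  assumes [measurable]: "f \<in> borel_measurable (exp_product lam I)" and "0 < \<tau>"
  shows "(\<integral>\<^sup>+x. f x * ennreal (exp (- \<tau> * energy x)) \<partial>exp_product lam I) = L \<tau> f UNIV"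
proof -
  interpret sigma_finite_measure "exp_product lam I" by (rule sigma_finite_exp_product)
  interpret P: pair_sigma_finite "exp_product lam I" "lborel :: real measure" ..
  have "(\<integral>\<^sup>+x. f x * ennreal (exp (- \<tau> * energy x)) \<partial>exp_product lam I) =
      (\<integral>\<^sup>+x. \<integral>\<^sup>+s. f x * (ennreal (\<tau> * exp (- \<tau> * s)) * indicator {energy x..} s) \<partial>lborel \<partial>exp_product lam I)"
    using assms
    by (intro nn_integral_cong, subst nn_integral_cmult) (auto simp only: nn_integral_exp_tail, measurable)
  also have "\<dots> = (\<integral>\<^sup>+x. \<integral>\<^sup>+s. ennreal (\<tau> * exp (- \<tau> * s)) * (f x * indicator {x. energy x \<le> s} x) \<partial>lborel \<partial>exp_product lam I)"
    by (intro nn_integral_cong) (auto simp: indicator_def mult.commute)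
  also have "\<dots> = (\<integral>\<^sup>+s. \<integral>\<^sup>+x. ennreal (\<tau> * exp (- \<tau> * s)) * (f x * indicator {x. energy x \<le> s} x) \<partial>exp_product lam I \<partial>lborel)"
    by (rule P.Fubini'[symmetric]) measurable
  also have "\<dots> = L \<tau> f UNIV"
    unfolding L_def level_integral_def by (intro nn_integral_cong) (simp add: nn_integral_cmult)
  finally show ?thesis .
qed

lemma V_product_density:
  assumes tau: "0 < \<tau>"
  shows "V_product \<tau> = density (exp_product lam I)
    (\<lambda>x. ennreal (exp (- \<tau> * energy x) / partition_function \<tau>))"
proof -
  interpret A: admissible_coordinate lam \<tau> "\<phi> i" for i using tau by (rule coordinate)
  have "V_product \<tau> = Pi\<^sub>M I (\<lambda>i. density (exp_measure lam)
      (\<lambda>v. ennreal (exp (- \<tau> * \<phi> i \<bar>v\<bar>) / V_normalizer lam \<tau> (\<phi> i))))"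
    unfolding V_product_def by (simp add: A.V_law_exp_measure)
  also have "\<dots> = density (exp_product lam I)
      (\<lambda>x. \<Prod>i\<in>I. ennreal (exp (- \<tau> * \<phi> i \<bar>x i\<bar>) / V_normalizer lam \<tau> (\<phi> i)))"
    using product_sigma_finite_V_law[OF tau] fin
    by (intro PiM_density product_sigma_finite_exp_measure) (auto simp: A.V_law_exp_measure)
  also have "(\<lambda>x. \<Prod>i\<in>I. ennreal (exp (- \<tau> * \<phi> i \<bar>x i\<bar>) / V_normalizer lam \<tau> (\<phi> i))) =
      (\<lambda>x. ennreal (exp (- \<tau> * energy x) / partition_function \<tau>))"
    using fin A.V_normalizer_pos
    by (auto simp: fun_eq_iff prod_ennreal less_imp_le partition_function_def prod_dividef
        exp_sum sum_distrib_left)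
  finally show ?thesis .
qed

lemma L_eq_expectation:
  assumes f: "f \<in> borel_measurable (exp_product lam I)" and tau: "0 < \<tau>"
  shows "L \<tau> f UNIV = ennreal (partition_function \<tau>) * (\<integral>\<^sup>+x. f x \<partial>V_product \<tau>)"
proof -
  note [measurable] = f
  have "ennreal (partition_function \<tau>) * (\<integral>\<^sup>+x. f x \<partial>V_product \<tau>) =
      ennreal (partition_function \<tau>) *
      (\<integral>\<^sup>+x. ennreal (exp (- \<tau> * energy x) / partition_function \<tau>) * f x \<partial>exp_product lam I)"
    unfolding V_product_density[OF tau] by (subst nn_integral_density) auto
  also have "\<dots> = (\<integral>\<^sup>+x. ennreal (partition_function \<tau>) * (ennreal (exp (- \<tau> * energy x) / partition_function \<tau>) * f x) \<partial>exp_product lam I)"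
    by (rule nn_integral_cmult[symmetric]) measurable
  also have "\<dots> = (\<integral>\<^sup>+x. f x * ennreal (exp (- \<tau> * energy x)) \<partial>exp_product lam I)"
  proof (rule nn_integral_cong)
    fix x
    have "ennreal (partition_function \<tau>) * ennreal (exp (- \<tau> * energy x) / partition_function \<tau>) =
        ennreal (exp (- \<tau> * energy x))"
      using partition_function_pos[OF tau] by (subst ennreal_mult[symmetric]) auto
    then show "ennreal (partition_function \<tau>) * (ennreal (exp (- \<tau> * energy x) / partition_function \<tau>) * f x) =
        f x * ennreal (exp (- \<tau> * energy x))"
      by (metis mult.assoc mult.commute)
  qed
  finally show ?thesis using level_integral_Laplace[OF f tau] by simp
qed

text \<open>Homogeneity writes \<open>q x\<close> as \<open>k * q (x / k)\<close>, and the dilated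
  vector is dominated by the one with parameter \<open>k * \<tau>\<close>.\<close>

lemma V_product_scaling:
  assumes q: "q \<in> borel_measurable (Pi\<^sub>M I (\<lambda>_. borel))" "abs_mono I q"
    and hom: "\<And>x k. x \<in> I \<rightarrow>\<^sub>E UNIV \<Longrightarrow> 0 < k \<Longrightarrow> q (\<lambda>i\<in>I. x i / k) = q x / ennreal k"
    and tau: "0 < \<tau>" "1 \<le> k"
  shows "(\<integral>\<^sup>+x. q x \<partial>V_product \<tau>) \<le> ennreal k * (\<integral>\<^sup>+x. q x \<partial>V_product (k * \<tau>))"
proof -
  have [measurable]: "q \<in> borel_measurable (V_product \<tau>)"
    using q(1) by (simp add: measurable_cong_sets[OF sets_V_product refl])
  have "(\<integral>\<^sup>+x. q x \<partial>V_product \<tau>) = (\<integral>\<^sup>+x. ennreal k * q (\<lambda>i\<in>I. x i / k) \<partial>V_product \<tau>)"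
    using tau by (intro nn_integral_cong) (simp add: hom ennreal_times_divide mult.commute[of "ennreal k"] ennreal_mult_divide_eq)
  also have "\<dots> = ennreal k * (\<integral>\<^sup>+x. q (\<lambda>i\<in>I. x i / k) \<partial>V_product \<tau>)"
  proof (rule nn_integral_cmult)
    have "(\<lambda>x. \<lambda>i\<in>I. x i / k) \<in> V_product \<tau> \<rightarrow>\<^sub>M Pi\<^sub>M I (\<lambda>_. borel)"
      unfolding V_product_def by (intro measurable_restrict) measurable
    from measurable_compose[OF this q(1)]
    show "(\<lambda>x. q (\<lambda>i\<in>I. x i / k)) \<in> borel_measurable (V_product \<tau>)" .
  qed
  also have "\<dots> \<le> ennreal k * (\<integral>\<^sup>+x. q x \<partial>V_product (k * \<tau>))"
    unfolding V_product_def using tau lam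
    by (intro mult_left_mono PiM_scaled_domination product_sigma_finite_V_law V_law_scaled_domination fin q adm) auto
  finally show ?thesis .
qed

end

context product_gibbs
begin

lemma G_log_concave_profile: "log_concave_profile G"
  using level_volume_log_concave_and_integral_ratio_mono[where \<phi> = \<phi>, OF lam fin adm] by blast

lemma N_ratio_mono:
  assumes "f \<in> borel_measurable (exp_product lam I)" "abs_mono I f" "s \<le> s'"
  shows "N f s * G s' \<le> N f s' * G s"
  using level_volume_log_concave_and_integral_ratio_mono[where \<phi> = \<phi>, OF lam fin adm] assms by blast

lemma G_finite: "G s < \<top>"
  using G_log_concave_profile by (auto simp: log_concave_profile_def)

lemma G_pos: "0 < s \<Longrightarrow> 0 < G s"
  using G_log_concave_profile by (auto simp: log_concave_profile_def)

definition g :: "real \<Rightarrow> real" where "g s = enn2real (G s)"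

lemma ennreal_g [simp]: "ennreal (g s) = G s"
  using G_finite by (simp add: g_def)

lemma g_nonneg: "0 \<le> g s"
  by (simp add: g_def)

lemma L_eq_expectation_1: "0 < \<tau> \<Longrightarrow> L \<tau> (\<lambda>_. 1) UNIV = ennreal (partition_function \<tau>)"
  using prob_space.emeasure_space_1[OF prob_space_V_product, of \<tau>] by (subst L_eq_expectation) auto

lemma measurable_N [measurable]:
  assumes [measurable]: "f \<in> borel_measurable (exp_product lam I)"
  shows "N f \<in> borel_measurable borel"
proof -
  interpret sigma_finite_measure "exp_product lam I" by (rule sigma_finite_exp_product)
  show ?thesis
    unfolding level_integral_def[abs_def] by (intro borel_measurable_nn_integral) measurable
qed

text \<open>The integrability condition is finiteness of the partition function, read through its
  Laplace representation.\<close>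

lemma laplace_profile_g:
  assumes "0 < E" shows "laplace_profile g E"
proof
  show "0 < E" by fact
  note lc = G_log_concave_profile[unfolded log_concave_profile_def]
  show "g s \<le> g t" if "s \<le> t" for s t
    unfolding g_def using lc that G_finite by (intro enn2real_mono) (auto dest: monoD)
  show "g s = 0" if "s < 0" for s
    unfolding g_def using lc that by simp
  show "0 < g s" if "0 < s" for s
    unfolding g_def using G_pos[OF that] G_finite by (simp add: enn2real_positive_iff)
  show "g (b + h) * g a \<le> g b * g (a + h)" if "a \<le> b" "0 \<le> h" for a b h
  proof -
    have "G (b + h) * G a \<le> G b * G (a + h)" using lc that by auto
    then have "ennreal (g (b + h) * g a) \<le> ennreal (g b * g (a + h))"
      by (simp add: ennreal_mult g_nonneg)
    then show ?thesis using g_nonneg by (simp add: ennreal_le_iff)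
  qed
  show "integrable lborel (\<lambda>s. exp (- \<tau> * s) * g s)" if \<tau>: "0 < \<tau>" for \<tau>
  proof (rule integrableI_nonneg)
    show [measurable]: "(\<lambda>s. exp (- \<tau> * s) * g s) \<in> borel_measurable lborel"
      unfolding g_def by measurable
    have "ennreal \<tau> * (\<integral>\<^sup>+s. ennreal (exp (- \<tau> * s) * g s) \<partial>lborel) =
        (\<integral>\<^sup>+s. ennreal \<tau> * ennreal (exp (- \<tau> * s) * g s) \<partial>lborel)"
      by (rule nn_integral_cmult[symmetric]) measurable
    also have "\<dots> = L \<tau> (\<lambda>_. 1) UNIV"
      unfolding L_def using \<tau> by (intro nn_integral_cong) (simp add: ennreal_mult g_nonneg mult.assoc)
    also have "\<dots> < \<top>" by (simp add: L_eq_expectation_1[OF \<tau>])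
    finally show "(\<integral>\<^sup>+s. ennreal (exp (- \<tau> * s) * g s) \<partial>lborel) < \<infinity>"
      using \<tau> by (auto simp: ennreal_mult_less_top)
  qed (simp add: g_nonneg)
qed

text \<open>Both bounds integrate the monotonicity of the ratio \<open>N f s / G s\<close> over
  levels: those above \<open>E\<close> for the first, those up to \<open>E\<close> for the second.
  In the second, finiteness of the expectation permits cancelling half of it.\<close>

proposition equivalence_parameter:
  assumes E: "0 < E"
  obtains \<tau> where "0 < \<tau>"
    "\<And>f. f \<in> borel_measurable (exp_product lam I) \<Longrightarrow> abs_mono I f \<Longrightarrow>
      N f E \<le> ennreal (3 * 15000 ^ 10) * (G E * (\<integral>\<^sup>+x. f x \<partial>V_product \<tau>))"
    "\<And>q. q \<in> borel_measurable (exp_product lam I) \<Longrightarrow> abs_mono I q \<Longrightarrow>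
      (\<And>x k. x \<in> I \<rightarrow>\<^sub>E UNIV \<Longrightarrow> 0 < k \<Longrightarrow> q (\<lambda>i\<in>I. x i / k) = q x / ennreal k) \<Longrightarrow>
      (\<integral>\<^sup>+x. q x \<partial>V_product \<tau>) < \<top> \<Longrightarrow> G E * (\<integral>\<^sup>+x. q x \<partial>V_product \<tau>) \<le> 2 * N q E"
proof -
  interpret P: laplace_profile g E by (rule laplace_profile_g[OF E])
  define C :: real where "C = 3 * 15000 ^ 10"
  have C: "0 \<le> C" by (simp add: C_def)
  obtain \<tau>' \<tau> where \<tau>: "0 < \<tau>'" "\<tau>' < \<tau>" "P.H UNIV \<tau> / \<tau> = 2 * (P.H UNIV \<tau>' / \<tau>')"
    "P.H UNIV \<tau> \<le> C * P.H {E<..} \<tau>"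
    unfolding C_def by (rule P.parameters)
  have tau: "0 < \<tau>" using \<tau> by simp
  \<comment> \<open>The factor \<open>exp (- t * E)\<close> undoes the recentring at
    \<open>E\<close> in \<open>P.f\<close>.\<close>
  have LH: "L t (\<lambda>_. 1) A = ennreal (t * exp (- t * E) * P.H A t)"
    if t: "0 < t" and [measurable]: "A \<in> sets borel" for t A
  proof -
    have "L t (\<lambda>_. 1) A = (\<integral>\<^sup>+s. ennreal (t * exp (- t * E) * (indicator A s * P.f t s)) \<partial>lborel)"
      unfolding L_def
    proof (rule nn_integral_cong)
      fix s
      have eq1: "t * exp (- t * E) * P.f t s = t * exp (- t * s) * g s"
        by (simp add: P.f_def exp_add[symmetric] algebra_simps)
      have eq2: "ennreal (t * exp (- t * s)) * G s = ennreal (t * exp (- t * s) * g s)"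
        using t g_nonneg[of s] by (subst ennreal_mult) auto
      show "ennreal (t * exp (- t * s)) * G s * indicator A s =
          ennreal (t * exp (- t * E) * (indicator A s * P.f t s))"
      proof (cases "s \<in> A")
        case True
        then show ?thesis by (simp only: indicator_simps mult_1_left mult_1_right eq1 eq2)
      qed simp
    qed
    also have "\<dots> = ennreal (LINT s|lborel. t * exp (- t * E) * (indicator A s * P.f t s))"
    proof (rule nn_integral_eq_integral)
      show "integrable lborel (\<lambda>s. t * exp (- t * E) * (indicator A s * P.f t s))"
        using P.f_set_integrable[OF t, of A]
        by (intro integrable_mult_right) (simp add: set_integrable_def)
    qed (use t P.f_nonneg in \<open>auto intro!: mult_nonneg_nonneg\<close>)
    finally show ?thesis by (simp add: P.H_def set_lebesgue_integral_def)
  qed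
  have Z: "partition_function t = t * exp (- t * E) * P.H UNIV t" if t: "0 < t" for t
  proof -
    have "ennreal (partition_function t) = ennreal (t * exp (- t * E) * P.H UNIV t)"
      using L_eq_expectation_1[OF t] LH[OF t, of UNIV] by simp
    then show ?thesis
      using partition_function_pos[OF t] P.H_nonneg t by (simp add: ennreal_inj)
  qed
  note Zpos = partition_function_pos[OF tau]
  have cancel: "a \<le> b" if "ennreal (partition_function \<tau>) * a \<le> ennreal (partition_function \<tau>) * b" for a b
    using that Zpos by (simp add: ennreal_mult_le_mult_iff)
  show thesis
  proof (rule that[OF tau])
    fix f :: "('i \<Rightarrow> real) \<Rightarrow> ennreal"
    assume f [measurable]: "f \<in> borel_measurable (exp_product lam I)" and mono: "abs_mono I f"
    \<comment> \<open>This says that the mixing level exceeds \<open>E\<close> with probability at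
      least \<open>1 / C\<close>.\<close>
    have "partition_function \<tau> \<le> C * (\<tau> * exp (- \<tau> * E) * P.H {E<..} \<tau>)"
      using mult_left_mono[OF \<tau>(4), of "\<tau> * exp (- \<tau> * E)"] tau by (simp add: Z[OF tau] mult_ac)
    then have "ennreal (partition_function \<tau>) \<le> ennreal (C * (\<tau> * exp (- \<tau> * E) * P.H {E<..} \<tau>))"
      by (rule ennreal_leI)
    also have "\<dots> = ennreal C * L \<tau> (\<lambda>_. 1) {E<..}"
      using C tau P.H_nonneg by (simp only: LH[OF tau] borel_open open_greaterThan)
        (intro ennreal_mult mult_nonneg_nonneg, auto)
    finally have Z_le: "ennreal (partition_function \<tau>) \<le> ennreal C * L \<tau> (\<lambda>_. 1) {E<..}" .
    have "N f E * L \<tau> (\<lambda>_. 1) {E<..} = (\<integral>\<^sup>+s. N f E * (ennreal (\<tau> * exp (- \<tau> * s)) * G s * indicator {E<..} s) \<partial>lborel)"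
      unfolding L_def by (rule nn_integral_cmult[symmetric]) measurable
    also have "\<dots> \<le> (\<integral>\<^sup>+s. G E * (ennreal (\<tau> * exp (- \<tau> * s)) * N f s * indicator UNIV s) \<partial>lborel)"
    proof (rule nn_integral_mono)
      fix s
      show "N f E * (ennreal (\<tau> * exp (- \<tau> * s)) * G s * indicator {E<..} s)
          \<le> G E * (ennreal (\<tau> * exp (- \<tau> * s)) * N f s * indicator UNIV s)"
      proof (cases "E < s")
        case True
        then have "ennreal (\<tau> * exp (- \<tau> * s)) * (N f E * G s) \<le> ennreal (\<tau> * exp (- \<tau> * s)) * (N f s * G E)"
          by (intro mult_left_mono N_ratio_mono[OF f mono]) auto
        then show ?thesis using True by (simp add: mult_ac)
      qed simp
    qed
    also have "\<dots> = G E * L \<tau> f UNIV"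
      unfolding L_def by (rule nn_integral_cmult) measurable
    also have "\<dots> = ennreal (partition_function \<tau>) * (G E * (\<integral>\<^sup>+x. f x \<partial>V_product \<tau>))"
      by (simp add: L_eq_expectation[OF f tau] mult_ac)
    finally have "ennreal C * (N f E * L \<tau> (\<lambda>_. 1) {E<..})
        \<le> ennreal C * (ennreal (partition_function \<tau>) * (G E * (\<integral>\<^sup>+x. f x \<partial>V_product \<tau>)))"
      by (rule mult_left_mono) simp
    moreover have "ennreal (partition_function \<tau>) * N f E \<le> ennreal C * (N f E * L \<tau> (\<lambda>_. 1) {E<..})"
      using mult_right_mono[OF Z_le, of "N f E"] by (simp add: mult_ac)
    ultimately have "ennreal (partition_function \<tau>) * N f E
        \<le> ennreal (partition_function \<tau>) * (ennreal C * (G E * (\<integral>\<^sup>+x. f x \<partial>V_product \<tau>)))"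
      by (simp add: mult.left_commute order.trans)
    then show "N f E \<le> ennreal (3 * 15000 ^ 10) * (G E * (\<integral>\<^sup>+x. f x \<partial>V_product \<tau>))"
      unfolding C_def by (rule cancel)
  next
    fix q :: "('i \<Rightarrow> real) \<Rightarrow> ennreal"
    assume q [measurable]: "q \<in> borel_measurable (exp_product lam I)" and mono: "abs_mono I q"
      and hom: "\<And>x k. x \<in> I \<rightarrow>\<^sub>E UNIV \<Longrightarrow> 0 < k \<Longrightarrow> q (\<lambda>i\<in>I. x i / k) = q x / ennreal k"
      and finite: "(\<integral>\<^sup>+x. q x \<partial>V_product \<tau>) < \<top>"
    define k where "k = \<tau> / \<tau>'"
    define W W' where "W = partition_function \<tau>" and "W' = partition_function \<tau>'"
    define Q where "Q = (\<integral>\<^sup>+x. q x \<partial>V_product \<tau>)"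
    have k: "1 < k" "\<tau> = k * \<tau>'" using \<tau> by (auto simp: k_def)
    have W: "0 < W" "0 < W'" using \<tau> tau partition_function_pos by (auto simp: W_def W'_def)
    have qb: "q \<in> borel_measurable (Pi\<^sub>M I (\<lambda>_. borel))"
      using q borel_measurable_PiM_borel[of "\<lambda>_. exp_measure lam" I] by auto
    have scale: "(\<integral>\<^sup>+x. q x \<partial>V_product \<tau>') \<le> ennreal k * Q"
      using V_product_scaling[OF qb mono hom \<tau>(1), of k] k by (simp add: Q_def)
    \<comment> \<open>The ratio of the level weights for \<open>\<tau>\<close> and
      \<open>\<tau>'\<close> decreases in \<open>s\<close>; \<open>c\<close> is its value at
      \<open>E\<close>, hence a bound on the levels above \<open>E\<close>.\<close>
    define c where "c = k * exp (- (\<tau> - \<tau>') * E)"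
    have c: "0 < c" using k by (simp add: c_def)
    have split: "L \<tau> q {..E} + L \<tau> q {E<..} = L \<tau> q UNIV"
      unfolding L_def by (subst nn_integral_add[symmetric]) (auto intro!: nn_integral_cong simp: indicator_def)
    have "L \<tau> q {E<..} \<le> (\<integral>\<^sup>+s. ennreal c * (ennreal (\<tau>' * exp (- \<tau>' * s)) * N q s * indicator UNIV s) \<partial>lborel)"
      unfolding L_def
    proof (rule nn_integral_mono)
      fix s
      show "ennreal (\<tau> * exp (- \<tau> * s)) * N q s * indicator {E<..} s
          \<le> ennreal c * (ennreal (\<tau>' * exp (- \<tau>' * s)) * N q s * indicator UNIV s)"
      proof (cases "E < s")
        case True
        have "exp (- \<tau> * s) = exp (- (\<tau> - \<tau>') * s) * exp (- \<tau>' * s)"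
          by (simp add: exp_add[symmetric] algebra_simps)
        also have "\<dots> \<le> exp (- (\<tau> - \<tau>') * E) * exp (- \<tau>' * s)"
          using True \<tau> by (intro mult_right_mono) auto
        finally have "\<tau> * exp (- \<tau> * s) \<le> \<tau> * (exp (- (\<tau> - \<tau>') * E) * exp (- \<tau>' * s))"
          using tau by simp
        also have "\<dots> = c * (\<tau>' * exp (- \<tau>' * s))"
          unfolding c_def by (subst k(2)) (simp only: mult_ac)
        finally have "ennreal (\<tau> * exp (- \<tau> * s)) \<le> ennreal c * ennreal (\<tau>' * exp (- \<tau>' * s))"
          using c \<tau> by (simp add: ennreal_mult[symmetric] ennreal_leI)
        from mult_right_mono[OF this, of "N q s"] True show ?thesis by (simp add: mult.assoc)
      qed simp
    qed
    also have "\<dots> = ennreal c * L \<tau>' q UNIV"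
      unfolding L_def by (rule nn_integral_cmult) measurable
    also have "\<dots> \<le> ennreal c * (ennreal W' * (ennreal k * Q))"
      unfolding L_eq_expectation[OF q \<tau>(1)] W'_def by (intro mult_left_mono scale) auto
    also have "\<dots> = ennreal (c * W' * k) * Q"
      using c W k by (simp add: ennreal_mult mult_ac)
    \<comment> \<open>The exponentials cancel, and \<open>c * W' * k / W\<close> becomes the
      quotient of \<open>P.H UNIV \<tau>' / \<tau>'\<close> by
      \<open>P.H UNIV \<tau> / \<tau>\<close>, which the choice of \<open>\<tau>\<close> makes
      1/2.\<close>
    also have "c * W' * k = W / 2"
    proof -
      have "P.H UNIV \<tau> = 2 * k * P.H UNIV \<tau>'" using \<tau> tau by (simp add: k_def field_simps)
      then have "W = (k * \<tau>') * (exp (- (\<tau> - \<tau>') * E) * exp (- \<tau>' * E)) * (2 * k * P.H UNIV \<tau>')"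
        unfolding W_def Z[OF tau] using k(2) by (simp add: exp_add[symmetric] algebra_simps)
      then show ?thesis unfolding W'_def Z[OF \<tau>(1)] c_def by (simp add: mult_ac)
    qed
    finally have upper: "L \<tau> q {E<..} \<le> ennreal (W / 2) * Q" .
    have WQ: "L \<tau> q UNIV = ennreal W * Q"
      unfolding W_def Q_def by (rule L_eq_expectation[OF q tau])
    define R where "R = ennreal (W / 2) * Q"
    have R: "R < \<top>" using finite by (simp add: R_def Q_def ennreal_mult_less_top)
    have "ennreal W = ennreal (W / 2) + ennreal (W / 2)"
      using W by (subst ennreal_plus[symmetric]) auto
    then have half: "ennreal W * Q = R + R" by (simp only: R_def distrib_right)
    have "R + R = L \<tau> q {E<..} + L \<tau> q {..E}"
      unfolding half[symmetric] WQ[symmetric] split[symmetric] by (rule add.commute)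
    also have "\<dots> \<le> R + L \<tau> q {..E}"
      unfolding R_def by (rule add_right_mono[OF upper])
    finally have "R \<le> L \<tau> q {..E}"
      using R by (simp only: ennreal_add_left_cancel_le) auto
    then have "ennreal W * Q \<le> 2 * L \<tau> q {..E}"
      unfolding half mult_2 by (intro add_mono)
    then have half_le: "ennreal W * (G E * Q) \<le> 2 * (G E * L \<tau> q {..E})"
      using mult_left_mono[of "ennreal W * Q" "2 * L \<tau> q {..E}" "G E"] by (simp add: mult.left_commute)
    have "G E * L \<tau> q {..E} = (\<integral>\<^sup>+s. G E * (ennreal (\<tau> * exp (- \<tau> * s)) * N q s * indicator {..E} s) \<partial>lborel)"
      unfolding L_def by (rule nn_integral_cmult[symmetric]) measurable
    also have "\<dots> \<le> (\<integral>\<^sup>+s. N q E * (ennreal (\<tau> * exp (- \<tau> * s)) * G s * indicator UNIV s) \<partial>lborel)"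
    proof (rule nn_integral_mono)
      fix s
      show "G E * (ennreal (\<tau> * exp (- \<tau> * s)) * N q s * indicator {..E} s)
          \<le> N q E * (ennreal (\<tau> * exp (- \<tau> * s)) * G s * indicator UNIV s)"
      proof (cases "s \<le> E")
        case True
        then have "ennreal (\<tau> * exp (- \<tau> * s)) * (N q s * G E) \<le> ennreal (\<tau> * exp (- \<tau> * s)) * (N q E * G s)"
          by (intro mult_left_mono N_ratio_mono[OF q mono]) auto
        then show ?thesis using True by (simp add: mult_ac)
      qed simp
    qed
    also have "\<dots> = N q E * L \<tau> (\<lambda>_. 1) UNIV"
      unfolding L_def by (rule nn_integral_cmult) measurable
    finally have "2 * (G E * L \<tau> q {..E}) \<le> 2 * (N q E * L \<tau> (\<lambda>_. 1) UNIV)"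
      by (rule mult_left_mono) simp
    also have "\<dots> = ennreal W * (2 * N q E)"
      by (simp add: L_eq_expectation_1[OF tau] W_def mult_ac)
    finally have "ennreal W * (G E * Q) \<le> ennreal W * (2 * N q E)"
      using half_le by (rule order.trans[rotated])
    then show "G E * (\<integral>\<^sup>+x. q x \<partial>V_product \<tau>) \<le> 2 * N q E"
      unfolding W_def Q_def by (rule cancel)
  qed
qed

end

section \<open>Convex functions and sign changes\<close>

text \<open>Rounding one coordinate down to a grid leaves countably many sections, each measurable
  by induction; continuity in that coordinate recovers \<open>f\<close> as the grid is refined. For
  convex functions, the sections along coordinate lines give the hypothesis at once.\<close>

lemma measurable_separately_continuous:
  fixes f :: "('i \<Rightarrow> real) \<Rightarrow> real"
  assumes "finite I"
    and "\<And>x i. x \<in> I \<rightarrow>\<^sub>E UNIV \<Longrightarrow> i \<in> I \<Longrightarrow> continuous_on UNIV (\<lambda>t. f (x(i := t)))"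
  shows "f \<in> borel_measurable (Pi\<^sub>M I (\<lambda>_. borel))"
  using assms
proof (induction I arbitrary: f rule: finite_induct)
  case empty
  then show ?case by (simp add: PiM_empty)
next
  case (insert i I)
  let ?M = "Pi\<^sub>M (insert i I) (\<lambda>_. borel :: real measure)"
  have sec [measurable]: "(\<lambda>x. f (x(i := y))) \<in> borel_measurable (Pi\<^sub>M I (\<lambda>_. borel))" for y
  proof (rule insert.IH)
    fix x :: "'i \<Rightarrow> real" and j assume x: "x \<in> I \<rightarrow>\<^sub>E UNIV" "j \<in> I"
    then have "i \<noteq> j" using insert.hyps by auto
    then have eq: "(\<lambda>t. f ((x(j := t))(i := y))) = (\<lambda>t. f ((x(i := y))(j := t)))"
      by (simp add: fun_upd_twist)
    show "continuous_on UNIV (\<lambda>t. f ((x(j := t))(i := y)))"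
      unfolding eq using x by (intro insert.prems fun_upd_PiE_UNIV) auto
  qed
  define r :: "nat \<Rightarrow> real \<Rightarrow> real" where "r n y = real_of_int \<lfloor>real (Suc n) * y\<rfloor> / real (Suc n)" for n y
  have r: "(\<lambda>n. r n y) \<longlonglongrightarrow> y" for y
  proof (rule LIMSEQ_I)
    fix e :: real assume "0 < e"
    then obtain m where m: "inverse (real (Suc m)) < e" using reals_Archimedean by blast
    have "norm (r n y - y) < e" if "m \<le> n" for n
    proof -
      have "\<bar>real_of_int \<lfloor>real (Suc n) * y\<rfloor> - real (Suc n) * y\<bar> \<le> 1" by linarith
      then have "\<bar>real_of_int \<lfloor>real (Suc n) * y\<rfloor> - real (Suc n) * y\<bar> / real (Suc n) \<le> 1 / real (Suc n)"
        by (intro divide_right_mono) auto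
      moreover have "r n y - y = (real_of_int \<lfloor>real (Suc n) * y\<rfloor> - real (Suc n) * y) / real (Suc n)"
        by (simp add: r_def diff_divide_distrib)
      ultimately have "norm (r n y - y) \<le> 1 / real (Suc n)" by (simp add: abs_divide)
      also have "\<dots> \<le> inverse (real (Suc m))" using that by (simp add: field_simps)
      finally show ?thesis using m by simp
    qed
    then show "\<exists>no. \<forall>n\<ge>no. norm (r n y - y) < e" by blast
  qed
  show ?case
  proof (rule borel_measurable_LIMSEQ_real)
    fix x assume "x \<in> space ?M"
    then have x: "x \<in> insert i I \<rightarrow>\<^sub>E UNIV" by (simp add: space_PiM)
    then have eq: "(restrict x I)(i := y) = x(i := y)" for y
      using insert.hyps by (auto simp: fun_eq_iff PiE_def extensional_def)
    have "continuous_on UNIV (\<lambda>t. f (x(i := t)))"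
      by (intro insert.prems x) simp
    then have "isCont (\<lambda>t. f (x(i := t))) (x i)"
      using continuous_on_eq_continuous_at[OF open_UNIV] by blast
    from isCont_tendsto_compose[OF this r]
    show "(\<lambda>n. f ((restrict x I)(i := r n (x i)))) \<longlonglongrightarrow> f x" by (simp add: eq)
  next
    fix n
    have [measurable]: "(\<lambda>x. restrict x I) \<in> ?M \<rightarrow>\<^sub>M Pi\<^sub>M I (\<lambda>_. borel)"
      by (rule measurable_restrict_subset) auto
    have "(\<lambda>x. f ((restrict x I)(i := real_of_int k / real (Suc n)))) \<in> borel_measurable ?M" for k :: int
      by (rule measurable_compose[OF _ sec]) measurable
    then show "(\<lambda>x. f ((restrict x I)(i := r n (x i)))) \<in> borel_measurable ?M"
      unfolding r_def by (rule measurable_compose_countable) measurable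
  qed
qed

lemma Rvec_upd: "x \<in> Rvec d \<Longrightarrow> i < d \<Longrightarrow> x(i := y) \<in> Rvec d"
  by (auto simp: Rvec_def PiE_def extensional_def)

lemma vscale_Rvec [simp]: "vscale d a x \<in> Rvec d"
  by (simp add: vscale_def Rvec_def)

lemma vadd_Rvec [simp]: "vadd d x y \<in> Rvec d"
  by (simp add: vadd_def Rvec_def)

lemma Rvec_eqI: "x \<in> Rvec d \<Longrightarrow> y \<in> Rvec d \<Longrightarrow> (\<And>i. i < d \<Longrightarrow> x i = y i) \<Longrightarrow> x = y"
  unfolding Rvec_def by (rule PiE_ext) auto

lemma convex_funD:
  "convex_fun d f \<Longrightarrow> x \<in> Rvec d \<Longrightarrow> y \<in> Rvec d \<Longrightarrow> 0 \<le> t \<Longrightarrow> t \<le> 1 \<Longrightarrow>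
    f (vadd d (vscale d (1 - t) x) (vscale d t y)) \<le> (1 - t) * f x + t * f y"
  by (auto simp: convex_fun_def)

lemma convex_fun_section:
  assumes f: "convex_fun d f" and x: "x \<in> Rvec d" "i < d"
  shows "convex_on UNIV (\<lambda>t. f (x(i := t)))"
proof (rule convex_onI)
  fix t a b :: real assume t: "0 < t" "t < 1"
  have "x(i := (1 - t) *\<^sub>R a + t *\<^sub>R b) = vadd d (vscale d (1 - t) (x(i := a))) (vscale d t (x(i := b)))"
  proof (rule Rvec_eqI[of _ d])
    show "x(i := (1 - t) *\<^sub>R a + t *\<^sub>R b) \<in> Rvec d" using x by (rule Rvec_upd)
    show "vadd d (vscale d (1 - t) (x(i := a))) (vscale d t (x(i := b))) \<in> Rvec d" by (rule vadd_Rvec)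
  qed (auto simp: vadd_def vscale_def algebra_simps)
  then show "f (x(i := (1 - t) *\<^sub>R a + t *\<^sub>R b)) \<le> (1 - t) * f (x(i := a)) + t * f (x(i := b))"
    using t x by (simp only:) (intro convex_funD[OF f] Rvec_upd, auto)
qed simp

lemma convex_fun_measurable:
  assumes "convex_fun d f" shows "f \<in> borel_measurable (Pi\<^sub>M {..<d} (\<lambda>_. borel))"
  by (intro measurable_separately_continuous convex_on_continuous convex_fun_section[OF assms])
    (auto simp: Rvec_def)

section \<open>Averaging over sign changes\<close>

definition flip :: "'i \<Rightarrow> ('i \<Rightarrow> real) \<Rightarrow> 'i \<Rightarrow> real" where
  "flip i x = x(i := - x i)"

text \<open>The average of \<open>f\<close> over all sign patterns of the first \<open>k\<close>
  coordinates, built one reflection at a time so that each property is checked for a single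
  flip.\<close>

primrec symm :: "nat \<Rightarrow> ((nat \<Rightarrow> real) \<Rightarrow> real) \<Rightarrow> (nat \<Rightarrow> real) \<Rightarrow> real" where
  "symm 0 f = f"
| "symm (Suc k) f = (\<lambda>x. (symm k f x + symm k f (flip k x)) / 2)"

lemma flip_Rvec: "x \<in> Rvec d \<Longrightarrow> i < d \<Longrightarrow> flip i x \<in> Rvec d"
  by (simp add: flip_def Rvec_upd)

lemma flip_flip [simp]: "flip i (flip i x) = x"
  by (simp add: flip_def)

lemma flip_commute: "flip i (flip j x) = flip j (flip i x)"
  by (auto simp: flip_def fun_eq_iff)

lemma flip_vadd: "i < d \<Longrightarrow> flip i (vadd d x y) = vadd d (flip i x) (flip i y)"
  by (auto simp: flip_def vadd_def fun_eq_iff)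

lemma flip_vscale: "i < d \<Longrightarrow> flip i (vscale d a x) = vscale d a (flip i x)"
  by (auto simp: flip_def vscale_def fun_eq_iff)

lemma convex_fun_symm:
  assumes "convex_fun d f" "k \<le> d" shows "convex_fun d (symm k f)"
  using assms(2)
proof (induction k)
  case (Suc k)
  then have IH: "convex_fun d (symm k f)" and k: "k < d" by auto
  show ?case
    unfolding convex_fun_def
  proof (intro ballI)
    fix x y t assume *: "x \<in> Rvec d" "y \<in> Rvec d" "t \<in> {0..1::real}"
    then show "symm (Suc k) f (vadd d (vscale d (1 - t) x) (vscale d t y)) \<le>
        (1 - t) * symm (Suc k) f x + t * symm (Suc k) f y"
      using convex_funD[OF IH *(1,2), of t] convex_funD[OF IH flip_Rvec[OF *(1) k] flip_Rvec[OF *(2) k], of t]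
      by (simp add: flip_vadd flip_vscale k field_simps)
  qed
qed (use assms in simp)

lemma symm_flip: "i < k \<Longrightarrow> symm k f (flip i x) = symm k f x"
proof (induction k arbitrary: x)
  case (Suc k)
  then show ?case by (cases "i = k") (auto simp: flip_commute[of k i] add.commute)
qed simp

lemma symm_nonneg:
  assumes "\<And>x. x \<in> Rvec d \<Longrightarrow> 0 \<le> f x" shows "k \<le> d \<Longrightarrow> x \<in> Rvec d \<Longrightarrow> 0 \<le> symm k f x"
proof (induction k arbitrary: x)
  case (Suc k)
  then show ?case using flip_Rvec[of x d k] by simp
qed (use assms in simp)

lemma symm_vscale_hom:
  assumes "\<And>x. x \<in> Rvec d \<Longrightarrow> f (vscale d a x) = c * f x"
  shows "k \<le> d \<Longrightarrow> x \<in> Rvec d \<Longrightarrow> symm k f (vscale d a x) = c * symm k f x"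
proof (induction k arbitrary: x)
  case (Suc k)
  then show ?case using flip_Rvec[of x d k] by (simp add: flip_vscale field_simps)
qed (use assms in simp)

lemma symm_vscale:
  "k \<le> d \<Longrightarrow> symm k (\<lambda>x. f (vscale d a x)) x = symm k f (vscale d a x)"
  by (induction k arbitrary: x) (auto simp: flip_vscale)

text \<open>The value \<open>a\<close> is a convex combination of \<open>b\<close> and
  \<open>- b\<close>, where the even function takes the same value.\<close>

lemma even_section_mono:
  assumes g: "convex_fun d g" and x: "x \<in> Rvec d" "i < d"
    and even: "\<And>x. x \<in> Rvec d \<Longrightarrow> g (flip i x) = g x" and ab: "\<bar>a\<bar> \<le> \<bar>b\<bar>"
  shows "g (x(i := a)) \<le> g (x(i := b))"
proof (cases "b = 0")
  case False
  define u where "u = (a + b) / (2 * b)"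
  have u: "0 \<le> u" "u \<le> 1" "(1 - u) * (- b) + u * b = a"
    using ab False by (auto simp: u_def field_simps abs_if split: if_splits)
  have "g (x(i := a)) \<le> (1 - u) * g (x(i := - b)) + u * g (x(i := b))"
    using convex_onD[OF convex_fun_section[OF g x], of u "- b" b] u by simp
  also have "g (x(i := - b)) = g (x(i := b))"
    using even[OF Rvec_upd[OF x, of b]] by (simp add: flip_def)
  also have "(1 - u) * g (x(i := b)) + u * g (x(i := b)) = g (x(i := b))"
    by (simp only: distrib_right[symmetric]) simp
  finally show ?thesis .
qed (use ab in simp)

text \<open>The coordinates of \<open>x\<close> are replaced by those of \<open>y\<close> one at a
  time; \<open>z k\<close> is the hybrid after \<open>k\<close> replacements.\<close>

lemma abs_mono_even:
  assumes g: "convex_fun d g" and even: "\<And>x i. x \<in> Rvec d \<Longrightarrow> i < d \<Longrightarrow> g (flip i x) = g x"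
  shows "abs_mono {..<d} g"
  unfolding abs_mono_def
proof (intro ballI impI)
  fix x y :: "nat \<Rightarrow> real"
  assume x: "x \<in> {..<d} \<rightarrow>\<^sub>E UNIV" and y: "y \<in> {..<d} \<rightarrow>\<^sub>E UNIV" and xy: "\<forall>i\<in>{..<d}. \<bar>x i\<bar> \<le> \<bar>y i\<bar>"
  define z where "z k j = (if j < k then y j else x j)" for k j
  have le: "g x \<le> g (z k)" if "k \<le> d" for k
    using that
  proof (induction k)
    case 0
    have "z 0 = x" by (auto simp: z_def)
    then show ?case by simp
  next
    case (Suc k)
    have zR: "z k \<in> Rvec d" using x y Suc by (auto simp: z_def Rvec_def PiE_def extensional_def)
    have "z k = (z k)(k := x k)" "z (Suc k) = (z k)(k := y k)"
      by (auto simp: z_def fun_eq_iff less_Suc_eq)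
    then have "g (z k) \<le> g (z (Suc k))"
      using even_section_mono[OF g zR, of k "x k" "y k"] even xy Suc by auto
    with Suc show ?case by simp
  qed
  have "z d = y"
    using x y by (auto simp: z_def fun_eq_iff PiE_def extensional_def)
  with le[of d] show "g x \<le> g y" by simp
qed

lemma abs_mono_symm: "convex_fun d f \<Longrightarrow> abs_mono {..<d} (symm d f)"
  by (intro abs_mono_even convex_fun_symm symm_flip) auto

lemma seminorm_convex_fun:
  assumes "seminorm d q" shows "convex_fun d q"
  unfolding convex_fun_def
proof (intro ballI)
  fix x y t assume *: "x \<in> Rvec d" "y \<in> Rvec d" "t \<in> {0..1::real}"
  have "q (vadd d (vscale d (1 - t) x) (vscale d t y)) \<le> q (vscale d (1 - t) x) + q (vscale d t y)"
    using assms by (auto simp: seminorm_def)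
  also have "\<dots> = (1 - t) * q x + t * q y" using assms * by (auto simp: seminorm_def)
  finally show "q (vadd d (vscale d (1 - t) x) (vscale d t y)) \<le> (1 - t) * q x + t * q y" .
qed

text \<open>Expansion in the standard basis; it reduces finiteness of the expected seminorm to
  integrability of the coordinates.\<close>

lemma seminorm_le_sum:
  assumes q: "seminorm d q" and x: "x \<in> Rvec d"
  shows "q x \<le> (\<Sum>i<d. \<bar>x i\<bar> * q (\<lambda>j\<in>{..<d}. if j = i then 1 else 0))"
proof -
  define e :: "nat \<Rightarrow> nat \<Rightarrow> real" where "e i = (\<lambda>j\<in>{..<d}. if j = i then 1 else 0)" for i
  define z where "z k = (\<lambda>j\<in>{..<d}. if j < k then x j else 0)" for k
  have le: "q (z k) \<le> (\<Sum>i<k. \<bar>x i\<bar> * q (e i))" if "k \<le> d" for k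
    using that
  proof (induction k)
    case 0
    have "z 0 = vscale d 0 x" by (auto simp: z_def vscale_def)
    then have "q (z 0) = \<bar>0\<bar> * q x" using q x by (simp only: seminorm_def)
    then show ?case by simp
  next
    case (Suc k)
    have R: "z k \<in> Rvec d" "e k \<in> Rvec d" by (auto simp: z_def e_def Rvec_def)
    have "z (Suc k) = vadd d (z k) (vscale d (x k) (e k))"
      by (auto simp: z_def e_def vadd_def vscale_def fun_eq_iff less_Suc_eq)
    then have "q (z (Suc k)) \<le> q (z k) + \<bar>x k\<bar> * q (e k)"
      using q R unfolding seminorm_def by (metis vscale_Rvec)
    with Suc show ?case by simp
  qed
  have "z d = x" using x by (intro Rvec_eqI[of _ d]) (auto simp: z_def Rvec_def)
  with le[of d] show ?thesis by (simp only: e_def order.refl)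
qed

section \<open>Comparison of the two laws\<close>

lemma measurable_flip:
  assumes "i \<in> I"
  shows "flip i \<in> Pi\<^sub>M I (\<lambda>_. borel) \<rightarrow>\<^sub>M Pi\<^sub>M I (\<lambda>_. borel)"
proof -
  have "I = I \<union> {i}" using assms by auto
  note measurable_fun_upd[OF this measurable_ident]
  then show ?thesis
    unfolding flip_def[abs_def] using assms by (intro measurable_fun_upd[OF \<open>I = I \<union> {i}\<close>]) measurable
qed

lemma nn_integral_symm:
  assumes S: "sets P = sets (Pi\<^sub>M {..<d} (\<lambda>_. borel))"
    and inv: "\<And>i h. i < d \<Longrightarrow> h \<in> borel_measurable (Pi\<^sub>M {..<d} (\<lambda>_. borel)) \<Longrightarrow>
      (\<integral>\<^sup>+x. h (flip i x) \<partial>P) = (\<integral>\<^sup>+x. h x \<partial>P :: ennreal)"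
    and f: "convex_fun d f" "\<And>x. x \<in> Rvec d \<Longrightarrow> 0 \<le> f x" and "k \<le> d"
  shows "(\<integral>\<^sup>+x. ennreal (symm k f x) \<partial>P) = (\<integral>\<^sup>+x. ennreal (f x) \<partial>P)"
  using \<open>k \<le> d\<close>
proof (induction k)
  case (Suc k)
  then have k: "k < d" "k \<in> {..<d}" by auto
  have sp: "space P = Rvec d" using sets_eq_imp_space_eq[OF S] by (simp add: space_PiM Rvec_def)
  have m: "symm k f \<in> borel_measurable (Pi\<^sub>M {..<d} (\<lambda>_. borel))"
    using k by (intro convex_fun_measurable convex_fun_symm f) auto
  have [measurable]: "symm k f \<in> borel_measurable P" "(\<lambda>x. symm k f (flip k x)) \<in> borel_measurable P"
    using m measurable_compose[OF measurable_flip[OF k(2)] m] by (simp_all add: measurable_cong_sets[OF S refl])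
  have "(\<integral>\<^sup>+x. ennreal (symm (Suc k) f x) \<partial>P) =
      (\<integral>\<^sup>+x. (ennreal (symm k f x) + ennreal (symm k f (flip k x))) / 2 \<partial>P)"
    using symm_nonneg[of d f k, OF f(2)] flip_Rvec[OF _ k(1)] k
    by (intro nn_integral_cong) (simp add: sp divide_ennreal[symmetric] ennreal_plus[symmetric] del: ennreal_plus)
  also have "\<dots> = ((\<integral>\<^sup>+x. ennreal (symm k f x) \<partial>P) + (\<integral>\<^sup>+x. ennreal (symm k f (flip k x)) \<partial>P)) / 2"
    by (simp add: nn_integral_divide nn_integral_add)
  also have "(\<integral>\<^sup>+x. ennreal (symm k f (flip k x)) \<partial>P) = (\<integral>\<^sup>+x. ennreal (symm k f x) \<partial>P)"
    using m k by (intro inv[of k "\<lambda>x. ennreal (symm k f x)"]) auto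
  also have "(\<integral>\<^sup>+x. ennreal (symm k f x) \<partial>P) = (\<integral>\<^sup>+x. ennreal (f x) \<partial>P)"
    using Suc by simp
  finally show ?case by (simp add: mult_2[symmetric] mult.commute[of 2] ennreal_mult_divide_eq)
qed simp

text \<open>The coordinate \<open>i\<close> is integrated innermost, where reflection preserves
  Lebesgue measure and the even weight.\<close>

lemma exp_product_flip:
  assumes fin: "finite I" and i: "i \<in> I" and F: "F \<in> borel_measurable (exp_product lam I)"
  shows "(\<integral>\<^sup>+x. F (flip i x) \<partial>exp_product lam I) = (\<integral>\<^sup>+x. F x \<partial>exp_product lam I)"
proof -
  interpret product_sigma_finite "\<lambda>_. exp_measure lam" by (rule product_sigma_finite_exp_measure)
  define J where "J = I - {i}"
  have J: "finite J" "i \<notin> J" "I = insert i J" using fin i by (auto simp: J_def)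
  have Ff: "(\<lambda>x. F (flip i x)) \<in> borel_measurable (exp_product lam I)"
    using measurable_compose[OF measurable_flip[OF i], of F] F
    by (simp add: borel_measurable_PiM_borel[of "\<lambda>_. exp_measure lam"])
  have "(\<integral>\<^sup>+y. F (flip i (x(i := y))) \<partial>exp_measure lam) = (\<integral>\<^sup>+y. F (x(i := y)) \<partial>exp_measure lam)"
    if x: "x \<in> space (exp_product lam J)" for x
  proof -
    have "(\<lambda>y. F (x(i := y))) \<in> borel_measurable (exp_measure lam)"
      using measurable_comp[OF measurable_component_update[OF x J(2)] F[unfolded J(3)]] by (simp add: comp_def)
    then have [measurable]: "(\<lambda>y. F (x(i := y))) \<in> borel_measurable borel"
      by (simp add: measurable_cong_sets[OF sets_exp_measure refl])
    have m2: "(\<lambda>y. F (x(i := - y))) \<in> borel_measurable borel"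
      by (rule measurable_compose[of uminus borel borel "\<lambda>y. F (x(i := y))"]) measurable
    have "(\<integral>\<^sup>+y. F (flip i (x(i := y))) \<partial>exp_measure lam) = (\<integral>\<^sup>+y. F (x(i := - y)) \<partial>exp_measure lam)"
      by (simp add: flip_def)
    also have "\<dots> = (\<integral>\<^sup>+y. ennreal (exp (- lam * \<bar>y\<bar>)) * F (x(i := - y)) \<partial>lborel)"
      using m2 by (rule nn_integral_exp_measure)
    also have "\<dots> = (\<integral>\<^sup>+y. ennreal (exp (- lam * \<bar>y\<bar>)) * F (x(i := y)) \<partial>lborel)"
      using m2 by (subst nn_integral_real_affine[of _ "-1" 0]) auto
    also have "\<dots> = (\<integral>\<^sup>+y. F (x(i := y)) \<partial>exp_measure lam)"
      by (rule nn_integral_exp_measure[symmetric]) measurable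
    finally show ?thesis .
  qed
  then have "(\<integral>\<^sup>+x. \<integral>\<^sup>+y. F (flip i (x(i := y))) \<partial>exp_measure lam \<partial>exp_product lam J) =
      (\<integral>\<^sup>+x. \<integral>\<^sup>+y. F (x(i := y)) \<partial>exp_measure lam \<partial>exp_product lam J)"
    by (rule nn_integral_cong)
  then show ?thesis
    unfolding J(3) using product_nn_integral_insert[OF J(1,2) F[unfolded J(3)]]
      product_nn_integral_insert[OF J(1,2) Ff[unfolded J(3)]] by simp
qed

section \<open>The vector X and the product law on a common base measure\<close>

locale gibbs_vector = product_gibbs lam \<phi> "{..<d}" for lam \<phi> and d :: nat +
  fixes E :: real and \<mu> :: "(nat \<Rightarrow> real) measure"
  assumes E: "0 < E" and d: "1 \<le> d" and law: "is_law_X d E lam \<phi> \<mu>"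
begin

abbreviation "PB \<equiv> exp_product lam {..<d}"
abbreviation "Borel \<equiv> Pi\<^sub>M {..<d} (\<lambda>_. borel :: real measure)"

lemma measurable_PB_iff [simp]: "borel_measurable PB = borel_measurable Borel"
  by (rule borel_measurable_PiM_borel) simp

lemma sets_lborel_vec: "sets (lborel_vec d) = sets Borel"
  unfolding lborel_vec_def by (intro sets_PiM_cong) auto

lemma energy_flip: "i < d \<Longrightarrow> energy (flip i x) = energy x"
  by (intro sum.cong) (auto simp: flip_def)

lemma flip_invariant:
  assumes "i < d" and h: "h \<in> borel_measurable Borel" and w: "w \<in> borel_measurable borel"
  shows "(\<integral>\<^sup>+x. h (flip i x) \<partial>density PB (\<lambda>x. w (energy x))) = (\<integral>\<^sup>+x. h x \<partial>density PB (\<lambda>x. w (energy x)))"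
proof -
  note [measurable] = w
  have [measurable]: "h \<in> borel_measurable PB" using h by simp
  have [measurable]: "(\<lambda>x. h (flip i x)) \<in> borel_measurable PB"
    using measurable_compose[OF measurable_flip h, of i] assms(1) by simp
  have "(\<integral>\<^sup>+x. w (energy (flip i x)) * h (flip i x) \<partial>PB) = (\<integral>\<^sup>+x. w (energy x) * h x \<partial>PB)"
    using assms(1) by (intro exp_product_flip[where F = "\<lambda>x. w (energy x) * h x"]) measurable
  then show ?thesis
    by (simp add: nn_integral_density energy_flip[OF assms(1)])
qed

text \<open>The exponential weight of \<open>X\<close> is absorbed into the base measure; total mass
  one then identifies \<open>c\<close> as the inverse of \<open>G E\<close>.\<close>

lemma law_density:
  obtains c where "0 < c" "\<mu> = density PB (\<lambda>x. ennreal c * indicator {..E} (energy x))"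
    "ennreal c * G E = 1"
proof -
  obtain c where c: "0 < c" and mu: "\<mu> = density (lborel_vec d) (\<lambda>x. ennreal (c * X_weight d E lam \<phi> x))"
    and prob: "prob_space \<mu>"
    using law by (auto simp: is_law_X_def)
  have PB: "PB = density (lborel_vec d) (\<lambda>x. \<Prod>i<d. ennreal (exp (- lam * \<bar>x i\<bar>)))"
    unfolding lborel_vec_def exp_measure_def
    using product_sigma_finite_exp_measure[of lam] sigma_finite_lborel
    by (intro PiM_density) (auto simp: exp_measure_def product_sigma_finite_def)
  have "(borel_measurable PB :: ((nat \<Rightarrow> real) \<Rightarrow> real) set) = borel_measurable (lborel_vec d)"
    unfolding measurable_PB_iff using measurable_cong_sets[OF sets_lborel_vec refl] by (rule sym)
  then have [measurable]: "energy \<in> borel_measurable (lborel_vec d)"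
    using measurable_energy' by (simp only:)
  have [measurable]: "(\<lambda>x. x i) \<in> borel_measurable (lborel_vec d)" if "i < d" for i
    using that measurable_component_singleton[of i "{..<d}" "\<lambda>_. lborel :: real measure"]
    by (simp add: lborel_vec_def measurable_cong_sets[OF refl sets_lborel])
  have mu': "\<mu> = density PB (\<lambda>x. ennreal c * indicator {..E} (energy x))"
    unfolding mu PB
  proof (subst density_density_eq)
    show "density (lborel_vec d) (\<lambda>x. ennreal (c * X_weight d E lam \<phi> x)) =
      density (lborel_vec d) (\<lambda>x. (\<Prod>i<d. ennreal (exp (- lam * \<bar>x i\<bar>))) * (ennreal c * indicator {..E} (energy x)))"
    proof (rule arg_cong[where f = "density (lborel_vec d)"], rule ext)
      fix x :: "nat \<Rightarrow> real"
      show "ennreal (c * X_weight d E lam \<phi> x) =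
          (\<Prod>i<d. ennreal (exp (- lam * \<bar>x i\<bar>))) * (ennreal c * indicator {..E} (energy x))"
        using c by (cases "energy x \<le> E")
          (simp_all add: X_weight_def prod_ennreal exp_sum[symmetric] sum_distrib_left ennreal_mult mult.commute)
    qed
  qed measurable
  have "1 = emeasure \<mu> (space \<mu>)" using prob_space.emeasure_space_1[OF prob] by simp
  also have "\<dots> = (\<integral>\<^sup>+x. ennreal c * indicator {..E} (energy x) \<partial>PB)"
    unfolding mu' by (subst emeasure_density) (auto intro!: nn_integral_cong)
  also have "\<dots> = ennreal c * (\<integral>\<^sup>+x. indicator {..E} (energy x) \<partial>PB)"
    by (rule nn_integral_cmult) measurable
  also have "\<dots> = ennreal c * G E"
    unfolding level_integral_def by (intro arg_cong2[where f = "(*)"] nn_integral_cong refl) (auto simp: indicator_def)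
  finally show ?thesis by (intro that[OF c mu']) simp
qed

lemma sets_mu: "sets \<mu> = sets Borel"
proof -
  obtain c where c: "\<mu> = density PB (\<lambda>x. ennreal c * indicator {..E} (energy x))"
    by (rule law_density)
  have "sets PB = sets Borel" by (intro sets_PiM_cong) auto
  then show ?thesis by (simp add: c)
qed

lemma space_mu: "space \<mu> = Rvec d"
  using sets_eq_imp_space_eq[OF sets_mu] by (simp add: space_PiM Rvec_def)

lemma prob_space_mu: "prob_space \<mu>"
  using law by (simp add: is_law_X_def)

lemma nn_integral_mu:
  assumes "h \<in> borel_measurable Borel"
  shows "G E * (\<integral>\<^sup>+x. h x \<partial>\<mu>) = N h E"
proof -
  have [measurable]: "h \<in> borel_measurable PB" using assms by simp
  obtain c where c: "\<mu> = density PB (\<lambda>x. ennreal c * indicator {..E} (energy x))" "ennreal c * G E = 1"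
    by (rule law_density)
  have "(\<integral>\<^sup>+x. h x \<partial>\<mu>) = (\<integral>\<^sup>+x. ennreal c * (h x * indicator {x. energy x \<le> E} x) \<partial>PB)"
    unfolding c by (subst nn_integral_density) (auto intro!: nn_integral_cong simp: indicator_def mult_ac)
  also have "\<dots> = ennreal c * N h E"
    unfolding level_integral_def by (rule nn_integral_cmult) measurable
  finally have "G E * (\<integral>\<^sup>+x. h x \<partial>\<mu>) = ennreal c * G E * N h E" by (simp add: mult_ac)
  then show ?thesis by (simp add: c(2))
qed

lemma mu_flip:
  assumes "i < d" "h \<in> borel_measurable Borel"
  shows "(\<integral>\<^sup>+x. h (flip i x) \<partial>\<mu>) = (\<integral>\<^sup>+x. h x \<partial>\<mu>)"
proof -
  obtain c where c: "\<mu> = density PB (\<lambda>x. ennreal c * indicator {..E} (energy x))"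
    by (rule law_density)
  show ?thesis unfolding c by (rule flip_invariant[OF assms]) measurable
qed

lemma V_flip:
  assumes "0 < \<tau>" "i < d" "h \<in> borel_measurable Borel"
  shows "(\<integral>\<^sup>+x. h (flip i x) \<partial>V_product \<tau>) = (\<integral>\<^sup>+x. h x \<partial>V_product \<tau>)"
  unfolding V_product_density[OF assms(1)]
  by (rule flip_invariant[OF assms(2,3), of "\<lambda>e. ennreal (exp (- \<tau> * e) / partition_function \<tau>)"]) measurable

lemma is_law_V_product:
  assumes tau: "0 < \<tau>" shows "is_law_V d lam \<tau> \<phi> (V_product \<tau>)"
proof -
  interpret A: admissible_coordinate lam \<tau> "\<phi> j" for j using tau by (rule coordinate)
  interpret V: prob_space "V_product \<tau>" by (rule prob_space_V_product[OF tau])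
  have distr: "distr (V_product \<tau>) borel (\<lambda>v. v i) = V_law lam \<tau> (\<phi> i)" if "i < d" for i
  proof -
    have "distr (V_product \<tau>) borel (\<lambda>v. v i) = distr (V_product \<tau>) (V_law lam \<tau> (\<phi> i)) (\<lambda>v. v i)"
      by (rule distr_cong) auto
    also have "\<dots> = V_law lam \<tau> (\<phi> i)"
      unfolding V_product_def using that A.prob_space_V_law
      by (intro distr_PiM_component[where M = "\<lambda>i. V_law lam \<tau> (\<phi> i)"]) auto
    finally show ?thesis .
  qed
  have rv [measurable]: "(\<lambda>v. v i) \<in> borel_measurable (V_product \<tau>)" if "i < d" for i
    using that measurable_component_singleton[of i "{..<d}" "\<lambda>i. V_law lam \<tau> (\<phi> i)"]
    by (simp add: V_product_def measurable_cong_sets[OF refl sets_V_law])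
  have "distr (V_product \<tau>) Borel (\<lambda>x. \<lambda>i\<in>{..<d}. x i) = distr (V_product \<tau>) (V_product \<tau>) (\<lambda>x. x)"
    by (intro distr_cong) (auto simp: fun_eq_iff PiE_def extensional_def)
  also have "\<dots> = Pi\<^sub>M {..<d} (\<lambda>i. distr (V_product \<tau>) borel (\<lambda>v. v i))"
    unfolding distr_id by (subst V_product_def, rule PiM_cong) (auto simp: distr)
  \<comment> \<open>Independence is read off from the joint law being the product of the marginals;
    the nonempty index set required by this criterion comes from \<open>1 \<le> d\<close>.\<close>
  finally have "V.indep_vars (\<lambda>_. borel) (\<lambda>i v. v i) {..<d}"
    using d rv by (subst V.indep_vars_iff_distr_eq_PiM') (auto simp: lessThan_empty_iff)
  moreover have "distributed (V_product \<tau>) lborel (\<lambda>v. v i) (\<lambda>v. ennreal (V_density lam \<tau> (\<phi> i) v))" if "i < d" for i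
  proof -
    have "distr (V_product \<tau>) lborel (\<lambda>v. v i) = distr (V_product \<tau>) borel (\<lambda>v. v i)"
      by (rule distr_cong) auto
    then show ?thesis
      unfolding distributed_def using rv[OF that] distr[OF that] by (simp add: V_law_def)
  qed
  ultimately show ?thesis
    unfolding is_law_V_def by (simp add: V.prob_space_axioms sets_lborel_vec)
qed

lemma V_coordinate_integrable:
  assumes tau: "0 < \<tau>" and i: "i < d" shows "integrable (V_product \<tau>) (\<lambda>v. v i)"
proof -
  interpret A: admissible_coordinate lam \<tau> "\<phi> j" for j using tau by (rule coordinate)
  have m: "(\<lambda>v. v i) \<in> V_product \<tau> \<rightarrow>\<^sub>M V_law lam \<tau> (\<phi> i)"
    unfolding V_product_def using i
    by (intro measurable_component_singleton[where M = "\<lambda>i. V_law lam \<tau> (\<phi> i)"]) auto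
  have "distr (V_product \<tau>) (V_law lam \<tau> (\<phi> i)) (\<lambda>v. v i) = V_law lam \<tau> (\<phi> i)"
    unfolding V_product_def using i A.prob_space_V_law
    by (intro distr_PiM_component[where M = "\<lambda>i. V_law lam \<tau> (\<phi> i)"]) auto
  then show ?thesis
    using A.V_law_integrable_abs[of i] integrable_distr[OF m, of "\<lambda>v. v"] by simp
qed

text \<open>The coordinate is almost surely bounded: it cannot spend more than the whole budget
  \<open>E\<close>.\<close>

lemma mu_coordinate_integrable:
  assumes i: "i < d" shows "integrable \<mu> (\<lambda>x. x i)"
proof -
  interpret prob_space \<mu> by (rule prob_space_mu)
  obtain c where c: "\<mu> = density PB (\<lambda>x. ennreal c * indicator {..E} (energy x))"
    by (rule law_density)
  obtain R where R: "0 \<le> R" "\<phi> i R = E" using admissible_onto[OF adm[of i], of E] E by auto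
  have "AE x in \<mu>. energy x \<le> E"
    unfolding c by (subst AE_density) (measurable, auto simp: indicator_def)
  then have "AE x in \<mu>. norm (x i) \<le> R"
  proof eventually_elim
    case (elim x)
    have "\<phi> i \<bar>x i\<bar> \<le> energy x"
      using i by (intro member_le_sum) (auto intro: admissible_nonneg[OF adm])
    then have "\<phi> i \<bar>x i\<bar> \<le> \<phi> i R" using elim R by simp
    then show ?case using admissible_le_iff[OF adm[of i], of "\<bar>x i\<bar>" R] R(1) by simp
  qed
  moreover have "(\<lambda>x. x i) \<in> borel_measurable \<mu>"
    using i by (simp add: measurable_cong_sets[OF sets_mu refl])
  ultimately show ?thesis by (rule integrable_const_bound)
qed

end

lemma measurable_vscale:
  assumes "sets M = sets (Pi\<^sub>M {..<d} (\<lambda>_. borel))"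
  shows "vscale d a \<in> M \<rightarrow>\<^sub>M Pi\<^sub>M {..<d} (\<lambda>_. borel)"
proof -
  have "(\<lambda>x. \<lambda>i\<in>{..<d}. a * x i) \<in> Pi\<^sub>M {..<d} (\<lambda>_. borel) \<rightarrow>\<^sub>M Pi\<^sub>M {..<d} (\<lambda>_. borel :: real measure)"
    by (intro measurable_restrict) measurable
  then show ?thesis
    by (simp add: vscale_def[abs_def] measurable_cong_sets[OF assms refl])
qed

lemma convex_fun_vscale:
  assumes "convex_fun d f" shows "convex_fun d (\<lambda>x. f (vscale d a x))"
  unfolding convex_fun_def
proof (intro ballI)
  fix x y t assume *: "x \<in> Rvec d" "y \<in> Rvec d" "t \<in> {0..1::real}"
  have "vscale d a (vadd d (vscale d (1 - t) x) (vscale d t y)) =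
      vadd d (vscale d (1 - t) (vscale d a x)) (vscale d t (vscale d a y))"
    by (auto simp: vscale_def vadd_def algebra_simps)
  then show "f (vscale d a (vadd d (vscale d (1 - t) x) (vscale d t y))) \<le>
      (1 - t) * f (vscale d a x) + t * f (vscale d a y)"
    using convex_funD[OF assms vscale_Rvec vscale_Rvec] * by simp
qed

lemma convex_fun_max:
  assumes "convex_fun d f" shows "convex_fun d (\<lambda>x. max (f x) b + c)"
  unfolding convex_fun_def
proof (intro ballI)
  fix x y t assume *: "x \<in> Rvec d" "y \<in> Rvec d" "t \<in> {0..1::real}"
  let ?z = "vadd d (vscale d (1 - t) x) (vscale d t y)"
  have "f ?z \<le> (1 - t) * f x + t * f y" using convex_funD[OF assms] * by auto
  also have "\<dots> \<le> (1 - t) * max (f x) b + t * max (f y) b"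
    using * by (intro add_mono mult_left_mono) auto
  finally have "f ?z \<le> (1 - t) * max (f x) b + t * max (f y) b" .
  moreover have "(1 - t) * b + t * b \<le> (1 - t) * max (f x) b + t * max (f y) b"
    using * by (intro add_mono mult_left_mono) auto
  then have "b \<le> (1 - t) * max (f x) b + t * max (f y) b" by (simp add: algebra_simps)
  ultimately have "max (f ?z) b \<le> (1 - t) * max (f x) b + t * max (f y) b" by (rule max.boundedI)
  then show "max (f ?z) b + c \<le> (1 - t) * (max (f x) b + c) + t * (max (f y) b + c)"
    by (simp add: algebra_simps)
qed

text \<open>Pointwise, the truncation plus the capped negative part equals the positive part plus
  \<open>n\<close>. An identity of sums avoids subtracting integrals that may be infinite.\<close>

lemma (in prob_space) nn_integral_truncation:
  fixes u :: "'a \<Rightarrow> real" and n :: nat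
  assumes [measurable]: "u \<in> borel_measurable M"
  shows "(\<integral>\<^sup>+x. ennreal (max (u x) (- real n) + real n) \<partial>M)
      + (\<integral>\<^sup>+x. ennreal (min (max (- u x) 0) (real n)) \<partial>M)
    = (\<integral>\<^sup>+x. ennreal (u x) \<partial>M) + ennreal (real n)"
proof -
  have "(\<integral>\<^sup>+x. ennreal (max (u x) (- real n) + real n) \<partial>M)
      + (\<integral>\<^sup>+x. ennreal (min (max (- u x) 0) (real n)) \<partial>M)
    = (\<integral>\<^sup>+x. ennreal (max (u x) (- real n) + real n) + ennreal (min (max (- u x) 0) (real n)) \<partial>M)"
    by (rule nn_integral_add[symmetric]) measurable
  also have "\<dots> = (\<integral>\<^sup>+x. ennreal (u x) + ennreal (real n) \<partial>M)"
  proof (rule nn_integral_cong)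
    fix x
    have "ennreal (max (u x) (- real n) + real n) + ennreal (min (max (- u x) 0) (real n))
        = ennreal (max (u x) (- real n) + real n + min (max (- u x) 0) (real n))"
      by (rule ennreal_plus[symmetric]) auto
    also have "max (u x) (- real n) + real n + min (max (- u x) 0) (real n) = max (u x) 0 + real n"
      by (auto simp: min_def max_def)
    also have "ennreal (max (u x) 0 + real n) = ennreal (max (u x) 0) + ennreal (real n)"
      by (rule ennreal_plus) auto
    also have "ennreal (max (u x) 0) = ennreal (u x)" by (auto simp: max_def ennreal_neg)
    finally show "ennreal (max (u x) (- real n) + real n) + ennreal (min (max (- u x) 0) (real n))
        = ennreal (u x) + ennreal (real n)" .
  qed
  also have "\<dots> = (\<integral>\<^sup>+x. ennreal (u x) \<partial>M) + ennreal (real n)"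
    by (subst nn_integral_add) (auto simp: emeasure_space_1)
  finally show ?thesis .
qed

lemma nn_integral_negative_part_SUP:
  fixes u :: "'a \<Rightarrow> real"
  assumes [measurable]: "u \<in> borel_measurable M"
  shows "(\<integral>\<^sup>+x. ennreal (- u x) \<partial>M) = (SUP n::nat. \<integral>\<^sup>+x. ennreal (min (max (- u x) 0) (real n)) \<partial>M)"
proof -
  have "(SUP n::nat. ennreal (min (max (- y) 0) (real n))) = ennreal (- y)" for y
  proof (rule antisym)
    show "(SUP n::nat. ennreal (min (max (- y) 0) (real n))) \<le> ennreal (- y)"
      by (rule SUP_least) (auto simp: min_def max_def ennreal_neg intro: ennreal_leI)
    obtain n where "- y \<le> real n" using real_arch_simple by blast
    then have "ennreal (- y) = ennreal (min (max (- y) 0) (real n))"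
      by (auto simp: min_def max_def ennreal_neg)
    then show "ennreal (- y) \<le> (SUP n::nat. ennreal (min (max (- y) 0) (real n)))"
      by (metis SUP_upper UNIV_I)
  qed
  then have "(\<integral>\<^sup>+x. ennreal (- u x) \<partial>M) = (\<integral>\<^sup>+x. (SUP n::nat. ennreal (min (max (- u x) 0) (real n))) \<partial>M)"
    by simp
  also have "\<dots> = (SUP n::nat. \<integral>\<^sup>+x. ennreal (min (max (- u x) 0) (real n)) \<partial>M)"
    by (rule nn_integral_monotone_convergence_SUP)
      (auto simp: incseq_def le_fun_def intro!: ennreal_leI min.mono)
  finally show ?thesis .
qed

text \<open>
  The truncations \<open>max f (-n) + n\<close> of a convex function are convex and nonnegative, so that possibly
  infinite expectations are compared through integrals of nonnegative functions.
\<close>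

lemma ext_expectation_le:
  assumes P: "prob_space P" and Q: "prob_space Q"
    and [measurable]: "f \<in> borel_measurable P" "h \<in> borel_measurable Q"
    and le: "\<And>n::nat. (\<integral>\<^sup>+x. ennreal (max (f x) (- real n) + real n) \<partial>P)
      \<le> (\<integral>\<^sup>+x. ennreal (max (h x) (- real n) + real n) \<partial>Q)"
  shows "ext_expectation P f \<le> ext_expectation Q h"
proof -
  define a b a' b' where "a = (\<integral>\<^sup>+x. ennreal (f x) \<partial>P)" and "b = (\<integral>\<^sup>+x. ennreal (- f x) \<partial>P)"
    and "a' = (\<integral>\<^sup>+x. ennreal (h x) \<partial>Q)" and "b' = (\<integral>\<^sup>+x. ennreal (- h x) \<partial>Q)"
  define bn where "bn n = (\<integral>\<^sup>+x. ennreal (min (max (- f x) 0) (real n)) \<partial>P)" for n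
  define bn' where "bn' n = (\<integral>\<^sup>+x. ennreal (min (max (- h x) 0) (real n)) \<partial>Q)" for n
  have b: "b = (SUP n. bn n)" "b' = (SUP n. bn' n)"
    unfolding b_def b'_def bn_def bn'_def by (rule nn_integral_negative_part_SUP; measurable)+
  \<comment> \<open>The truncation identities for \<open>f\<close> and \<open>h\<close> are combined
    with \<open>le\<close>, and the finite term \<open>n\<close> is cancelled.\<close>
  have "a + bn' n \<le> a' + bn n" for n
  proof -
    let ?A = "\<integral>\<^sup>+x. ennreal (max (f x) (- real n) + real n) \<partial>P"
    let ?A' = "\<integral>\<^sup>+x. ennreal (max (h x) (- real n) + real n) \<partial>Q"
    have eq: "?A + bn n = a + ennreal (real n)" "?A' + bn' n = a' + ennreal (real n)"
      unfolding a_def a'_def bn_def bn'_def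
      by (rule prob_space.nn_integral_truncation[OF P], measurable)
        (rule prob_space.nn_integral_truncation[OF Q], measurable)
    have "ennreal (real n) + (a + bn' n) = ?A + (bn n + bn' n)"
      using eq(1) by (metis add.assoc add.commute)
    also have "\<dots> \<le> ?A' + (bn n + bn' n)" by (intro add_right_mono le)
    also have "\<dots> = ennreal (real n) + (a' + bn n)"
      using eq(2) by (metis add.assoc add.commute)
    finally show ?thesis by (simp only: ennreal_add_left_cancel_le) auto
  qed
  then have "a + bn' n \<le> a' + b" for n
    unfolding b by (rule order.trans) (intro add_left_mono SUP_upper UNIV_I)
  then have key: "a + b' \<le> a' + b"
    unfolding b(2) by (subst ennreal_SUP_add_right) (auto intro: SUP_least)
  \<comment> \<open>For \<open>a' = \<top>\<close> the right-hand side is infinite whatever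
    \<open>b'\<close> is, since \<open>ereal\<close> sets \<infinity> - \<infinity> to
    \<infinity>.\<close>
  have "enn2ereal a - enn2ereal b \<le> enn2ereal a' - enn2ereal b'"
  proof (cases "a' = \<top>")
    case False
    show ?thesis
    proof (cases "b = \<top>")
      case True
      \<comment> \<open>Under the same convention an infinite \<open>a\<close> would make the
        left-hand side infinite; the truncation with \<open>n = 0\<close> gives
        \<open>a \<le> a'\<close>, which rules this out.\<close>
      moreover have "a \<noteq> \<top>"
      proof -
        have "(\<integral>\<^sup>+x. ennreal (max (f x) (- real 0) + real 0) \<partial>P) = a"
          unfolding a_def by (intro nn_integral_cong) (auto simp: max_def ennreal_neg)
        moreover have "(\<integral>\<^sup>+x. ennreal (max (h x) (- real 0) + real 0) \<partial>Q) = a'"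
          unfolding a'_def by (intro nn_integral_cong) (auto simp: max_def ennreal_neg)
        ultimately have "a \<le> a'" using le[of 0] by simp
        then show ?thesis using False by (auto simp: top_unique)
      qed
      ultimately show ?thesis by (cases a) (auto simp: ennreal.rep_eq)
    next
      case b: False
      then have "a \<noteq> \<top>" "b' \<noteq> \<top>" using key False by (auto simp: top_unique)
      then obtain ra rb ra' rb' where r: "a = ennreal ra" "b = ennreal rb" "a' = ennreal ra'" "b' = ennreal rb'"
        "0 \<le> ra" "0 \<le> rb" "0 \<le> ra'" "0 \<le> rb'"
        using b False by (metis ennreal_cases)
      then have "ra + rb' \<le> ra' + rb"
        using key by (simp add: ennreal_plus[symmetric] ennreal_le_iff del: ennreal_plus)
      then show ?thesis using r by (simp add: ennreal.rep_eq)
    qed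
  qed simp
  then show ?thesis
    by (simp add: ext_expectation_def a_def b_def a'_def b'_def)
qed

context gibbs_vector
begin

text \<open>\<open>key\<close> speaks only of functions of the \<open>\<bar>x i\<bar>\<close>, so
  \<open>h\<close> is replaced by its sign average, which has the same integral under either law.
  The factor \<open>C\<close> is then absorbed by the dilation.\<close>

proposition convex_comparison:
  assumes tau: "0 < \<tau>" and C: "1 \<le> C"
    and key: "\<And>f. f \<in> borel_measurable PB \<Longrightarrow> abs_mono {..<d} f \<Longrightarrow>
      N f E \<le> ennreal C * (G E * (\<integral>\<^sup>+x. f x \<partial>V_product \<tau>))"
    and h: "convex_fun d h" "\<And>x. x \<in> Rvec d \<Longrightarrow> 0 \<le> h x"
  shows "(\<integral>\<^sup>+x. ennreal (h x) \<partial>\<mu>) \<le> (\<integral>\<^sup>+v. ennreal (h (vscale d C v)) \<partial>V_product \<tau>)"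
proof -
  interpret X: prob_space \<mu> by (rule prob_space_mu)
  interpret V: prob_space "V_product \<tau>" by (rule prob_space_V_product[OF tau])
  define g where "g = symm d h"
  define o0 :: "nat \<Rightarrow> real" where "o0 = (\<lambda>i\<in>{..<d}. 0)"
  have o0: "o0 \<in> Rvec d" by (simp add: o0_def Rvec_def)
  have g: "convex_fun d g" unfolding g_def by (intro convex_fun_symm h) simp
  have g_abs: "abs_mono {..<d} g" unfolding g_def by (rule abs_mono_symm[OF h(1)])
  have g0: "g o0 \<le> g x" if "x \<in> Rvec d" for x
    using that o0 by (intro abs_monoD[OF g_abs]) (auto simp: Rvec_def o0_def)
  have g_nonneg: "0 \<le> g o0"
    unfolding g_def by (rule symm_nonneg[of d, OF h(2)]) (use o0 in auto)
  have gm: "g \<in> borel_measurable Borel" "(\<lambda>v. g (vscale d C v)) \<in> borel_measurable Borel"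
    by (intro convex_fun_measurable convex_fun_vscale g)+
  have gmu [measurable]: "g \<in> borel_measurable \<mu>"
    using gm by (simp add: measurable_cong_sets[OF sets_mu refl])
  have gV [measurable]: "(\<lambda>v. g (vscale d C v)) \<in> borel_measurable (V_product \<tau>)"
    using gm by (simp add: measurable_cong_sets[OF sets_V_product refl])
  \<comment> \<open>The sign average is smallest at the origin. With that value subtracted, it grows
    along rays at least linearly, so multiplying by \<open>C\<close> costs no more than dilating by
    \<open>C\<close>; the constant is restored at the end under two probability measures.\<close>
  define k where "k x = ennreal (g x - g o0)" for x
  define F where "F v = ennreal (g (vscale d C v) - g o0)" for v
  have km: "k \<in> borel_measurable Borel" and Fm: "F \<in> borel_measurable Borel"
    unfolding k_def[abs_def] F_def[abs_def] using gm by measurable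
  have "abs_mono {..<d} F"
    unfolding abs_mono_def F_def
  proof (intro ballI impI ennreal_leI diff_right_mono)
    fix x y :: "nat \<Rightarrow> real" assume "\<forall>i\<in>{..<d}. \<bar>x i\<bar> \<le> \<bar>y i\<bar>"
    then show "g (vscale d C x) \<le> g (vscale d C y)"
      using C by (intro abs_monoD[OF g_abs]) (auto simp: vscale_def abs_mult mult_left_mono)
  qed
  then have "N F E \<le> ennreal C * (G E * (\<integral>\<^sup>+x. F x \<partial>V_product \<tau>))"
    using Fm by (intro key) auto
  moreover have "ennreal C * N k E \<le> N F E"
  proof -
    have [measurable]: "k \<in> borel_measurable PB" using km by simp
    have "ennreal C * N k E = N (\<lambda>x. ennreal C * k x) E"
      unfolding level_integral_def by (subst nn_integral_cmult[symmetric]) (measurable, simp add: mult.assoc)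
    also have "\<dots> \<le> N F E"
    proof (rule level_integral_mono)
      fix x :: "nat \<Rightarrow> real" assume "x \<in> {..<d} \<rightarrow>\<^sub>E UNIV"
      then have x: "x \<in> Rvec d" by (simp add: Rvec_def)
      have "x = vadd d (vscale d (1 - 1 / C) o0) (vscale d (1 / C) (vscale d C x))"
        using x C by (intro Rvec_eqI[of _ d]) (auto simp: vadd_def vscale_def o0_def Rvec_def)
      then have "g x \<le> (1 - 1 / C) * g o0 + 1 / C * g (vscale d C x)"
        using convex_funD[OF g o0 vscale_Rvec, of "1 / C" C x] C by simp
      then have "C * (g x - g o0) \<le> g (vscale d C x) - g o0"
        using C by (simp add: field_simps)
      then show "ennreal C * k x \<le> F x"
        using C g0[OF x] by (simp add: k_def F_def ennreal_mult[symmetric] ennreal_leI)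
    qed
    finally show ?thesis .
  qed
  ultimately have "ennreal C * N k E \<le> ennreal C * (G E * (\<integral>\<^sup>+x. F x \<partial>V_product \<tau>))"
    by (rule order.trans[rotated])
  then have "N k E \<le> G E * (\<integral>\<^sup>+x. F x \<partial>V_product \<tau>)"
    using C by (simp add: ennreal_mult_le_mult_iff)
  then have "G E * (\<integral>\<^sup>+x. k x \<partial>\<mu>) \<le> G E * (\<integral>\<^sup>+x. F x \<partial>V_product \<tau>)"
    by (simp add: nn_integral_mu[OF km])
  then have main: "(\<integral>\<^sup>+x. k x \<partial>\<mu>) \<le> (\<integral>\<^sup>+x. F x \<partial>V_product \<tau>)"
    using G_pos[OF E] G_finite[of E] by (subst (asm) ennreal_mult_le_mult_iff) auto
  have "(\<integral>\<^sup>+x. ennreal (h x) \<partial>\<mu>) = (\<integral>\<^sup>+x. ennreal (g x) \<partial>\<mu>)"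
    unfolding g_def by (rule nn_integral_symm[OF sets_mu mu_flip h order.refl, symmetric])
  also have "\<dots> = (\<integral>\<^sup>+x. k x + ennreal (g o0) \<partial>\<mu>)"
    using g0 g_nonneg
    by (intro nn_integral_cong) (simp add: k_def space_mu ennreal_plus[symmetric] del: ennreal_plus)
  also have "\<dots> = (\<integral>\<^sup>+x. k x \<partial>\<mu>) + ennreal (g o0)"
    unfolding k_def by (subst nn_integral_add) (auto simp: X.emeasure_space_1)
  also have "\<dots> \<le> (\<integral>\<^sup>+x. F x \<partial>V_product \<tau>) + ennreal (g o0)"
    by (rule add_right_mono[OF main])
  also have "\<dots> = (\<integral>\<^sup>+x. F x + ennreal (g o0) \<partial>V_product \<tau>)"
    unfolding F_def by (subst nn_integral_add) (auto simp: V.emeasure_space_1[simplified])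
  also have "\<dots> = (\<integral>\<^sup>+v. ennreal (g (vscale d C v)) \<partial>V_product \<tau>)"
    using g0[OF vscale_Rvec] g_nonneg
    by (intro nn_integral_cong) (simp add: F_def ennreal_plus[symmetric] del: ennreal_plus)
  also have "\<dots> = (\<integral>\<^sup>+v. ennreal (symm d (\<lambda>v. h (vscale d C v)) v) \<partial>V_product \<tau>)"
    by (simp add: g_def symm_vscale)
  also have "\<dots> = (\<integral>\<^sup>+v. ennreal (h (vscale d C v)) \<partial>V_product \<tau>)"
    by (rule nn_integral_symm[OF sets_V_product V_flip[OF tau] convex_fun_vscale[OF h(1)]]) (auto intro: h(2))
  finally show ?thesis .
qed

lemma convex_order_V_product:
  assumes tau: "0 < \<tau>" and C: "1 \<le> C"
    and key: "\<And>f. f \<in> borel_measurable PB \<Longrightarrow> abs_mono {..<d} f \<Longrightarrow>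
      N f E \<le> ennreal C * (G E * (\<integral>\<^sup>+x. f x \<partial>V_product \<tau>))"
  shows "convex_order d \<mu> (\<lambda>x. x) (V_product \<tau>) (\<lambda>v. vscale d C v)"
  unfolding convex_order_def integrable_random_vector_def
proof (intro conjI allI impI)
  show "prob_space \<mu>" by (rule prob_space_mu)
  show "prob_space (V_product \<tau>)" by (rule prob_space_V_product[OF tau])
  show "(\<lambda>x. x) \<in> \<mu> \<rightarrow>\<^sub>M lborel_vec d"
    using sets_mu sets_lborel_vec by (simp add: measurable_ident_sets)
  show "vscale d C \<in> V_product \<tau> \<rightarrow>\<^sub>M lborel_vec d"
    using measurable_vscale[OF sets_V_product, of C \<tau>] measurable_cong_sets[OF refl sets_lborel_vec] by auto
  show "integrable \<mu> (\<lambda>x. x i)" if "i < d" for i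
    using that by (rule mu_coordinate_integrable)
  show "integrable (V_product \<tau>) (\<lambda>v. vscale d C v i)" if "i < d" for i
    using V_coordinate_integrable[OF tau that] that by (simp add: vscale_def)
next
  fix f assume f: "convex_fun d f"
  show "ext_expectation \<mu> (\<lambda>x. f x) \<le> ext_expectation (V_product \<tau>) (\<lambda>v. f (vscale d C v))"
  proof (rule ext_expectation_le[OF prob_space_mu prob_space_V_product[OF tau]])
    show "f \<in> borel_measurable \<mu>"
      using convex_fun_measurable[OF f] by (simp add: measurable_cong_sets[OF sets_mu refl])
    show "(\<lambda>v. f (vscale d C v)) \<in> borel_measurable (V_product \<tau>)"
      using convex_fun_measurable[OF convex_fun_vscale[OF f]]
      by (simp add: measurable_cong_sets[OF sets_V_product refl])
    fix n :: nat
    show "(\<integral>\<^sup>+x. ennreal (max (f x) (- real n) + real n) \<partial>\<mu>)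
        \<le> (\<integral>\<^sup>+v. ennreal (max (f (vscale d C v)) (- real n) + real n) \<partial>V_product \<tau>)"
      by (rule convex_comparison[OF tau C key convex_fun_max[OF f]]) auto
  qed
qed

text \<open>The sign average of a seminorm is still homogeneous and convex, and it depends on the
  \<open>\<bar>x i\<bar>\<close> only, as \<open>key\<close> requires.\<close>

lemma seminorm_comparison:
  assumes tau: "0 < \<tau>"
    and key: "\<And>q. q \<in> borel_measurable PB \<Longrightarrow> abs_mono {..<d} q \<Longrightarrow>
      (\<And>x k. x \<in> {..<d} \<rightarrow>\<^sub>E UNIV \<Longrightarrow> 0 < k \<Longrightarrow> q (\<lambda>i\<in>{..<d}. x i / k) = q x / ennreal k) \<Longrightarrow>
      (\<integral>\<^sup>+x. q x \<partial>V_product \<tau>) < \<top> \<Longrightarrow> G E * (\<integral>\<^sup>+x. q x \<partial>V_product \<tau>) \<le> 2 * N q E"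
    and q: "seminorm d q"
  shows "ext_expectation (V_product \<tau>) q \<le> 2 * ext_expectation \<mu> q"
proof -
  have nonneg: "0 \<le> q x" if "x \<in> Rvec d" for x using q that by (auto simp: seminorm_def)
  have hom: "q (vscale d a x) = \<bar>a\<bar> * q x" if "x \<in> Rvec d" for a x using q that by (auto simp: seminorm_def)
  note cvx = seminorm_convex_fun[OF q]
  define g where "g = symm d q"
  have g_nonneg: "0 \<le> g x" if "x \<in> Rvec d" for x
    unfolding g_def using that by (intro symm_nonneg[of d q d, OF nonneg]) auto
  have gm: "g \<in> borel_measurable Borel"
    unfolding g_def by (intro convex_fun_measurable convex_fun_symm cvx) simp
  have eq_V: "(\<integral>\<^sup>+x. ennreal (g x) \<partial>V_product \<tau>) = (\<integral>\<^sup>+x. ennreal (q x) \<partial>V_product \<tau>)"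
    unfolding g_def by (rule nn_integral_symm[OF sets_V_product V_flip[OF tau] cvx nonneg order.refl])
  have eq_mu: "(\<integral>\<^sup>+x. ennreal (g x) \<partial>\<mu>) = (\<integral>\<^sup>+x. ennreal (q x) \<partial>\<mu>)"
    unfolding g_def by (rule nn_integral_symm[OF sets_mu mu_flip cvx nonneg order.refl])
  have zero: "(\<integral>\<^sup>+x. ennreal (- q x) \<partial>P) = 0" if "space P = Rvec d" for P
  proof -
    have "(\<integral>\<^sup>+x. ennreal (- q x) \<partial>P) = (\<integral>\<^sup>+x. 0 \<partial>P)"
      by (rule nn_integral_cong) (simp add: that nonneg ennreal_neg)
    then show ?thesis by simp
  qed
  define e :: "nat \<Rightarrow> nat \<Rightarrow> real" where "e i = (\<lambda>j\<in>{..<d}. if j = i then 1 else 0)" for i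
  have "(\<integral>\<^sup>+x. ennreal (q x) \<partial>V_product \<tau>) \<le> (\<integral>\<^sup>+x. ennreal (\<Sum>i<d. \<bar>x i\<bar> * q (e i)) \<partial>V_product \<tau>)"
    using seminorm_le_sum[OF q] by (intro nn_integral_mono ennreal_leI) (simp add: Rvec_def e_def)
  also have "\<dots> < \<top>"
  proof -
    have int: "integrable (V_product \<tau>) (\<lambda>x. \<Sum>i<d. \<bar>x i\<bar> * q (e i))"
      using V_coordinate_integrable[OF tau] by (intro Bochner_Integration.integrable_sum integrable_mult_left) auto
    have "0 \<le> (\<Sum>i<d. \<bar>x i\<bar> * q (e i))" for x
      by (intro sum_nonneg mult_nonneg_nonneg nonneg) (auto simp: e_def Rvec_def)
    then show ?thesis by (subst nn_integral_eq_integral[OF int]) auto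
  qed
  finally have finite: "(\<integral>\<^sup>+x. ennreal (g x) \<partial>V_product \<tau>) < \<top>" by (simp add: eq_V)
  have "G E * (\<integral>\<^sup>+x. ennreal (g x) \<partial>V_product \<tau>) \<le> 2 * N (\<lambda>x. ennreal (g x)) E"
  proof (rule key)
    show "(\<lambda>x. ennreal (g x)) \<in> borel_measurable PB" using gm by simp
    show "abs_mono {..<d} (\<lambda>x. ennreal (g x))"
      using abs_mono_symm[OF cvx] unfolding g_def abs_mono_def by (auto intro: ennreal_leI)
    fix x :: "nat \<Rightarrow> real" and k :: real assume x: "x \<in> {..<d} \<rightarrow>\<^sub>E UNIV" and k: "0 < k"
    have "(\<lambda>i\<in>{..<d}. x i / k) = vscale d (1 / k) x" by (auto simp: vscale_def)
    moreover have "g (vscale d (1 / k) x) = \<bar>1 / k\<bar> * g x"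
      unfolding g_def using x by (intro symm_vscale_hom hom) (auto simp: Rvec_def)
    ultimately show "ennreal (g (\<lambda>i\<in>{..<d}. x i / k)) = ennreal (g x) / ennreal k"
      using k x g_nonneg[of x] by (simp add: divide_ennreal Rvec_def)
  qed (rule finite)
  also have "\<dots> = G E * (2 * (\<integral>\<^sup>+x. ennreal (g x) \<partial>\<mu>))"
    using gm by (subst nn_integral_mu[symmetric]) (auto simp: mult_ac)
  finally have "(\<integral>\<^sup>+x. ennreal (q x) \<partial>V_product \<tau>) \<le> 2 * (\<integral>\<^sup>+x. ennreal (q x) \<partial>\<mu>)"
    using G_pos[OF E] G_finite[of E] by (simp add: ennreal_mult_le_mult_iff eq_V eq_mu)
  then have "enn2ereal (\<integral>\<^sup>+x. ennreal (q x) \<partial>V_product \<tau>) \<le> 2 * enn2ereal (\<integral>\<^sup>+x. ennreal (q x) \<partial>\<mu>)"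
    by (simp add: less_eq_ennreal.rep_eq times_ennreal.rep_eq)
  moreover have "(\<integral>\<^sup>+x. ennreal (- q x) \<partial>V_product \<tau>) = 0" "(\<integral>\<^sup>+x. ennreal (- q x) \<partial>\<mu>) = 0"
    by (rule zero, simp add: Rvec_def space_mu)+
  ultimately show ?thesis by (simp add: ext_expectation_def zero_ennreal.rep_eq)
qed

end

theorem theorem2p3:
  "\<exists>M::real. M \<ge> 1 \<and>
     (\<forall>(d::nat) (E::real) (lam::real) (\<phi> :: nat \<Rightarrow> real \<Rightarrow> real) (\<mu> :: (nat \<Rightarrow> real) measure).
        d \<ge> 1 \<longrightarrow> E > 0 \<longrightarrow> lam \<ge> 0 \<longrightarrow> (\<forall>i<d. admissible_phi (\<phi> i)) \<longrightarrow>
        is_law_X d E lam \<phi> \<mu> \<longrightarrow>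
        (\<exists>\<tau>>0. \<exists>\<nu> :: (nat \<Rightarrow> real) measure.
           is_law_V d lam \<tau> \<phi> \<nu> \<and>
           convex_order d \<mu> (\<lambda>x. x) \<nu> (\<lambda>v. vscale d (2 * M) v) \<and>
           (\<forall>q. seminorm d q \<longrightarrow> ext_expectation \<nu> q \<le> 2 * ext_expectation \<mu> q)))"
proof (rule exI[of _ "3 * 15000 ^ 10 / 2"], intro conjI allI impI)
  fix d :: nat and E lam :: real and \<phi> :: "nat \<Rightarrow> real \<Rightarrow> real" and \<mu> :: "(nat \<Rightarrow> real) measure"
  assume d: "d \<ge> 1" and E: "E > 0" and lam: "lam \<ge> 0" and adm: "\<forall>i<d. admissible_phi (\<phi> i)"
    and law: "is_law_X d E lam \<phi> \<mu>"
  \<comment> \<open>The locale asks for admissibility at every index, while \<open>\<phi> i\<close> is arbitrary for \<open>i \<ge> d\<close>.\<close>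
  define \<psi> :: "nat \<Rightarrow> real \<Rightarrow> real" where "\<psi> i = (if i < d then \<phi> i else (\<lambda>x. x))" for i
  have "admissible_phi (\<lambda>x::real. x)"
    by (auto simp: admissible_phi_def strict_mono_on_def filterlim_ident intro!: convex_onI)
  then have "admissible_phi (\<psi> i)" for i using adm by (simp add: \<psi>_def)
  moreover have "X_weight d E lam \<psi> = X_weight d E lam \<phi>"
    by (auto simp: X_weight_def \<psi>_def fun_eq_iff)
  then have "is_law_X d E lam \<psi> \<mu>" using law by (simp add: is_law_X_def)
  ultimately interpret gibbs_vector lam \<psi> d E \<mu>
    using d E lam by unfold_locales auto
  obtain \<tau> where \<tau>: "0 < \<tau>"
    and upper: "\<And>f. f \<in> borel_measurable PB \<Longrightarrow> abs_mono {..<d} f \<Longrightarrow>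
      N f E \<le> ennreal (3 * 15000 ^ 10) * (G E * (\<integral>\<^sup>+x. f x \<partial>V_product \<tau>))"
    and lower: "\<And>q. q \<in> borel_measurable PB \<Longrightarrow> abs_mono {..<d} q \<Longrightarrow>
      (\<And>x k. x \<in> {..<d} \<rightarrow>\<^sub>E UNIV \<Longrightarrow> 0 < k \<Longrightarrow> q (\<lambda>i\<in>{..<d}. x i / k) = q x / ennreal k) \<Longrightarrow>
      (\<integral>\<^sup>+x. q x \<partial>V_product \<tau>) < \<top> \<Longrightarrow> G E * (\<integral>\<^sup>+x. q x \<partial>V_product \<tau>) \<le> 2 * N q E"
    by (rule equivalence_parameter[OF E]) (rule that; blast)
  have "is_law_V d lam \<tau> \<phi> (V_product \<tau>)"
    using is_law_V_product[OF \<tau>] by (simp add: is_law_V_def \<psi>_def)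
  \<comment> \<open>The claim dilates by \<open>2 * M\<close>, so \<open>M\<close> is half of the
    constant in the convex order.\<close>
  moreover have "convex_order d \<mu> (\<lambda>x. x) (V_product \<tau>) (\<lambda>v. vscale d (2 * (3 * 15000 ^ 10 / 2)) v)"
    using convex_order_V_product[OF \<tau> _ upper] by simp
  moreover have "\<forall>q. seminorm d q \<longrightarrow> ext_expectation (V_product \<tau>) q \<le> 2 * ext_expectation \<mu> q"
    using seminorm_comparison[OF \<tau> lower] by blast
  ultimately show "\<exists>\<tau>>0. \<exists>\<nu> :: (nat \<Rightarrow> real) measure. is_law_V d lam \<tau> \<phi> \<nu> \<and>
      convex_order d \<mu> (\<lambda>x. x) \<nu> (\<lambda>v. vscale d (2 * (3 * 15000 ^ 10 / 2)) v) \<and>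
      (\<forall>q. seminorm d q \<longrightarrow> ext_expectation \<nu> q \<le> 2 * ext_expectation \<mu> q)"
    using \<tau> by blast
qed simp

end
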